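(* Let $z\in\mathbb{C}$, let $K$ be a kernel function on $\mathbb{R}^d\times\mathbb{R}^d$ such that for some $\alpha\in(0,1]$ $$\|r_K\|_1+\sup_{0<\delta\le 1}\delta^{-\alpha}\|r_{\omega_\delta(K)}\|_1+\sup_{0<\delta\le 1}\delta^{-\alpha}\|r_K\chi_{|\cdot|\le\delta}\|_1<\infty,$$ and let $T$ be the integral operator $Tf(x)=\int_{\mathbb{R}^d}K(x,y)f(y)\,dy$. If $zI-T$ has stability on $L^p_w$ for some $1\le p<\infty$ and some $A_p$-weight $w$, then $zI-T$ has stability on $L^{p'}_{w'}$ for all $1\le p'<\infty$ and all $A_{p'}$-weights $w'$.
   Context: $|x|:=\max_i|x_i|$ for $x\in\mathbb{R}^d$; $\|\cdot\|_1$ is the $L^1(\mathbb{R}^d)$ norm; $\chi_{|\cdot|\le\delta}$ is the indicator function of $\{x:|x|\le\delta\}$; $I$ is the identity operator. A kernel function is a measurable complex-valued function on $\mathbb{R}^d\times\mathbb{R}^d$. For a kernel $K$, $r_K(x):=\sup_{|y-y'|\ge|x|}|K(y,y')|$ for $x\in\mathbb{R}^d$. For $\delta>0$, the modified modulus of continuity is $\omega_\delta(K)(x,y)=\sup_{|x'-x|,|y'-y|\le\delta}|K(x',y')-K(x,y)|$ if $|x-y|\ge4\delta$, and $\omega_\delta(K)(x,y)=0$ otherwise. A weight is a positive locally integrable function on $\mathbb{R}^d$. For $1<p<\infty$, $w$ is an $A_p$-weight if there is $A<\infty$ with $\big(\frac1{|Q|}\int_Qw\big)\big(\frac1{|Q|}\int_Qw^{-1/(p-1)}\big)^{p-1}\le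 A$ for all cubes $Q$; $w$ is an $A_1$-weight if there is $A<\infty$ with $\frac1{|Q|}\int_Qw\le A\inf_{x\in Q}w(x)$ for all cubes $Q$. $L^p_w$ is the space of measurable $f$ on $\mathbb{R}^d$ with $\|f\|_{p,w}=(\int|f|^pw\,dx)^{1/p}<\infty$. When $\|r_K\|_1<\infty$, $T$ is a bounded operator on $L^p_w$ for every $1\le p<\infty$ and $A_p$-weight $w$. The operator $zI-T$ has stability on $L^p_w$ if there is a constant $C>0$ with $\|(zI-T)f\|_{p,w}\ge C\|f\|_{p,w}$ for all $f\in L^p_w$. *)

theory Defs
  imports "HOL-Analysis.Analysis"
begin

text \<open>
  The ambient space is \<open>real ^ 'n\<close>; the maximum norm is the library's \<^const>\<open>infnorm\<close>
  (see \<open>infnorm_cart\<close>). ``Measurable'' means Lebesgue measurable throughout.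
  Suprema, \<open>L\<^sup>1\<close> norms and weighted \<open>L\<^sup>p\<close> norms take values in \<^typ>\<open>ennreal\<close>, so that the
  value infinity is represented honestly.
\<close>

type_synonym 'n kernel = "real ^ 'n \<Rightarrow> real ^ 'n \<Rightarrow> complex"

definition kernel_function :: "'n::finite kernel \<Rightarrow> bool" where
  "kernel_function K \<longleftrightarrow> case_prod K \<in> borel_measurable lebesgue"

text \<open>
  \<open>r\<^sub>M\<close> for the modulus \<open>M\<close> of a kernel. It takes the modulus rather than the kernel because it is
  applied both to a complex kernel \<open>K\<close>, through \<open>kernel_abs K\<close>, and to the nonnegative
  (a priori infinite) kernel \<open>\<omega>\<^sub>\<delta>(K)\<close>.
\<close>
definition radial_sup ::
  "(real ^ 'n \<Rightarrow> real ^ 'n \<Rightarrow> ennreal) \<Rightarrow> real ^ 'n::finite \<Rightarrow> ennreal" where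
  "radial_sup M x = (SUP (y, y') \<in> {(y, y'). infnorm (y - y') \<ge> infnorm x}. M y y')"

definition kernel_abs :: "'n::finite kernel \<Rightarrow> real ^ 'n \<Rightarrow> real ^ 'n \<Rightarrow> ennreal" where
  "kernel_abs K x y = ennreal (cmod (K x y))"

definition mod_continuity ::
  "real \<Rightarrow> 'n::finite kernel \<Rightarrow> real ^ 'n \<Rightarrow> real ^ 'n \<Rightarrow> ennreal" where
  "mod_continuity \<delta> K x y =
     (if infnorm (x - y) \<ge> 4 * \<delta>
      then (SUP (x', y') \<in> {(x', y'). infnorm (x' - x) \<le> \<delta> \<and> infnorm (y' - y) \<le> \<delta>}.
              ennreal (cmod (K x' y' - K x y)))
      else 0)"

definition L1_norm :: "(real ^ 'n::finite \<Rightarrow> ennreal) \<Rightarrow> ennreal" where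
  "L1_norm g = (\<integral>\<^sup>+ x. g x \<partial>lebesgue)"

text \<open>Powers of extended nonnegative reals; only meaningful for exponents \<open>a > 0\<close>.\<close>
definition epowr :: "ennreal \<Rightarrow> real \<Rightarrow> ennreal" where
  "epowr t a = (if t = \<infinity> then \<infinity> else ennreal (enn2real t powr a))"

definition weight :: "(real ^ 'n::finite \<Rightarrow> real) \<Rightarrow> bool" where
  "weight w \<longleftrightarrow> (\<forall>x. w x > 0) \<and> (\<forall>S. compact S \<longrightarrow> w absolutely_integrable_on S)"

text \<open>Closed axis-parallel cubes, as balls of the maximum norm.\<close>
definition cubes :: "(real ^ 'n::finite) set set" where
  "cubes = {{x. infnorm (x - c) \<le> r} | c r. r > 0}"

definition average :: "(real ^ 'n) set \<Rightarrow> (real ^ 'n::finite \<Rightarrow> real) \<Rightarrow> ennreal" where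
  "average Q g = (\<integral>\<^sup>+ x \<in> Q. ennreal (g x) \<partial>lebesgue) / emeasure lebesgue Q"

definition Ap_weight :: "real \<Rightarrow> (real ^ 'n::finite \<Rightarrow> real) \<Rightarrow> bool" where
  "Ap_weight p w \<longleftrightarrow> weight w \<and>
     (if p = 1
      then (\<exists>A::real. \<forall>Q\<in>cubes. average Q w \<le> ennreal A * ennreal (INF x\<in>Q. w x))
      else (\<exists>A::real. \<forall>Q\<in>cubes.
              average Q w * epowr (average Q (\<lambda>x. w x powr (- 1 / (p - 1)))) (p - 1) \<le> ennreal A))"

definition Lp_norm ::
  "real \<Rightarrow> (real ^ 'n \<Rightarrow> real) \<Rightarrow> (real ^ 'n::finite \<Rightarrow> complex) \<Rightarrow> ennreal" where
  "Lp_norm p w f = epowr (\<integral>\<^sup>+ x. ennreal (cmod (f x) powr p * w x) \<partial>lebesgue) (1 / p)"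

definition Lp_space ::
  "real \<Rightarrow> (real ^ 'n::finite \<Rightarrow> real) \<Rightarrow> (real ^ 'n \<Rightarrow> complex) set" where
  "Lp_space p w = {f \<in> borel_measurable lebesgue. Lp_norm p w f < \<infinity>}"

definition integral_operator ::
  "'n::finite kernel \<Rightarrow> (real ^ 'n \<Rightarrow> complex) \<Rightarrow> real ^ 'n \<Rightarrow> complex" where
  "integral_operator K f x = (LINT y|lebesgue. K x y * f y)"

definition has_stability ::
  "((real ^ 'n::finite \<Rightarrow> complex) \<Rightarrow> real ^ 'n \<Rightarrow> complex) \<Rightarrow> real \<Rightarrow> (real ^ 'n \<Rightarrow> real) \<Rightarrow> bool" where
  "has_stability S p w \<longleftrightarrow>
     (\<exists>C::real. C > 0 \<and> (\<forall>f \<in> Lp_space p w. Lp_norm p w (S f) \<ge> ennreal C * Lp_norm p w f))"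

end

theory Submission
  imports Defs
begin

text \<open>
  If \<open>z = 0\<close>, the hypotheses on the modulus of continuity and on the diagonal make \<open>T\<close> small on a mean
  zero bump supported in a cube of side \<open>\<delta> \<rightarrow> 0\<close>, so stability is impossible.

  Let \<open>z \<noteq> 0\<close>; then only the integrability of \<open>r\<^sub>K\<close> matters. An integral operator with a radially
  decreasing integrable majorant \<open>\<rho>\<close> is bounded on every \<open>L\<^sup>q\<^sub>v\<close> with norm at most a constant
  (depending on \<open>q\<close> and \<open>v\<close>) times \<open>\<parallel>\<rho>\<parallel>\<^sub>1\<close>: dyadically, it is a combination of averages over balls, which the
  \<open>A\<^sub>q\<close> condition controls. Split \<open>K\<close> into a near part of small mass and a far part with bounded
  majorant. Given a bounded \<open>f\<close> and \<open>g = (z - T) f\<close>, put \<open>G = (z - T\<^sub>n\<^sub>e\<^sub>a\<^sub>r)\<^sup>-\<^sup>1 g\<close> and \<open>h = f - G\<close>, so that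
  \<open>(z - T) h = T\<^sub>f\<^sub>a\<^sub>r G\<close> is locally bounded by a radial convolution of \<open>\<bar>G\<bar>\<close>. Let \<open>\<alpha>(x)\<close> be the normalised
  \<open>L\<^sup>p\<^sub>w\<close> norm of \<open>h\<close> on the cell of side \<open>N\<close> containing \<open>x\<close>. Stability on \<open>L\<^sup>p\<^sub>w\<close>, applied to \<open>h\<close> times a
  cutoff at scale \<open>N\<close>, gives a pointwise inequality \<open>\<alpha> \<le> C U + \<rho>\<^sub>N * \<alpha>\<close> with \<open>\<parallel>\<rho>\<^sub>N\<parallel>\<^sub>1 \<rightarrow> 0\<close>. In it the weight \<open>w\<close>
  no longer appears, so it can be integrated against any other weight \<open>v\<close> and the last term absorbed
  for large \<open>N\<close>; \<open>\<alpha>\<close> in turn controls \<open>T\<^sub>f\<^sub>a\<^sub>r h\<close> and hence \<open>h\<close>.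

  All estimates are for \<open>q\<close>-th powers of norms with values in \<^typ>\<open>ennreal\<close>, using
  \<open>(a + b)\<^sup>q \<le> 2\<^sup>q (a\<^sup>q + b\<^sup>q)\<close> in place of Minkowski's inequality.
\<close>

text \<open>The obstacle is that the norms of L^p_w and L^q_v cannot be compared, not even locally.
  Applied to \<open>f\<close> itself, the cutoff argument would leave local L^p_w norms of
  \<open>g\<close> on the right, over which the L^q_v norm of \<open>g\<close> gives no control.
  Subtracting \<open>G\<close> repairs this: on a whole cell, the far part of the operator applied
  to \<open>G\<close> is bounded by a single value of a radial convolution of |G|, and a locally
  bounded function has every normalised local norm under control, whatever the weight. On the way
  back from the local norms of \<open>h\<close>, only unweighted cell averages of |h| are needed,
  because the majorant of the far kernel can be shifted by the width of a cell at finite cost; the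
  A_p condition bounds these averages by the local norms. Absorption is done by iteration and not by
  subtraction, since the term to be absorbed may be infinite: for bounded \<open>f\<close> the
  functions \<open>G\<close>, \<open>h\<close> and the local norms of \<open>h\<close> are bounded,
  but their L^q_v norms need not be finite. All majorants are kept decreasing, because only then is
  the dyadic sum controlled by the mass.\<close>

section \<open>Powers of extended nonnegative reals\<close>

lemma epowr_0 [simp]: "epowr 0 a = 0"
  by (simp add: epowr_def)

lemma epowr_top [simp]: "epowr top a = top"
  by (simp add: epowr_def)

lemma epowr_1 [simp]: "epowr t 1 = t"
  by (cases t) (auto simp: epowr_def)

lemma epowr_one [simp]: "epowr 1 a = 1"
  by (simp add: epowr_def)

lemma epowr_ennreal: "0 \<le> x \<Longrightarrow> epowr (ennreal x) a = ennreal (x powr a)"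
  by (simp add: epowr_def)

lemma epowr_mono:
  assumes "0 < a" "s \<le> t"
  shows "epowr s a \<le> epowr t a"
proof (cases t)
  case (real y)
  then obtain x where "s = ennreal x" "0 \<le> x"
    using assms(2) by (cases s) (auto simp: top_unique)
  then show ?thesis
    using real assms by (auto simp: epowr_ennreal intro!: ennreal_leI powr_mono2)
qed simp

lemma epowr_epowr:
  assumes "0 < a" "0 < b"
  shows "epowr (epowr t a) b = epowr t (a * b)"
  by (cases t) (auto simp: epowr_ennreal powr_powr)

lemma epowr_inverse [simp]:
  assumes "0 < a"
  shows "epowr (epowr t a) (1 / a) = t" "epowr (epowr t (1 / a)) a = t"
  using assms by (auto simp: epowr_epowr)

lemma epowr_le_iff:
  assumes "0 < a"
  shows "epowr s a \<le> epowr t a \<longleftrightarrow> s \<le> t"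
  using epowr_mono[of "1 / a" "epowr s a" "epowr t a"] epowr_mono[of a s t] assms by auto

lemma epowr_eq_0_iff [simp]: "0 < a \<Longrightarrow> epowr t a = 0 \<longleftrightarrow> t = 0"
  by (cases t) (auto simp: epowr_ennreal)

lemma epowr_eq_top_iff [simp]: "epowr t a = top \<longleftrightarrow> t = top"
  by (cases t) (auto simp: epowr_ennreal)

lemma epowr_less_top_iff [simp]: "epowr t a < top \<longleftrightarrow> t < top"
  by (simp add: less_top[symmetric] top.not_eq_extremum[symmetric])

lemma epowr_mult:
  assumes "0 < a"
  shows "epowr (s * t) a = epowr s a * epowr t a"
proof (cases s; cases t)
  fix x y :: real
  assume *: "s = ennreal x" "0 \<le> x" "t = ennreal y" "0 \<le> y"
  have "epowr (s * t) a = ennreal ((x * y) powr a)"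
    using * by (simp add: epowr_ennreal flip: ennreal_mult)
  also have "\<dots> = epowr s a * epowr t a"
    using * by (simp add: epowr_ennreal powr_mult ennreal_mult)
  finally show ?thesis .
qed (use assms in \<open>auto simp: ennreal_mult_top ennreal_top_mult epowr_ennreal\<close>)

lemma epowr_max: "0 < a \<Longrightarrow> epowr (max s t) a = max (epowr s a) (epowr t a)"
  by (auto simp: max_def epowr_le_iff)

lemma epowr_add_le:
  assumes "0 < a"
  shows "epowr (s + t) a \<le> ennreal (2 powr a) * (epowr s a + epowr t a)"
proof -
  have "s + t \<le> 2 * max s t"
    by (metis add_mono max.cobounded1 max.cobounded2 mult_2)
  then have "epowr (s + t) a \<le> epowr (2 * max s t) a"
    using assms by (rule epowr_mono[rotated])
  also have "\<dots> = ennreal (2 powr a) * epowr (max s t) a"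
    using assms epowr_ennreal[of 2 a] by (simp add: epowr_mult)
  also have "\<dots> \<le> ennreal (2 powr a) * (epowr s a + epowr t a)"
    using assms by (intro mult_left_mono) (auto simp: epowr_max max_def add_increasing)
  finally show ?thesis .
qed

lemma epowr_SUP:
  assumes "0 < a" "I \<noteq> {}"
  shows "epowr (SUP i\<in>I. f i) a = (SUP i\<in>I. epowr (f i) a)"
proof (rule antisym)
  have "f i \<le> epowr (SUP i\<in>I. epowr (f i) a) (1 / a)" if "i \<in> I" for i
  proof -
    have "epowr (f i) a \<le> (SUP i\<in>I. epowr (f i) a)"
      using that by (rule SUP_upper)
    then show ?thesis
      using assms epowr_mono[of "1 / a" "epowr (f i) a"] by simp
  qed
  then have "(SUP i\<in>I. f i) \<le> epowr (SUP i\<in>I. epowr (f i) a) (1 / a)"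
    by (rule SUP_least)
  then show "epowr (SUP i\<in>I. f i) a \<le> (SUP i\<in>I. epowr (f i) a)"
    using assms epowr_mono[of a] by fastforce
  show "(SUP i\<in>I. epowr (f i) a) \<le> epowr (SUP i\<in>I. f i) a"
    using assms by (intro SUP_least epowr_mono SUP_upper)
qed

lemma measurable_epowr [measurable]: "(\<lambda>t. epowr t a) \<in> borel_measurable borel"
  unfolding epowr_def by measurable

text \<open>By convexity the graph of t^p lies above its tangent at \<open>s\<close>; solved for
  \<open>t\<close>, this is the bound, with equality at \<open>t = s\<close>. Integrating it with a
  suitable \<open>s\<close> yields Jensen's inequality.\<close>

lemma epowr_tangent:
  assumes p: "1 \<le> p" and s: "0 < s"
  shows "t \<le> ennreal (s powr (1 - p) / p) * epowr t p + ennreal (s * (1 - 1 / p))"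
proof (cases t)
  case (real x)
  have "x \<le> s powr (1 - p) / p * x powr p + s * (1 - 1 / p)"
  proof (cases "x = 0")
    case False
    then have x: "0 < x" using real by simp
    have "((x / s) powr p) powr (1 / p) * 1 powr (1 - 1 / p)
        \<le> 1 / p * (x / s) powr p + (1 - 1 / p) * 1"
      using p s x by (intro Youngs_inequality_0) auto
    then have "x / s \<le> 1 / p * (x / s) powr p + (1 - 1 / p)"
      using p s x by (simp add: powr_powr)
    then have "s * (x / s) \<le> s * (1 / p * (x / s) powr p + (1 - 1 / p))"
      using s by (intro mult_left_mono) auto
    also have "\<dots> = s powr (1 - p) / p * x powr p + s * (1 - 1 / p)"
      using s x p by (simp add: powr_diff powr_divide field_simps)
    finally show ?thesis
      using s by simp
  qed (use p s in auto)
  then show ?thesis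
    using real p s by (auto simp: epowr_ennreal simp flip: ennreal_mult ennreal_plus)
qed (use p s in \<open>auto simp: ennreal_mult_top\<close>)

text \<open>Multiplying through by the total mass avoids the exponent \<open>p - 1\<close>, which is \<open>0\<close> for \<open>p = 1\<close>.\<close>
lemma nn_integral_Jensen:
  assumes [measurable]: "f \<in> borel_measurable M" and p: "1 \<le> p"
    and fin: "emeasure M (space M) < top"
  shows "epowr (\<integral>\<^sup>+x. f x \<partial>M) p * emeasure M (space M)
    \<le> epowr (emeasure M (space M)) p * (\<integral>\<^sup>+x. epowr (f x) p \<partial>M)"
proof -
  let ?F = "\<integral>\<^sup>+x. epowr (f x) p \<partial>M"
  obtain m where m: "emeasure M (space M) = ennreal m" "0 \<le> m"
    using fin by (cases "emeasure M (space M)") auto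
  consider "m = 0" | "0 < m" "?F = 0" | "0 < m" "?F = top" | F where "0 < m" "?F = ennreal F" "0 < F"
    using m by (cases ?F) (auto simp: less_le)
  then show ?thesis
  proof cases
    case 2
    then have "AE x in M. epowr (f x) p = 0"
      by (subst (asm) nn_integral_0_iff_AE) auto
    then have "(\<integral>\<^sup>+x. f x \<partial>M) = 0"
      using p by (subst nn_integral_0_iff_AE) auto
    then show ?thesis by simp
  next
    case 4
    \<comment> \<open>The tangent point is the \<open>p\<close>-mean of \<open>f\<close>: since
      \<open>s powr p = F / m\<close>, the two integrated terms add up to
      \<open>s * m\<close>.\<close>
    define s where "s = (F / m) powr (1 / p)"
    have s: "0 < s" and sp: "s powr p = F / m"
      using 4 p by (auto simp: s_def powr_powr)
    have "(\<integral>\<^sup>+x. f x \<partial>M)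
        \<le> (\<integral>\<^sup>+x. ennreal (s powr (1 - p) / p) * epowr (f x) p + ennreal (s * (1 - 1 / p)) \<partial>M)"
      using p s by (intro nn_integral_mono epowr_tangent)
    also have "\<dots> = ennreal (s powr (1 - p) / p) * ennreal F + ennreal (s * (1 - 1 / p)) * ennreal m"
      using p s 4 m by (subst nn_integral_add) (auto simp: nn_integral_cmult)
    also have "\<dots> = ennreal (s powr (1 - p) / p * F + s * (1 - 1 / p) * m)"
      using p s 4 m by (simp flip: ennreal_mult ennreal_plus)
    also have "s powr (1 - p) / p * F + s * (1 - 1 / p) * m = s * m"
    proof -
      have "s powr (1 - p) * F = s * m"
        using sp 4 s by (simp add: powr_diff field_simps)
      then have "s powr (1 - p) / p * F = s * m / p"
        by simp
      then show ?thesis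
        using p by (simp add: field_simps)
    qed
    finally have "epowr (\<integral>\<^sup>+x. f x \<partial>M) p \<le> epowr (ennreal (s * m)) p"
      using p by (intro epowr_mono) auto
    then have "epowr (\<integral>\<^sup>+x. f x \<partial>M) p * ennreal m \<le> ennreal ((s * m) powr p) * ennreal m"
      using s m by (intro mult_right_mono) (auto simp: epowr_ennreal)
    also have "\<dots> = ennreal (m powr p) * ennreal F"
      using s m sp 4 by (simp add: powr_mult field_simps flip: ennreal_mult)
    finally show ?thesis
      using 4 m by (simp add: epowr_ennreal)
  qed (use m in \<open>auto simp: epowr_ennreal ennreal_mult_top\<close>)
qed

section \<open>Radial kernels and their mass\<close>

lemma infnorm_le_iff: "infnorm (x :: real ^ 'n::finite) \<le> t \<longleftrightarrow> (\<forall>i. \<bar>x $ i\<bar> \<le> t)"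
  unfolding infnorm_Max by (auto simp: Basis_vec_def inner_axis)

lemma infnorm_less_iff: "infnorm (x :: real ^ 'n::finite) < t \<longleftrightarrow> (\<forall>i. \<bar>x $ i\<bar> < t)"
  unfolding infnorm_Max by (auto simp: Basis_vec_def inner_axis)

lemma infnorm_triangle_sub: "infnorm (x - z) \<le> infnorm (x - y) + infnorm (y - z :: real ^ 'n::finite)"
  using infnorm_triangle[of "x - y" "y - z"] by simp

lemma measurable_infnorm [measurable]:
  "infnorm \<in> borel_measurable (borel :: (real ^ 'n::finite) measure)"
  by (intro borel_measurable_continuous_onI continuous_intros)

lemma infnorm_cball_eq_cbox:
  "{y. infnorm (x - y :: real ^ 'n::finite) \<le> t} = cbox (x - (\<chi> i. t)) (x + (\<chi> i. t))"
  by (auto simp: infnorm_le_iff mem_box_cart abs_le_iff) (smt (verit))+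

lemma emeasure_infnorm_cball:
  assumes "0 \<le> t"
  shows "emeasure lborel {y. infnorm (x - y :: real ^ 'n::finite) \<le> t} = ennreal ((2 * t) ^ CARD('n))"
proof -
  have "(\<Prod>b\<in>Basis. (x + (\<chi> i. t) - (x - (\<chi> i. t))) \<bullet> b) = (\<Prod>b\<in>(Basis :: (real ^ 'n) set). 2 * t)"
    by (intro prod.cong) (auto simp: Basis_vec_def inner_axis)
  moreover have "\<forall>b\<in>Basis. (x - (\<chi> i. t)) \<bullet> b \<le> (x + (\<chi> i. t)) \<bullet> b"
    using assms by (auto simp: Basis_vec_def inner_axis)
  ultimately show ?thesis
    by (simp only: infnorm_cball_eq_cbox emeasure_lborel_cbox_eq if_True prod_constant) simp
qed

lemma emeasure_infnorm_ball:
  assumes "0 \<le> t"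
  shows "emeasure lborel {y. infnorm (x - y :: real ^ 'n::finite) < t} = ennreal ((2 * t) ^ CARD('n))"
proof -
  have "{y. infnorm (x - y) < t} = box (x - (\<chi> i. t)) (x + (\<chi> i. t))"
    by (auto simp: infnorm_less_iff mem_box_cart abs_less_iff) (smt (verit))+
  moreover have "(\<Prod>b\<in>Basis. (x + (\<chi> i. t) - (x - (\<chi> i. t))) \<bullet> b) = (\<Prod>b\<in>(Basis :: (real ^ 'n) set). 2 * t)"
    by (intro prod.cong) (auto simp: Basis_vec_def inner_axis)
  moreover have "\<forall>b\<in>Basis. (x - (\<chi> i. t)) \<bullet> b \<le> (x + (\<chi> i. t)) \<bullet> b"
    using assms by (auto simp: Basis_vec_def inner_axis)
  ultimately show ?thesis
    by (simp only: emeasure_lborel_box_eq if_True prod_constant) simp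
qed

lemma nn_integral_lborel_affine:
  fixes f :: "real ^ 'n::finite \<Rightarrow> ennreal"
  assumes [measurable]: "f \<in> borel_measurable borel" and c: "c \<noteq> 0"
  shows "(\<integral>\<^sup>+x. f x \<partial>lborel) = ennreal (\<bar>c\<bar> ^ CARD('n)) * (\<integral>\<^sup>+x. f (t + c *\<^sub>R x) \<partial>lborel)"
  by (subst lborel_affine[OF c, of t])
    (simp add: nn_integral_density nn_integral_distr nn_integral_cmult)

text \<open>The kernel is given by its profile, a function of the radius, so that decrease is
  \<open>antimono\<close> over the reals and truncation and dilation act on one variable.\<close>

definition radconv :: "(real \<Rightarrow> ennreal) \<Rightarrow> (real ^ 'n::finite \<Rightarrow> ennreal) \<Rightarrow> real ^ 'n \<Rightarrow> ennreal" where
  "radconv \<rho> \<phi> x = (\<integral>\<^sup>+y. \<rho> (infnorm (x - y)) * \<phi> y \<partial>lborel)"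

definition radmass :: "'n::finite itself \<Rightarrow> (real \<Rightarrow> ennreal) \<Rightarrow> ennreal" where
  "radmass _ \<rho> = (\<integral>\<^sup>+x. \<rho> (infnorm (x :: real ^ 'n)) \<partial>lborel)"

lemma measurable_radconv [measurable]:
  assumes [measurable]: "\<rho> \<in> borel_measurable borel" "\<phi> \<in> borel_measurable borel"
  shows "radconv \<rho> \<phi> \<in> borel_measurable borel"
  unfolding radconv_def by measurable

lemma radconv_mono:
  assumes "\<And>y. \<phi> y \<le> \<psi> y"
  shows "radconv \<rho> \<phi> x \<le> radconv \<rho> \<psi> x"
  unfolding radconv_def by (intro nn_integral_mono mult_left_mono assms) simp

lemma radconv_mono_AE:
  assumes "AE y in lborel. \<phi> y \<le> \<psi> y"
  shows "radconv \<rho> \<phi> x \<le> radconv \<rho> \<psi> x"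
  unfolding radconv_def using assms by (intro nn_integral_mono_AE) (auto elim!: eventually_mono intro: mult_left_mono)

lemma radconv_mono_kernel:
  assumes "\<And>t. 0 \<le> t \<Longrightarrow> \<rho> t \<le> \<sigma> t"
  shows "radconv \<rho> \<phi> x \<le> radconv \<sigma> \<phi> x"
  unfolding radconv_def by (intro nn_integral_mono mult_right_mono assms infnorm_pos_le) simp

lemma radconv_add:
  assumes [measurable]: "\<rho> \<in> borel_measurable borel" "\<phi> \<in> borel_measurable borel" "\<psi> \<in> borel_measurable borel"
  shows "radconv \<rho> (\<lambda>y. \<phi> y + \<psi> y) x = radconv \<rho> \<phi> x + radconv \<rho> \<psi> x"
  unfolding radconv_def by (simp add: distrib_left nn_integral_add)

lemma radconv_cmult:
  assumes [measurable]: "\<rho> \<in> borel_measurable borel" "\<phi> \<in> borel_measurable borel"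
  shows "radconv \<rho> (\<lambda>y. c * \<phi> y) x = c * radconv \<rho> \<phi> x"
  unfolding radconv_def by (simp add: mult.left_commute nn_integral_cmult)

lemma radconv_add_kernel:
  assumes [measurable]: "\<rho> \<in> borel_measurable borel" "\<sigma> \<in> borel_measurable borel" "\<phi> \<in> borel_measurable borel"
  shows "radconv (\<lambda>t. \<rho> t + \<sigma> t) \<phi> x = radconv \<rho> \<phi> x + radconv \<sigma> \<phi> x"
  unfolding radconv_def by (simp add: distrib_right nn_integral_add)

lemma radconv_cmult_kernel:
  assumes [measurable]: "\<rho> \<in> borel_measurable borel" "\<phi> \<in> borel_measurable borel"
  shows "radconv (\<lambda>t. c * \<rho> t) \<phi> x = c * radconv \<rho> \<phi> x"
  unfolding radconv_def by (simp add: mult.assoc nn_integral_cmult)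

lemma radconv_const:
  fixes x :: "real ^ 'n::finite"
  assumes [measurable]: "\<rho> \<in> borel_measurable borel"
  shows "radconv \<rho> (\<lambda>_. c) x = radmass TYPE('n) \<rho> * c"
proof -
  have "(\<integral>\<^sup>+y. \<rho> (infnorm (y :: real ^ 'n)) \<partial>lborel) = (\<integral>\<^sup>+y. \<rho> (infnorm (x - y)) \<partial>lborel)"
    using nn_integral_lborel_affine[of "\<lambda>y. \<rho> (infnorm y)" "-1" x] by simp
  then show ?thesis
    by (simp add: radconv_def radmass_def nn_integral_multc)
qed

lemma radmass_mono:
  assumes "\<And>t. 0 \<le> t \<Longrightarrow> \<rho> t \<le> \<sigma> t"
  shows "radmass T \<rho> \<le> radmass T \<sigma>"
  unfolding radmass_def by (intro nn_integral_mono assms infnorm_pos_le)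

lemma radmass_add:
  assumes [measurable]: "\<rho> \<in> borel_measurable borel" "\<sigma> \<in> borel_measurable borel"
  shows "radmass T (\<lambda>t. \<rho> t + \<sigma> t) = radmass T \<rho> + radmass T \<sigma>"
  unfolding radmass_def by (simp add: nn_integral_add)

lemma radmass_cmult:
  assumes [measurable]: "\<rho> \<in> borel_measurable borel"
  shows "radmass T (\<lambda>t. c * \<rho> t) = c * radmass T \<rho>"
  unfolding radmass_def by (simp add: nn_integral_cmult)

lemma radmass_scale:
  assumes [measurable]: "\<rho> \<in> borel_measurable borel" and a: "0 < a"
  shows "radmass TYPE('n::finite) (\<lambda>t. \<rho> (t / a)) = ennreal (a ^ CARD('n)) * radmass TYPE('n) \<rho>"
  unfolding radmass_def
  by (subst nn_integral_lborel_affine[of _ a 0]) (use a in \<open>simp_all add: infnorm_mul\<close>)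

lemma radmass_indicator:
  assumes "0 \<le> t"
  shows "radmass TYPE('n::finite) (indicator {..t}) = ennreal ((2 * t) ^ CARD('n))"
proof -
  have "radmass TYPE('n) (indicator {..t}) = (\<integral>\<^sup>+x. indicator {y :: real ^ 'n. infnorm (0 - y) \<le> t} x \<partial>lborel)"
    unfolding radmass_def by (intro nn_integral_cong) (auto simp: indicator_def infnorm_neg)
  also have "\<dots> = emeasure lborel {y :: real ^ 'n. infnorm (0 - y) \<le> t}"
    by (rule nn_integral_indicator) measurable
  finally show ?thesis
    using emeasure_infnorm_cball[OF assms, of 0] by simp
qed

text \<open>The superlevel sets are intervals. Decreasing profiles thus bring their own
  measurability.\<close>

lemma measurable_antimono:
  fixes \<rho> :: "real \<Rightarrow> ennreal"
  assumes "antimono \<rho>"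
  shows "\<rho> \<in> borel_measurable borel"
proof (rule borel_measurableI_greater)
  fix y
  have "is_interval {x. y < \<rho> x}"
    unfolding is_interval_1
  proof (intro ballI allI impI)
    fix a b x assume "a \<in> {x. y < \<rho> x}" "b \<in> {x. y < \<rho> x}" "a \<le> x \<and> x \<le> b"
    then show "x \<in> {x. y < \<rho> x}"
      using antimonoD[OF assms, of x b] by (simp add: less_le_trans)
  qed
  then show "{x \<in> space borel. y < \<rho> x} \<in> sets borel"
    by (auto intro: real_interval_borel_measurable)
qed

section \<open>Dyadic shells and the mass of a decreasing profile\<close>

text \<open>In dimension d the shell has volume (2t)^d - t^d, which is at least t^d. A term
  \<rho>(t) t^d can therefore be charged to a region where a decreasing \<rho> is at least
  \<rho>(t).\<close>

lemma radmass_shell: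
  assumes t: "0 < t"
  shows "ennreal (t ^ CARD('n)) \<le> radmass TYPE('n::finite) (indicator {t / 2<..t})"
proof -
  let ?B = "\<lambda>t. {y :: real ^ 'n. infnorm (0 - y) \<le> t}"
  have [measurable]: "?B s \<in> sets borel" for s
    by measurable
  have "(2 * t) ^ CARD('n) - t ^ CARD('n) = (2 ^ CARD('n) - 1) * t ^ CARD('n)"
    by (simp add: power_mult_distrib algebra_simps)
  moreover have "(1::real) \<le> 2 ^ CARD('n) - 1"
    using power_increasing[of 1 "CARD('n)" "2::real"] by (simp add: Suc_leI)
  ultimately have "t ^ CARD('n) \<le> (2 * t) ^ CARD('n) - t ^ CARD('n)"
    using t mult_right_mono[of 1 "2 ^ CARD('n) - 1" "t ^ CARD('n)"] by simp
  then have "ennreal (t ^ CARD('n)) \<le> ennreal ((2 * t) ^ CARD('n)) - ennreal (t ^ CARD('n))"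
    using t by (subst ennreal_minus) (auto intro: ennreal_leI)
  also have "\<dots> = emeasure lborel (?B t) - emeasure lborel (?B (t / 2))"
    using t emeasure_infnorm_cball[of t "0 :: real ^ 'n"] emeasure_infnorm_cball[of "t / 2" "0 :: real ^ 'n"]
    by simp
  also have "\<dots> = emeasure lborel (?B t - ?B (t / 2))"
    using t emeasure_infnorm_cball[of "t / 2" "0 :: real ^ 'n"]
    by (subst emeasure_Diff) auto
  also have "\<dots> = (\<integral>\<^sup>+x. indicator (?B t - ?B (t / 2)) x \<partial>lborel)"
    by (rule nn_integral_indicator[symmetric]) measurable
  also have "\<dots> = radmass TYPE('n) (indicator {t / 2<..t})"
    unfolding radmass_def by (intro nn_integral_cong) (auto simp: indicator_def infnorm_neg)
  finally show ?thesis .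
qed

text \<open>The term with k = floor(log 2 t) alone suffices. Sums over the integers are written as
  integrals over \<open>count_space\<close>, so that they can be exchanged with integrals over
  space.\<close>

lemma antimono_pointwise_le_dyadic:
  assumes "antimono \<rho>" "0 < t"
  shows "(\<rho> t :: ennreal) \<le> (\<integral>\<^sup>+k. \<rho> (2 powr real_of_int k) * indicator {..2 powr real_of_int (k + 1)} t \<partial>count_space UNIV)"
proof -
  define k where "k = \<lfloor>log 2 t\<rfloor>"
  have "2 powr real_of_int k \<le> t"
    using assms by (simp add: k_def le_log_iff[symmetric])
  moreover have "t \<le> 2 powr real_of_int (k + 1)"
    using assms by (simp add: k_def log_le_iff[symmetric])
  ultimately have "\<rho> t \<le> \<rho> (2 powr real_of_int k) * indicator {..2 powr real_of_int (k + 1)} t"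
    using antimonoD[OF assms(1) \<open>2 powr real_of_int k \<le> t\<close>] by simp
  also have "\<dots> \<le> (\<integral>\<^sup>+k. \<rho> (2 powr real_of_int k) * indicator {..2 powr real_of_int (k + 1)} t \<partial>count_space UNIV)"
    by (rule nn_integral_ge_point) simp
  finally show ?thesis .
qed

text \<open>The half-open shells are disjoint, so at most one term survives, and it takes \<rho> at
  the outer radius of its shell.\<close>

lemma dyadic_le_antimono_pointwise:
  assumes "antimono \<rho>"
  shows "(\<integral>\<^sup>+k. \<rho> (2 powr real_of_int k) * indicator {2 powr real_of_int k / 2<..2 powr real_of_int k} t \<partial>count_space UNIV)
    \<le> (\<rho> t :: ennreal)"
proof (cases "\<exists>k::int. 2 powr real_of_int k / 2 < t \<and> t \<le> 2 powr real_of_int k")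
  case True
  then obtain k :: int where k: "2 powr real_of_int k / 2 < t" "t \<le> 2 powr real_of_int k"
    by blast
  have unique: "j = k" if "2 powr real_of_int j / 2 < t" "t \<le> 2 powr real_of_int j" for j
  proof -
    have "2 powr real_of_int (j - 1) < 2 powr real_of_int k" "2 powr real_of_int (k - 1) < 2 powr real_of_int j"
      using that k by (auto simp: powr_diff)
    then have "j - 1 < k" "k - 1 < j"
      using powr_less_cancel_iff[where x = "2::real"] by (simp_all only: of_int_less_iff)
    then show ?thesis by linarith
  qed
  have "\<rho> (2 powr real_of_int j) * indicator {2 powr real_of_int j / 2<..2 powr real_of_int j} t
      = \<rho> (2 powr real_of_int k) * indicator {k} j" for j
  proof (cases "j = k")
    case True
    then show ?thesis
      using k by (simp only: indicator_simps greaterThanAtMost_iff insertI1 simp_thms mult_1_right)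
  next
    case False
    then have "t \<notin> {2 powr real_of_int j / 2<..2 powr real_of_int j}"
      using unique[of j] by (meson greaterThanAtMost_iff)
    then show ?thesis
      using False by simp
  qed
  then have "(\<integral>\<^sup>+k. \<rho> (2 powr real_of_int k) * indicator {2 powr real_of_int k / 2<..2 powr real_of_int k} t \<partial>count_space UNIV)
      = \<rho> (2 powr real_of_int k)"
    by (simp add: nn_integral_cmult_indicator)
  also have "\<dots> \<le> \<rho> t"
    using antimonoD[OF assms k(2)] .
  finally show ?thesis .
next
  case False
  then have "t \<notin> {2 powr real_of_int k / 2<..2 powr real_of_int k}" for k
    by (meson greaterThanAtMost_iff)
  then show ?thesis
    by simp
qed

text \<open>The k-th term is charged to the k-th shell by \<open>radmass_shell\<close>; then sum and
  integral are exchanged.\<close>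

lemma dyadic_sum_le_radmass:
  assumes \<rho>: "antimono \<rho>"
  shows "(\<integral>\<^sup>+k. \<rho> (2 powr real_of_int k) * ennreal ((2 powr real_of_int k) ^ CARD('n)) \<partial>count_space UNIV)
    \<le> radmass TYPE('n::finite) \<rho>"
proof -
  note [measurable] = measurable_antimono[OF \<rho>]
  let ?t = "\<lambda>k. 2 powr real_of_int k"
  have "(\<integral>\<^sup>+k. \<rho> (?t k) * ennreal (?t k ^ CARD('n)) \<partial>count_space UNIV)
      \<le> (\<integral>\<^sup>+k. \<rho> (?t k) * radmass TYPE('n) (indicator {?t k / 2<..?t k}) \<partial>count_space UNIV)"
    by (intro nn_integral_mono mult_left_mono radmass_shell) auto
  also have "\<dots> = (\<integral>\<^sup>+k. (\<integral>\<^sup>+x. \<rho> (?t k) * indicator {?t k / 2<..?t k} (infnorm (x :: real ^ 'n)) \<partial>lborel) \<partial>count_space UNIV)"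
    unfolding radmass_def by (simp add: nn_integral_cmult)
  also have "\<dots> = (\<integral>\<^sup>+x. (\<integral>\<^sup>+k. \<rho> (?t k) * indicator {?t k / 2<..?t k} (infnorm (x :: real ^ 'n)) \<partial>count_space UNIV) \<partial>lborel)"
    by (rule nn_integral_count_space_nn_integral[symmetric]) auto
  also have "\<dots> \<le> radmass TYPE('n) \<rho>"
    unfolding radmass_def by (intro nn_integral_mono dyadic_le_antimono_pointwise \<rho>)
  finally show ?thesis .
qed

section \<open>Muckenhoupt weights and radial convolutions\<close>

abbreviation ballint :: "real \<Rightarrow> (real ^ 'n::finite \<Rightarrow> ennreal) \<Rightarrow> real ^ 'n \<Rightarrow> ennreal" where
  "ballint t \<equiv> radconv (indicator {..t})"

definition wint :: "real \<Rightarrow> (real ^ 'n::finite \<Rightarrow> ennreal) \<Rightarrow> (real ^ 'n \<Rightarrow> ennreal) \<Rightarrow> ennreal" where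
  "wint p w \<phi> = (\<integral>\<^sup>+x. epowr (\<phi> x) p * w x \<partial>lborel)"

lemma half_mult_ennreal: "1 / 2 * ennreal x = ennreal (x / 2)"
proof -
  have "1 / 2 * ennreal x = ennreal (1 / 2) * ennreal x"
    by (simp add: divide_ennreal_def)
  also have "\<dots> = ennreal (1 / 2 * x)"
    by (rule ennreal_mult'[symmetric]) simp
  finally show ?thesis
    by simp
qed

lemma ballint_mono_radius: "s \<le> t \<Longrightarrow> ballint s \<phi> x \<le> ballint t \<phi> x"
  by (intro radconv_mono_kernel) (auto simp: indicator_def)

lemma ballint_le_ballint:
  assumes "infnorm (x - y) + s \<le> t"
  shows "ballint s \<phi> y \<le> ballint t \<phi> x"
  unfolding radconv_def
proof (intro nn_integral_mono mult_right_mono)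
  fix u
  show "indicator {..s} (infnorm (y - u)) \<le> (indicator {..t} (infnorm (x - u)) :: ennreal)"
    using assms infnorm_triangle_sub[of x u y] by (auto simp: indicator_def)
qed simp

lemma ballint_indicator_le:
  fixes y :: "real ^ 'n::finite"
  assumes "0 \<le> s" "infnorm (x - y) + s \<le> t"
  shows "ballint t (indicator {u. infnorm (y - u) \<le> s}) x = ennreal ((2 * s) ^ CARD('n))"
proof -
  have "ballint t (indicator {u. infnorm (y - u) \<le> s}) x = (\<integral>\<^sup>+u. indicator {u. infnorm (y - u) \<le> s} u \<partial>lborel)"
    unfolding radconv_def
  proof (intro nn_integral_cong)
    fix u
    show "indicator {..t} (infnorm (x - u)) * indicator {u. infnorm (y - u) \<le> s} u
        = (indicator {u. infnorm (y - u) \<le> s} u :: ennreal)"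
      using assms infnorm_triangle_sub[of x u y] by (auto simp: indicator_def)
  qed
  also have "\<dots> = emeasure lborel {u. infnorm (y - u) \<le> s}"
    by (rule nn_integral_indicator) measurable
  finally show ?thesis
    using assms by (simp add: emeasure_infnorm_cball)
qed

lemma wint_mono_AE:
  assumes "AE x in lborel. \<phi> x \<le> \<psi> x" "0 < p"
  shows "wint p w \<phi> \<le> wint p w \<psi>"
  unfolding wint_def using assms(1)
  by (intro nn_integral_mono_AE) (auto elim!: eventually_mono intro!: mult_right_mono epowr_mono assms(2))

lemma wint_mono: "(\<And>x. \<phi> x \<le> \<psi> x) \<Longrightarrow> 0 < p \<Longrightarrow> wint p w \<phi> \<le> wint p w \<psi>"
  by (intro wint_mono_AE) auto

lemma wint_add_le:
  assumes [measurable]: "\<phi> \<in> borel_measurable borel" "\<psi> \<in> borel_measurable borel" "w \<in> borel_measurable borel"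
    and "0 < p"
  shows "wint p w (\<lambda>x. \<phi> x + \<psi> x) \<le> ennreal (2 powr p) * (wint p w \<phi> + wint p w \<psi>)"
proof -
  have "wint p w (\<lambda>x. \<phi> x + \<psi> x) \<le> (\<integral>\<^sup>+x. ennreal (2 powr p) * (epowr (\<phi> x) p * w x + epowr (\<psi> x) p * w x) \<partial>lborel)"
    unfolding wint_def
    by (intro nn_integral_mono)
      (metis assms(4) distrib_right epowr_add_le mult.assoc mult_right_mono zero_le)
  also have "\<dots> = ennreal (2 powr p) * (wint p w \<phi> + wint p w \<psi>)"
    unfolding wint_def by (subst nn_integral_cmult) (auto simp: nn_integral_add)
  finally show ?thesis .
qed

lemma wint_cmult:
  assumes [measurable]: "\<phi> \<in> borel_measurable borel" "w \<in> borel_measurable borel" and "0 < p"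
  shows "wint p w (\<lambda>x. c * \<phi> x) = epowr c p * wint p w \<phi>"
  unfolding wint_def using assms(3) by (simp add: epowr_mult mult.assoc nn_integral_cmult)

text \<open>For a density \<open>w\<close> and \<open>1 \<le> p < \<infinity>\<close> the \<open>A\<^sub>p\<close> condition is equivalent to
  the inequality below, which treats \<open>p = 1\<close> and \<open>p > 1\<close> alike.\<close>
locale muckenhoupt =
  fixes p :: real and w :: "real ^ 'n::finite \<Rightarrow> ennreal" and A :: real
  assumes p: "1 \<le> p" and A: "0 < A"
    and measurable_w [measurable]: "w \<in> borel_measurable borel"
    and ball_pos: "0 < t \<Longrightarrow> 0 < ballint t w x"
    and ball_finite: "ballint t w x < top"
    and Ap: "\<phi> \<in> borel_measurable borel \<Longrightarrow> 0 < t \<Longrightarrow>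
      epowr (ballint t \<phi> x) p * ballint t w x
        \<le> ennreal (A * ((2 * t) ^ CARD('n)) powr p) * ballint t (\<lambda>y. epowr (\<phi> y) p * w y) x"
begin

lemma p_pos [simp]: "0 < p"
  using p by simp

text \<open>Apply \<open>Ap\<close> on the large ball to the indicator of the small one: its
  integral is the volume of the small ball, and its weighted integral is at most the weight of the
  small ball.\<close>

lemma doubling:
  assumes s: "0 < s" and t: "infnorm (x - y) + s \<le> t"
  shows "ballint t w x \<le> ennreal (A * ((t / s) ^ CARD('n)) powr p) * ballint s w y"
proof -
  have t_pos: "0 < t"
    using assms infnorm_pos_le[of "x - y"] by simp
  let ?\<phi> = "indicator {u. infnorm (y - u) \<le> s} :: _ \<Rightarrow> ennreal"
  let ?a = "((2 * s) ^ CARD('n)) powr p" and ?b = "((2 * t) ^ CARD('n)) powr p"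
  have "ennreal ?a * ballint t w x = epowr (ballint t ?\<phi> x) p * ballint t w x"
    using s t by (subst ballint_indicator_le) (auto simp: epowr_ennreal)
  also have "\<dots> \<le> ennreal (A * ?b) * ballint t (\<lambda>y. epowr (?\<phi> y) p * w y) x"
    using t_pos by (intro Ap) measurable
  also have "\<dots> \<le> ennreal (A * ?b) * ballint s w y"
    unfolding radconv_def by (intro mult_left_mono nn_integral_mono) (auto simp: indicator_def)
  finally have "ennreal (1 / ?a) * (ennreal ?a * ballint t w x) \<le> ennreal (1 / ?a) * (ennreal (A * ?b) * ballint s w y)"
    by (rule mult_left_mono) simp
  moreover have "ennreal (1 / ?a) * (ennreal ?a * ballint t w x) = ballint t w x"
    using s by (simp add: mult.assoc[symmetric] flip: ennreal_mult)
  moreover have "ennreal (1 / ?a) * (ennreal (A * ?b) * ballint s w y)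
      = ennreal (A * ((t / s) ^ CARD('n)) powr p) * ballint s w y"
  proof -
    have "(t / s) ^ CARD('n) = (2 * t) ^ CARD('n) / (2 * s) ^ CARD('n)"
      by (simp add: power_divide power_mult_distrib)
    then have "((t / s) ^ CARD('n)) powr p = ?b / ?a"
      using s t_pos by (simp only: powr_divide)
    then have "1 / ?a * (A * ?b) = A * ((t / s) ^ CARD('n)) powr p"
      by simp
    then show ?thesis
      using A s t_pos by (simp add: mult.assoc[symmetric] ennreal_mult[symmetric])
  qed
  ultimately show ?thesis by simp
qed

definition "doubling_const = A * (2 ^ CARD('n)) powr p"

lemma doubling_const_pos: "0 < doubling_const"
  using A by (simp add: doubling_const_def)

lemma epowr_ballint_le:
  assumes "\<phi> \<in> borel_measurable borel" "0 < t"
  shows "epowr (ballint t \<phi> x) p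
    \<le> ennreal (A * ((2 * t) ^ CARD('n)) powr p) * ballint t (\<lambda>y. epowr (\<phi> y) p * w y) x / ballint t w x"
proof -
  have "epowr (ballint t \<phi> x) p = epowr (ballint t \<phi> x) p * ballint t w x / ballint t w x"
    using ball_pos[OF assms(2), of x] ball_finite[of t x] by (simp add: ennreal_mult_divide_eq)
  also have "\<dots> \<le> ennreal (A * ((2 * t) ^ CARD('n)) powr p) * ballint t (\<lambda>y. epowr (\<phi> y) p * w y) x / ballint t w x"
    by (intro divide_right_mono_ennreal Ap assms)
  finally show ?thesis .
qed

text \<open>\<open>Ap\<close> bounds the power of the ball integral at \<open>x\<close> by a
  weighted integral divided by the weight W(x) of the ball about \<open>x\<close>. After Fubini, for
  |x - y| at most \<open>t\<close>, doubling replaces 1 / W(x) by a multiple of 1 / W(y), and the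
  remaining integral of \<open>w\<close> over the ball about \<open>y\<close> cancels W(y). No
  maximal function is involved, so \<open>p = 1\<close> is covered too.\<close>

lemma wint_ballint:
  assumes \<phi> [measurable]: "\<phi> \<in> borel_measurable borel" and t: "0 < t"
  shows "wint p w (ballint t \<phi>)
    \<le> ennreal (A * doubling_const) * ennreal (((2 * t) ^ CARD('n)) powr p) * wint p w \<phi>"
proof -
  let ?I = "indicator {..t} :: real \<Rightarrow> ennreal"
  let ?W = "ballint t w"
  let ?K = "ennreal (A * ((2 * t) ^ CARD('n)) powr p)"
  let ?D = "ennreal doubling_const"
  let ?F = "\<lambda>y. epowr (\<phi> y) p * w y"
  have W: "1 / ?W x \<le> ?D / ?W y" if "infnorm (x - y) \<le> t" for x y
  proof -
    have "?W y \<le> ballint (2 * t) w x"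
      using that by (intro ballint_le_ballint) auto
    also have "\<dots> \<le> ?D * ?W x"
      using doubling[of t x x "2 * t"] t by (simp add: infnorm_0 doubling_const_def)
    finally have "?W y \<le> ?D * ?W x" .
    then have "?W y / (?W x * ?W y) \<le> ?D * ?W x / (?W x * ?W y)"
      by (rule divide_right_mono_ennreal)
    moreover have "?W y / (?W x * ?W y) = 1 / ?W x"
      using ball_pos[OF t, of y] ball_finite[of t y] divide_mult_eq[of "?W y" 1 "?W x"] by simp
    moreover have "?D * ?W x / (?W x * ?W y) = ?D / ?W y"
      using ball_pos[OF t, of x] ball_finite[of t x] divide_mult_eq[of "?W x" ?D "?W y"]
      by (simp add: mult.commute)
    ultimately show ?thesis by simp
  qed
  have "wint p w (ballint t \<phi>) \<le> (\<integral>\<^sup>+x. ?K * (\<integral>\<^sup>+y. ?I (infnorm (x - y)) * ?F y * (w x / ?W x) \<partial>lborel) \<partial>lborel)"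
    unfolding wint_def
  proof (intro nn_integral_mono)
    fix x
    have "epowr (ballint t \<phi> x) p * w x \<le> ?K * ballint t ?F x / ?W x * w x"
      by (intro mult_right_mono epowr_ballint_le t \<phi>) simp
    also have "\<dots> = ?K * (ballint t ?F x * (w x / ?W x))"
      by (simp add: ennreal_divide_times mult.assoc ennreal_times_divide mult_ac)
    also have "ballint t ?F x * (w x / ?W x) = (\<integral>\<^sup>+y. ?I (infnorm (x - y)) * ?F y * (w x / ?W x) \<partial>lborel)"
      unfolding radconv_def by (subst nn_integral_multc) auto
    finally show "epowr (ballint t \<phi> x) p * w x \<le> ?K * (\<integral>\<^sup>+y. ?I (infnorm (x - y)) * ?F y * (w x / ?W x) \<partial>lborel)" .
  qed
  also have "\<dots> = ?K * (\<integral>\<^sup>+x. (\<integral>\<^sup>+y. ?I (infnorm (x - y)) * ?F y * (w x / ?W x) \<partial>lborel) \<partial>lborel)"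
    by (rule nn_integral_cmult) measurable
  also have "(\<integral>\<^sup>+x. (\<integral>\<^sup>+y. ?I (infnorm (x - y)) * ?F y * (w x / ?W x) \<partial>lborel) \<partial>lborel)
      = (\<integral>\<^sup>+y. (\<integral>\<^sup>+x. ?I (infnorm (x - y)) * ?F y * (w x / ?W x) \<partial>lborel) \<partial>lborel)"
    by (rule lborel_pair.Fubini') measurable
  also have "\<dots> \<le> (\<integral>\<^sup>+y. ?D * ?F y \<partial>lborel)"
  proof (intro nn_integral_mono)
    fix y
    have "(\<integral>\<^sup>+x. ?I (infnorm (x - y)) * ?F y * (w x / ?W x) \<partial>lborel)
        \<le> (\<integral>\<^sup>+x. ?F y * (?D / ?W y) * (?I (infnorm (y - x)) * w x) \<partial>lborel)"
    proof (intro nn_integral_mono)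
      fix x
      show "?I (infnorm (x - y)) * ?F y * (w x / ?W x) \<le> ?F y * (?D / ?W y) * (?I (infnorm (y - x)) * w x)"
      proof (cases "infnorm (x - y) \<le> t")
        case True
        have "?F y * w x * (1 / ?W x) \<le> ?F y * w x * (?D / ?W y)"
          by (intro mult_left_mono W True) simp
        then show ?thesis
          using True infnorm_sub[of x y] by (simp add: ennreal_times_divide mult_ac)
      qed simp
    qed
    also have "\<dots> = ?F y * (?D / ?W y) * ?W y"
      unfolding radconv_def by (rule nn_integral_cmult) measurable
    also have "\<dots> = ?D * ?F y"
    proof -
      have "?D / ?W y * ?W y = ?D"
        using ball_pos[OF t, of y] ball_finite[of t y]
        by (simp add: ennreal_divide_times ennreal_times_divide[symmetric])
      then show ?thesis
        by (simp only: mult.assoc mult_ac)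
    qed
    finally show "(\<integral>\<^sup>+x. ?I (infnorm (x - y)) * ?F y * (w x / ?W x) \<partial>lborel) \<le> ?D * ?F y" .
  qed
  also have "(\<integral>\<^sup>+y. ?D * ?F y \<partial>lborel) = ?D * wint p w \<phi>"
    unfolding wint_def by (rule nn_integral_cmult) measurable
  finally show ?thesis
    using A doubling_const_pos by (simp add: ennreal_mult mult_ac mult_right_mono)
qed

text \<open>The factor 4^d compares the volume of the ball of radius 2^(k+1), which contains a
  dyadic shell, with the factor (2^k)^d in \<open>dyadic_sum_le_radmass\<close>; it enters to the
  power \<open>p\<close> together with the mass.\<close>

definition "conv_const = A * doubling_const * (4 ^ CARD('n)) powr p"

lemma conv_const_pos: "0 < conv_const"
  using A doubling_const_pos by (simp add: conv_const_def)

text \<open>The convolution is at most a mixture of ball averages over dyadic radii. Jensen's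
  inequality moves the power inside the mixture, and \<open>wint_ballint\<close> bounds every
  normalised average with a constant independent of its radius, so only the total mass of the
  mixture remains.\<close>

lemma wint_radconv:
  assumes \<rho>: "antimono \<rho>" "radmass TYPE('n) \<rho> < top" and \<phi> [measurable]: "\<phi> \<in> borel_measurable borel"
  shows "wint p w (radconv \<rho> \<phi>) \<le> ennreal conv_const * epowr (radmass TYPE('n) \<rho>) p * wint p w \<phi>"
proof -
  note [measurable] = measurable_antimono[OF \<rho>(1)]
  let ?t = "\<lambda>k::int. 2 powr real_of_int (k + 1)"
  define c where "c k = \<rho> (2 powr real_of_int k)" for k :: int
  define V where "V k = (2 * ?t k) ^ CARD('n)" for k
  have V_pos: "0 < V k" for k
    by (simp add: V_def)
  have V_eq: "V k = 4 ^ CARD('n) * (2 powr real_of_int k) ^ CARD('n)" for k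
  proof -
    have "2 * ?t k = 4 * 2 powr real_of_int k"
      by (simp add: powr_add)
    then show ?thesis
      unfolding V_def by (simp only: power_mult_distrib)
  qed
  define a where "a k x = ballint (?t k) \<phi> x / ennreal (V k)" for k x
  have [measurable]: "a k \<in> borel_measurable borel" for k
    unfolding a_def by measurable
  \<comment> \<open>The mixing measure on the integers: the normalised average \<open>a k\<close>
    receives weight \<open>c k * V k\<close>, and \<open>S\<close> is the total weight.\<close>
  define M where "M = density (count_space UNIV) (\<lambda>k. c k * ennreal (V k))"
  define S where "S = emeasure M (space M)"
  have S_eq: "S = (\<integral>\<^sup>+k. c k * ennreal (V k) \<partial>count_space UNIV)"
    unfolding S_def M_def by (simp add: emeasure_density)
  have [measurable_cong]: "sets M = sets (count_space UNIV)"
    by (simp add: M_def)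
  have "S = ennreal (4 ^ CARD('n)) * (\<integral>\<^sup>+k. c k * ennreal ((2 powr real_of_int k) ^ CARD('n)) \<partial>count_space UNIV)"
    unfolding S_eq V_eq by (simp add: ennreal_mult nn_integral_cmult[symmetric] mult_ac)
  also have "\<dots> \<le> ennreal (4 ^ CARD('n)) * radmass TYPE('n) \<rho>"
    unfolding c_def by (intro mult_left_mono dyadic_sum_le_radmass \<rho>) auto
  finally have S_le: "S \<le> ennreal (4 ^ CARD('n)) * radmass TYPE('n) \<rho>" .
  have S_fin: "S < top"
    by (rule le_less_trans[OF S_le]) (use \<rho>(2) in \<open>simp add: ennreal_mult_less_top\<close>)
  have conv_le: "radconv \<rho> \<phi> x \<le> (\<integral>\<^sup>+k. a k x \<partial>M)" for x
  proof -
    have "radconv \<rho> \<phi> x \<le> (\<integral>\<^sup>+y. (\<integral>\<^sup>+k. c k * indicator {..?t k} (infnorm (x - y)) * \<phi> y \<partial>count_space UNIV) \<partial>lborel)"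
      unfolding radconv_def
    proof (intro nn_integral_mono_AE, rule eventually_mono[OF AE_lborel_singleton[of x]])
      fix y assume "y \<noteq> x"
      then have "0 < infnorm (x - y)"
        by (simp add: infnorm_pos_lt)
      then have "\<rho> (infnorm (x - y)) * \<phi> y \<le> (\<integral>\<^sup>+k. c k * indicator {..?t k} (infnorm (x - y)) \<partial>count_space UNIV) * \<phi> y"
        unfolding c_def by (intro mult_right_mono antimono_pointwise_le_dyadic \<rho>) auto
      then show "\<rho> (infnorm (x - y)) * \<phi> y \<le> (\<integral>\<^sup>+k. c k * indicator {..?t k} (infnorm (x - y)) * \<phi> y \<partial>count_space UNIV)"
        by (simp add: nn_integral_multc)
    qed
    also have "\<dots> = (\<integral>\<^sup>+k. (\<integral>\<^sup>+y. c k * indicator {..?t k} (infnorm (x - y)) * \<phi> y \<partial>lborel) \<partial>count_space UNIV)"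
      by (rule nn_integral_count_space_nn_integral) auto
    also have "\<dots> = (\<integral>\<^sup>+k. c k * ennreal (V k) * a k x \<partial>count_space UNIV)"
    proof (intro nn_integral_cong)
      fix k
      have "ennreal (V k) * a k x = ballint (?t k) \<phi> x"
        using V_pos[of k] unfolding a_def
        by (simp add: ennreal_times_divide mult.commute[of _ "ballint _ _ _"] ennreal_mult_divide_eq)
      then show "(\<integral>\<^sup>+y. c k * indicator {..?t k} (infnorm (x - y)) * \<phi> y \<partial>lborel) = c k * ennreal (V k) * a k x"
        by (simp add: mult.assoc nn_integral_cmult radconv_def)
    qed
    also have "\<dots> = (\<integral>\<^sup>+k. a k x \<partial>M)"
      unfolding M_def by (subst nn_integral_density) auto
    finally show ?thesis .
  qed
  have wint_a: "wint p w (a k) \<le> ennreal (A * doubling_const) * wint p w \<phi>" for k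
  proof -
    have "wint p w (a k) = epowr (ennreal (1 / V k)) p * wint p w (ballint (?t k) \<phi>)"
    proof -
      have "a k = (\<lambda>x. ennreal (1 / V k) * ballint (?t k) \<phi> x)"
        using V_pos[of k] divide_ennreal[of 1 "V k"]
        by (auto simp: a_def fun_eq_iff divide_ennreal_def mult.commute inverse_ennreal inverse_eq_divide)
      then show ?thesis
        by (simp add: wint_cmult)
    qed
    also have "\<dots> \<le> ennreal ((1 / V k) powr p) * (ennreal (A * doubling_const) * ennreal (V k powr p) * wint p w \<phi>)"
      using V_pos[of k] unfolding V_def by (intro mult_mono wint_ballint) (auto simp: epowr_ennreal)
    also have "\<dots> = ennreal ((1 / V k) powr p * V k powr p) * (ennreal (A * doubling_const) * wint p w \<phi>)"
      by (simp add: ennreal_mult mult_ac)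
    also have "(1 / V k) powr p * V k powr p = 1"
      using V_pos[of k] by (simp flip: powr_mult)
    finally show ?thesis by simp
  qed
  have "S * wint p w (radconv \<rho> \<phi>) \<le> (\<integral>\<^sup>+x. S * (epowr (\<integral>\<^sup>+k. a k x \<partial>M) p * w x) \<partial>lborel)"
    unfolding wint_def
    by (subst nn_integral_cmult[symmetric]) (auto intro!: nn_integral_mono mult_left_mono mult_right_mono epowr_mono conv_le)
  also have "\<dots> \<le> (\<integral>\<^sup>+x. epowr S p * (\<integral>\<^sup>+k. epowr (a k x) p * w x \<partial>M) \<partial>lborel)"
  proof (intro nn_integral_mono)
    fix x
    have "S * (epowr (\<integral>\<^sup>+k. a k x \<partial>M) p * w x) = (epowr (\<integral>\<^sup>+k. a k x \<partial>M) p * emeasure M (space M)) * w x"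
      by (simp add: S_def mult_ac)
    also have "\<dots> \<le> (epowr (emeasure M (space M)) p * (\<integral>\<^sup>+k. epowr (a k x) p \<partial>M)) * w x"
      using S_fin p by (intro mult_right_mono nn_integral_Jensen) (auto simp: S_def)
    finally show "S * (epowr (\<integral>\<^sup>+k. a k x \<partial>M) p * w x) \<le> epowr S p * (\<integral>\<^sup>+k. epowr (a k x) p * w x \<partial>M)"
      by (simp add: S_def mult.assoc nn_integral_multc)
  qed
  also have "\<dots> = (\<integral>\<^sup>+x. (\<integral>\<^sup>+k. epowr S p * (c k * ennreal (V k) * (epowr (a k x) p * w x)) \<partial>count_space UNIV) \<partial>lborel)"
    unfolding M_def by (intro nn_integral_cong) (simp add: nn_integral_density nn_integral_cmult)
  also have "\<dots> = (\<integral>\<^sup>+k. (\<integral>\<^sup>+x. epowr S p * (c k * ennreal (V k) * (epowr (a k x) p * w x)) \<partial>lborel) \<partial>count_space UNIV)"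
    by (rule nn_integral_count_space_nn_integral) auto
  also have "\<dots> = epowr S p * (\<integral>\<^sup>+k. c k * ennreal (V k) * wint p w (a k) \<partial>count_space UNIV)"
    unfolding wint_def by (simp add: nn_integral_cmult)
  also have "\<dots> \<le> epowr S p * (\<integral>\<^sup>+k. c k * ennreal (V k) * (ennreal (A * doubling_const) * wint p w \<phi>) \<partial>count_space UNIV)"
    by (intro mult_left_mono nn_integral_mono wint_a) auto
  also have "\<dots> = S * (ennreal (A * doubling_const) * epowr S p * wint p w \<phi>)"
    unfolding S_eq by (subst nn_integral_multc) (auto simp: mult_ac)
  finally have key: "S * wint p w (radconv \<rho> \<phi>) \<le> S * (ennreal (A * doubling_const) * epowr S p * wint p w \<phi>)" .
  \<comment> \<open>Jensen's inequality without division leaves a factor \<open>S\<close> on both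
    sides. If \<open>S = 0\<close> the convolution vanishes; otherwise \<open>S\<close> is positive
    and finite and cancels.\<close>
  have "wint p w (radconv \<rho> \<phi>) \<le> ennreal (A * doubling_const) * epowr S p * wint p w \<phi>"
  proof (cases "S = 0")
    case True
    then have "(\<integral>\<^sup>+k. a k x \<partial>M) = 0" for x
      unfolding M_def S_eq by (auto simp: nn_integral_density nn_integral_0_iff_AE AE_count_space)
    then have "radconv \<rho> \<phi> x = 0" for x
      using conv_le[of x] by simp
    then show ?thesis
      by (simp add: wint_def)
  next
    case False
    then show ?thesis
      using key S_fin by (simp add: ennreal_mult_le_mult_iff)
  qed
  also have "\<dots> \<le> ennreal (A * doubling_const) * epowr (ennreal (4 ^ CARD('n)) * radmass TYPE('n) \<rho>) p * wint p w \<phi>"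
    by (intro mult_right_mono mult_left_mono epowr_mono S_le) auto
  also have "\<dots> = ennreal conv_const * epowr (radmass TYPE('n) \<rho>) p * wint p w \<phi>"
    using A doubling_const_pos by (simp add: epowr_mult epowr_ennreal conv_const_def ennreal_mult mult_ac)
  finally show ?thesis .
qed

text \<open>Since \<open>wint p w \<alpha>\<close> may be infinite, the last term of
  \<open>le\<close> cannot be subtracted. Instead the inequality is iterated: the map sending g to
  \<beta> + \<rho> * g, started at 0, gives functions \<open>b k\<close>, and mass at most 1/2
  bounds the defect \<alpha> - b_k by M / 2^k. The second smallness condition bounds every
  \<open>wint p w (b k)\<close> uniformly; the constant c = 2 * 2^p is the solution of c = 2^p + c /
  2. Monotone convergence finishes the proof.\<close>

lemma wint_absorb:
  assumes [measurable]: "\<alpha> \<in> borel_measurable borel" "\<beta> \<in> borel_measurable borel"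
    and \<rho>: "antimono \<rho>" and bounded: "\<And>x. \<alpha> x \<le> ennreal M"
    and le: "AE x in lborel. \<alpha> x \<le> \<beta> x + radconv \<rho> \<alpha> x"
    and half: "radmass TYPE('n) \<rho> \<le> 1 / 2"
      "ennreal (2 powr p * conv_const) * epowr (radmass TYPE('n) \<rho>) p \<le> 1 / 2"
  shows "wint p w \<alpha> \<le> ennreal (2 * 2 powr p) * wint p w \<beta>"
proof -
  note [measurable] = measurable_antimono[OF \<rho>]
  have fin: "radmass TYPE('n) \<rho> < top"
    using half(1) by (rule le_less_trans) (simp add: ennreal_divide_eq_top_iff less_top[symmetric])
  define b where "b k = ((\<lambda>g x. \<beta> x + radconv \<rho> g x) ^^ k) (\<lambda>_. 0)" for k
  have b_0: "b 0 = (\<lambda>_. 0)" and b_Suc: "b (Suc k) = (\<lambda>x. \<beta> x + radconv \<rho> (b k) x)" for k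
    by (auto simp: b_def)
  have b_meas [measurable]: "b k \<in> borel_measurable borel" for k
    by (induction k) (simp_all add: b_0 b_Suc)
  have b_mono: "b k x \<le> b (Suc k) x" for k x
    by (induction k arbitrary: x) (simp_all add: b_0 b_Suc add_left_mono radconv_mono)
  have approx: "AE x in lborel. \<alpha> x \<le> b k x + ennreal (M / 2 ^ k)" for k
  proof (induction k)
    case 0
    then show ?case using bounded by (simp add: b_0)
  next
    case (Suc k)
    have "radconv \<rho> \<alpha> x \<le> radconv \<rho> (b k) x + ennreal (M / 2 ^ Suc k)" for x
    proof -
      have "radconv \<rho> \<alpha> x \<le> radconv \<rho> (\<lambda>y. b k y + ennreal (M / 2 ^ k)) x"
        by (rule radconv_mono_AE[OF Suc.IH])
      also have "\<dots> = radconv \<rho> (b k) x + radmass TYPE('n) \<rho> * ennreal (M / 2 ^ k)"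
        by (simp add: radconv_add radconv_const)
      also have "radmass TYPE('n) \<rho> * ennreal (M / 2 ^ k) \<le> 1 / 2 * ennreal (M / 2 ^ k)"
        by (intro mult_right_mono half) simp
      also have "1 / 2 * ennreal (M / 2 ^ k) = ennreal (M / 2 ^ Suc k)"
        by (simp add: half_mult_ennreal mult.commute)
      finally show ?thesis by (simp add: add_left_mono)
    qed
    with le show ?case
      by (auto elim!: eventually_mono simp: b_Suc add.assoc intro: order_trans[OF _ add_left_mono])
  qed
  have wint_b: "wint p w (b k) \<le> ennreal (2 * 2 powr p) * wint p w \<beta>" for k
  proof (induction k)
    case 0
    then show ?case by (simp add: b_0 wint_def)
  next
    case (Suc k)
    let ?B = "ennreal (2 powr p) * wint p w \<beta>"
    have "wint p w (b (Suc k)) \<le> ennreal (2 powr p) * (wint p w \<beta> + wint p w (radconv \<rho> (b k)))"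
      unfolding b_Suc by (intro wint_add_le) auto
    also have "\<dots> \<le> ennreal (2 powr p) * (wint p w \<beta> + ennreal conv_const * epowr (radmass TYPE('n) \<rho>) p * wint p w (b k))"
      by (intro mult_left_mono add_left_mono wint_radconv \<rho> fin) auto
    also have "\<dots> = ?B + ennreal (2 powr p * conv_const) * epowr (radmass TYPE('n) \<rho>) p * wint p w (b k)"
      using conv_const_pos by (simp add: distrib_left ennreal_mult mult_ac)
    also have "\<dots> \<le> ?B + 1 / 2 * (ennreal (2 * 2 powr p) * wint p w \<beta>)"
      by (intro add_left_mono mult_mono half Suc.IH) auto
    also have "1 / 2 * (ennreal (2 * 2 powr p) * wint p w \<beta>) = ?B"
      unfolding mult.assoc[symmetric] half_mult_ennreal by simp
    also have "?B + ?B = ennreal (2 * 2 powr p) * wint p w \<beta>"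
    proof -
      have "ennreal (2 * 2 powr p) = ennreal (2 powr p) + ennreal (2 powr p)"
        by (subst mult_2, rule ennreal_plus) auto
      then show ?thesis
        by (simp only: distrib_right)
    qed
    finally show ?case .
  qed
  have "AE x in lborel. \<alpha> x \<le> (SUP k. b k x)"
  proof -
    have "AE x in lborel. \<forall>k. \<alpha> x \<le> b k x + ennreal (M / 2 ^ k)"
      using approx by (simp add: AE_all_countable)
    then show ?thesis
    proof eventually_elim
      case (elim x)
      have "\<alpha> x \<le> (SUP k. b k x) + ennreal (M / 2 ^ k)" for k
        using elim[rule_format, of k] by (rule order_trans) (auto intro!: add_right_mono SUP_upper)
      moreover have "(\<lambda>k. (SUP k. b k x) + ennreal (M / 2 ^ k)) \<longlonglongrightarrow> (SUP k. b k x) + ennreal 0"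
        by (intro tendsto_add tendsto_const tendsto_ennrealI LIMSEQ_divide_realpow_zero) simp
      ultimately show ?case
        using LIMSEQ_le_const[of _ _ "\<alpha> x"] by fastforce
    qed
  qed
  then have "wint p w \<alpha> \<le> wint p w (\<lambda>x. SUP k. b k x)"
    by (intro wint_mono_AE) auto
  also have "\<dots> = (\<integral>\<^sup>+x. (SUP k. epowr (b k x) p * w x) \<partial>lborel)"
    unfolding wint_def by (simp add: epowr_SUP SUP_mult_right_ennreal)
  also have "\<dots> = (SUP k. wint p w (b k))"
    unfolding wint_def
    by (intro nn_integral_monotone_convergence_SUP)
      (auto simp: incseq_Suc_iff le_fun_def intro!: mult_right_mono epowr_mono b_mono)
  also have "\<dots> \<le> ennreal (2 * 2 powr p) * wint p w \<beta>"
    by (intro SUP_least wint_b)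
  finally show ?thesis .
qed

end

section \<open>Local norms on a grid of cells\<close>

text \<open>Points with the same centre form one half-open cell of a grid of side \<open>N\<close>.
  The closed cell is the ball of radius \<open>N / 2\<close> about the centre, so integrals over
  cells are values of \<open>ballint (N / 2)\<close>.\<close>

definition cell_center :: "real \<Rightarrow> real ^ 'n::finite \<Rightarrow> real ^ 'n" where
  "cell_center N x = (\<chi> i. N * (of_int \<lfloor>x $ i / N\<rfloor> + 1 / 2))"

lemma measurable_cell_center [measurable]: "cell_center N \<in> borel \<rightarrow>\<^sub>M (borel :: (real ^ 'n::finite) measure)"
proof (rule borel_measurable_euclidean_space[THEN iffD2], intro ballI)
  fix b :: "real ^ 'n" assume "b \<in> Basis"
  then obtain i where "b = axis i 1"
    by (auto simp: Basis_vec_def)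
  then show "(\<lambda>x. cell_center N x \<bullet> b) \<in> borel_measurable borel"
    by (simp add: inner_axis cell_center_def)
qed

lemma infnorm_cell_center:
  assumes N: "0 < N"
  shows "infnorm (cell_center N x - x) \<le> N / 2"
  unfolding infnorm_le_iff
proof
  fix i
  have "N * of_int \<lfloor>x $ i / N\<rfloor> \<le> x $ i" "x $ i \<le> N * (of_int \<lfloor>x $ i / N\<rfloor> + 1)"
    using N by (simp_all add: pos_le_divide_eq[symmetric] pos_divide_le_eq[symmetric] mult.commute[of N])
  then have "\<bar>N * of_int \<lfloor>x $ i / N\<rfloor> + N / 2 - x $ i\<bar> \<le> N / 2"
    unfolding distrib_left by linarith
  then show "\<bar>(cell_center N x - x) $ i\<bar> \<le> N / 2"
    by (simp add: cell_center_def distrib_left)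
qed

text \<open>The inequality is strict because boundary points may belong to a neighbouring cell. This
  is why open balls, which have the same volume, are used when a value is spread over its
  cell.\<close>

lemma cell_center_eqI:
  assumes N: "0 < N" and "infnorm (cell_center N x - y) < N / 2"
  shows "cell_center N y = cell_center N x"
proof -
  have "\<lfloor>y $ i / N\<rfloor> = \<lfloor>x $ i / N\<rfloor>" for i
  proof (rule floor_unique)
    have *: "\<bar>N * (of_int \<lfloor>x $ i / N\<rfloor> + 1 / 2) - y $ i\<bar> < N / 2"
      using assms(2)[unfolded infnorm_less_iff, rule_format, of i] by (simp add: cell_center_def)
    then have "N * of_int \<lfloor>x $ i / N\<rfloor> \<le> y $ i" "y $ i < N * (of_int \<lfloor>x $ i / N\<rfloor> + 1)"
      unfolding distrib_left by linarith+
    then show "of_int \<lfloor>x $ i / N\<rfloor> \<le> y $ i / N" "y $ i / N < of_int \<lfloor>x $ i / N\<rfloor> + 1"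
      using N by (simp_all add: pos_le_divide_eq pos_divide_less_eq mult.commute[of N])
  qed
  then show ?thesis
    by (simp add: cell_center_def)
qed

text \<open>Spread the integrand at \<open>y\<close> uniformly over the open cell of
  \<open>y\<close>, of volume N^d, passing from \<open>k\<close> to \<open>k'\<close> at the new
  point, and exchange the integrals. In the applications \<open>k'\<close> is \<open>k\<close> with
  its radius adjusted by the width of a cell.\<close>

lemma nn_integral_le_cell_averages:
  fixes F k k' :: "real ^ 'n::finite \<Rightarrow> ennreal"
  assumes [measurable]: "F \<in> borel_measurable borel" "k \<in> borel_measurable borel" "k' \<in> borel_measurable borel"
    and N: "0 < N" and k: "\<And>y y'. infnorm (y - y') \<le> N \<Longrightarrow> k y \<le> k' y'"
  shows "(\<integral>\<^sup>+y. k y * F y \<partial>lborel)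
    \<le> ennreal (1 / N ^ CARD('n)) * (\<integral>\<^sup>+y. k' y * ballint (N / 2) F (cell_center N y) \<partial>lborel)"
proof -
  let ?I = "\<lambda>y' y. indicator {..N / 2} (infnorm (cell_center N y' - y)) :: ennreal"
  have "k y * F y \<le> ennreal (1 / N ^ CARD('n)) * (\<integral>\<^sup>+y'. k' y' * (?I y' y * F y) \<partial>lborel)" for y
  proof -
    let ?B = "{y'. infnorm (cell_center N y - y') < N / 2}"
    have "ennreal (N ^ CARD('n)) * (k y * F y) = (\<integral>\<^sup>+y'. k y * F y * indicator ?B y' \<partial>lborel)"
      using N emeasure_infnorm_ball[of "N / 2" "cell_center N y"]
      by (subst nn_integral_cmult_indicator) (auto simp: mult.commute)
    also have "\<dots> \<le> (\<integral>\<^sup>+y'. k' y' * (?I y' y * F y) \<partial>lborel)"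
    proof (intro nn_integral_mono)
      fix y'
      show "k y * F y * indicator ?B y' \<le> k' y' * (?I y' y * F y)"
      proof (cases "y' \<in> ?B")
        case True
        then have c: "cell_center N y' = cell_center N y"
          using N by (intro cell_center_eqI) auto
        have "infnorm (y - y') \<le> N"
          using infnorm_triangle_sub[of y y' "cell_center N y"] True infnorm_cell_center[OF N, of y]
          by (simp add: infnorm_sub)
        then have "k y \<le> k' y'"
          by (rule k)
        moreover have "?I y' y = 1"
          using infnorm_cell_center[OF N, of y] by (simp add: c)
        ultimately show ?thesis
          using True by (simp add: mult_right_mono)
      qed simp
    qed
    finally have "ennreal (1 / N ^ CARD('n)) * (ennreal (N ^ CARD('n)) * (k y * F y))
        \<le> ennreal (1 / N ^ CARD('n)) * (\<integral>\<^sup>+y'. k' y' * (?I y' y * F y) \<partial>lborel)"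
      by (rule mult_left_mono) simp
    then show ?thesis
      using N by (simp add: mult.assoc[symmetric] ennreal_mult[symmetric])
  qed
  then have "(\<integral>\<^sup>+y. k y * F y \<partial>lborel)
      \<le> (\<integral>\<^sup>+y. ennreal (1 / N ^ CARD('n)) * (\<integral>\<^sup>+y'. k' y' * (?I y' y * F y) \<partial>lborel) \<partial>lborel)"
    by (rule nn_integral_mono)
  also have "\<dots> = ennreal (1 / N ^ CARD('n)) * (\<integral>\<^sup>+y. (\<integral>\<^sup>+y'. k' y' * (?I y' y * F y) \<partial>lborel) \<partial>lborel)"
    by (rule nn_integral_cmult) measurable
  also have "(\<integral>\<^sup>+y. (\<integral>\<^sup>+y'. k' y' * (?I y' y * F y) \<partial>lborel) \<partial>lborel)
      = (\<integral>\<^sup>+y'. (\<integral>\<^sup>+y. k' y' * (?I y' y * F y) \<partial>lborel) \<partial>lborel)"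
    by (rule lborel_pair.Fubini') measurable
  also have "\<dots> = (\<integral>\<^sup>+y. k' y * ballint (N / 2) F (cell_center N y) \<partial>lborel)"
    unfolding radconv_def by (intro nn_integral_cong nn_integral_cmult) measurable
  finally show ?thesis .
qed

context muckenhoupt
begin

text \<open>Normalising by the weight of the cell makes the quantity insensitive to the size of
  \<open>w\<close>: it is at most the supremum of \<open>H\<close>, and by the A_p condition it
  dominates unweighted averages up to a constant.\<close>

definition local_norm :: "real \<Rightarrow> (real ^ 'n \<Rightarrow> ennreal) \<Rightarrow> real ^ 'n \<Rightarrow> ennreal" where
  "local_norm N H x = epowr (ballint (N / 2) (\<lambda>y. epowr (H y) p * w y) (cell_center N x)
      / ballint (N / 2) w (cell_center N x)) (1 / p)"

lemma measurable_local_norm [measurable]: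
  assumes [measurable]: "H \<in> borel_measurable borel"
  shows "local_norm N H \<in> borel_measurable borel"
  unfolding local_norm_def by measurable

lemma epowr_local_norm:
  assumes "0 < N"
  shows "epowr (local_norm N H x) p * ballint (N / 2) w (cell_center N x)
    = ballint (N / 2) (\<lambda>y. epowr (H y) p * w y) (cell_center N x)"
  using ball_pos[of "N / 2" "cell_center N x"] ball_finite[of "N / 2" "cell_center N x"] assms
  by (simp add: local_norm_def ennreal_divide_times ennreal_times_divide[symmetric])

lemma local_norm_le:
  assumes N: "0 < N" and H: "\<And>y. H y \<le> c"
  shows "local_norm N H x \<le> c"
proof -
  let ?c = "cell_center N x"
  have "ballint (N / 2) (\<lambda>y. epowr (H y) p * w y) ?c \<le> ballint (N / 2) (\<lambda>y. epowr c p * w y) ?c"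
    by (intro radconv_mono mult_right_mono epowr_mono H) auto
  also have "\<dots> = epowr c p * ballint (N / 2) w ?c"
    by (simp add: radconv_cmult)
  finally have "ballint (N / 2) (\<lambda>y. epowr (H y) p * w y) ?c / ballint (N / 2) w ?c
      \<le> epowr c p * ballint (N / 2) w ?c / ballint (N / 2) w ?c"
    by (rule divide_right_mono_ennreal)
  also have "\<dots> = epowr c p"
    using ball_pos[of "N / 2" ?c] ball_finite[of "N / 2" ?c] N by (simp add: ennreal_mult_divide_eq)
  finally show ?thesis
    unfolding local_norm_def using epowr_mono[of "1 / p" _ "epowr c p"] by simp
qed

text \<open>This is the A_p inequality on a single cell, with the weight of the cell divided out and
  the \<open>p\<close>-th root taken. It turns local weighted information into unweighted
  averages.\<close>

lemma ballint_le_local_norm: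
  assumes [measurable]: "H \<in> borel_measurable borel" and N: "0 < N"
  shows "ballint (N / 2) H (cell_center N x) \<le> ennreal (A powr (1 / p) * N ^ CARD('n)) * local_norm N H x"
proof -
  have "epowr (ballint (N / 2) H (cell_center N x)) p
      \<le> ennreal (A * (N ^ CARD('n)) powr p) * epowr (local_norm N H x) p"
    using epowr_ballint_le[of H "N / 2" "cell_center N x"] N
    by (simp add: local_norm_def ennreal_times_divide)
  also have "ennreal (A * (N ^ CARD('n)) powr p) = epowr (ennreal (A powr (1 / p) * N ^ CARD('n))) p"
    using A N p by (simp add: epowr_ennreal powr_mult powr_powr)
  also have "\<dots> * epowr (local_norm N H x) p
      = epowr (ennreal (A powr (1 / p) * N ^ CARD('n)) * local_norm N H x) p"
    by (simp add: epowr_mult)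
  finally show ?thesis
    by (simp add: epowr_le_iff)
qed

text \<open>The local norm is constant on cells, so its value is dominated by its integral over
  any ball containing the cell.\<close>
lemma local_norm_le_average:
  assumes [measurable]: "H \<in> borel_measurable borel" and N: "0 < N" and y: "infnorm (x - y) \<le> 6 * N"
  shows "local_norm N H y \<le> ennreal (1 / N ^ CARD('n)) * ballint (7 * N) (local_norm N H) x"
proof -
  let ?B = "{u. infnorm (cell_center N y - u) < N / 2}"
  have "ennreal (N ^ CARD('n)) * local_norm N H y = (\<integral>\<^sup>+u. local_norm N H y * indicator ?B u \<partial>lborel)"
    using N emeasure_infnorm_ball[of "N / 2" "cell_center N y"]
    by (subst nn_integral_cmult_indicator) (auto simp: mult.commute)
  also have "\<dots> \<le> ballint (7 * N) (local_norm N H) x"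
    unfolding radconv_def
  proof (intro nn_integral_mono)
    fix u
    show "local_norm N H y * indicator ?B u \<le> indicator {..7 * N} (infnorm (x - u)) * local_norm N H u"
    proof (cases "u \<in> ?B")
      case True
      then have c: "cell_center N u = cell_center N y"
        using N by (intro cell_center_eqI) auto
      have "infnorm (x - u) \<le> 7 * N"
        using infnorm_triangle_sub[of x u y] infnorm_triangle_sub[of y u "cell_center N y"]
          infnorm_cell_center[OF N, of y] infnorm_sub[of y "cell_center N y"] True y
        by simp
      then show ?thesis
        by (simp add: local_norm_def c indicator_def)
    qed simp
  qed
  finally have "ennreal (1 / N ^ CARD('n)) * (ennreal (N ^ CARD('n)) * local_norm N H y)
      \<le> ennreal (1 / N ^ CARD('n)) * ballint (7 * N) (local_norm N H) x"
    by (rule mult_left_mono) simp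
  then show ?thesis
    using N by (simp add: mult.assoc[symmetric] ennreal_mult[symmetric])
qed

text \<open>The aim is the power of an average of local norms and not an average of powers, so that
  a \<open>p\<close>-th root can be taken later. Each local norm is bounded by such an average
  through \<open>local_norm_le_average\<close>; the cells involved contribute the volume ratio (12
  N)^d / N^d. The weight survives only as the weight of one ball.\<close>

lemma ballint_le_average_local_norm:
  assumes [measurable]: "H \<in> borel_measurable borel" and N: "0 < N"
  shows "ballint (5 * N) (\<lambda>y. epowr (H y) p * w y) x
    \<le> ennreal (12 ^ CARD('n)) * epowr (ennreal (1 / N ^ CARD('n)) * ballint (7 * N) (local_norm N H) x) p
      * ballint (7 * N) w x"
proof -
  let ?F = "\<lambda>y. epowr (H y) p * w y"
  let ?a = "ennreal (1 / N ^ CARD('n)) * ballint (7 * N) (local_norm N H) x"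
  have "ballint (5 * N) ?F x = (\<integral>\<^sup>+y. indicator {..5 * N} (infnorm (x - y)) * ?F y \<partial>lborel)"
    by (simp add: radconv_def)
  also have "\<dots> \<le> ennreal (1 / N ^ CARD('n))
      * (\<integral>\<^sup>+y. indicator {..6 * N} (infnorm (x - y)) * ballint (N / 2) ?F (cell_center N y) \<partial>lborel)"
  proof (rule nn_integral_le_cell_averages[OF _ _ _ N])
    fix y y' :: "real ^ 'n" assume "infnorm (y - y') \<le> N"
    then show "indicator {..5 * N} (infnorm (x - y)) \<le> (indicator {..6 * N} (infnorm (x - y')) :: ennreal)"
      using infnorm_triangle_sub[of x y' y] by (auto simp: indicator_def)
  qed measurable
  also have "\<dots> \<le> ennreal (1 / N ^ CARD('n))
      * (\<integral>\<^sup>+y. indicator {..6 * N} (infnorm (x - y)) * (epowr ?a p * ballint (7 * N) w x) \<partial>lborel)"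
  proof (rule mult_left_mono, rule nn_integral_mono)
    fix y
    show "indicator {..6 * N} (infnorm (x - y)) * ballint (N / 2) ?F (cell_center N y)
        \<le> indicator {..6 * N} (infnorm (x - y)) * (epowr ?a p * ballint (7 * N) w x)"
    proof (cases "infnorm (x - y) \<le> 6 * N")
      case True
      have "ballint (N / 2) ?F (cell_center N y) = epowr (local_norm N H y) p * ballint (N / 2) w (cell_center N y)"
        by (rule epowr_local_norm[OF N, symmetric])
      also have "\<dots> \<le> epowr ?a p * ballint (7 * N) w x"
      proof (rule mult_mono)
        show "epowr (local_norm N H y) p \<le> epowr ?a p"
          using True by (intro epowr_mono local_norm_le_average N) auto
        have "infnorm (x - cell_center N y) + N / 2 \<le> 7 * N"
          using infnorm_triangle_sub[of x "cell_center N y" y] infnorm_cell_center[OF N, of y]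
            infnorm_sub[of y "cell_center N y"] True
          by simp
        then show "ballint (N / 2) w (cell_center N y) \<le> ballint (7 * N) w x"
          by (rule ballint_le_ballint)
      qed auto
      finally show ?thesis
        by (rule mult_left_mono) simp
    qed simp
  qed auto
  also have "\<dots> = ennreal (1 / N ^ CARD('n)) * (ennreal ((2 * (6 * N)) ^ CARD('n)) * (epowr ?a p * ballint (7 * N) w x))"
    using radconv_const[of "indicator {..6 * N}" "epowr ?a p * ballint (7 * N) w x" x] N
    by (simp add: radconv_def radmass_indicator)
  also have "\<dots> = ennreal (12 ^ CARD('n)) * epowr ?a p * ballint (7 * N) w x"
  proof -
    have "1 / N ^ CARD('n) * (2 * (6 * N)) ^ CARD('n) = 12 ^ CARD('n)"
    proof -
      have "2 * (6 * N) = 12 * N"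
        by simp
      then have "(2 * (6 * N)) ^ CARD('n) = 12 ^ CARD('n) * N ^ CARD('n)"
        by (simp only: power_mult_distrib)
      then show ?thesis
        using N by simp
    qed
    then show ?thesis
      using N by (simp add: mult.assoc[symmetric] ennreal_mult[symmetric])
  qed
  finally show ?thesis .
qed

end

section \<open>Kernels with an integrable radial majorant\<close>

definition kernel_op :: "'n::finite kernel \<Rightarrow> (real ^ 'n \<Rightarrow> complex) \<Rightarrow> real ^ 'n \<Rightarrow> complex" where
  "kernel_op K \<phi> x = (LINT y|lborel. K x y * \<phi> y)"

abbreviation eabs :: "('a \<Rightarrow> complex) \<Rightarrow> 'a \<Rightarrow> ennreal" where
  "eabs \<phi> \<equiv> \<lambda>x. ennreal (cmod (\<phi> x))"

definition cutoff :: "real ^ 'n::finite \<Rightarrow> real \<Rightarrow> real ^ 'n \<Rightarrow> real" where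
  "cutoff c N y = max 0 (min 1 (2 - infnorm (c - y) / N))"

lemma measurable_cutoff [measurable]: "cutoff c N \<in> borel_measurable borel"
  unfolding cutoff_def by measurable

lemma cutoff_bounds: "0 \<le> cutoff c N y" "cutoff c N y \<le> 1"
  by (auto simp: cutoff_def)

lemma cutoff_eq_1: "0 < N \<Longrightarrow> infnorm (c - y) \<le> N \<Longrightarrow> cutoff c N y = 1"
  by (simp add: cutoff_def field_simps)

lemma cutoff_eq_0: "0 < N \<Longrightarrow> 2 * N \<le> infnorm (c - y) \<Longrightarrow> cutoff c N y = 0"
  by (simp add: cutoff_def field_simps)

lemma cutoff_lipschitz:
  assumes "0 < N"
  shows "\<bar>cutoff c N x - cutoff c N y\<bar> \<le> infnorm (x - y) / N"
proof -
  have "\<bar>infnorm (c - x) / N - infnorm (c - y) / N\<bar> \<le> infnorm (x - y) / N"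
    using assms absdiff_infnorm[of "c - x" "c - y"] infnorm_sub[of x y]
    by (simp add: diff_divide_distrib[symmetric] divide_right_mono)
  then show ?thesis
    unfolding cutoff_def by linarith
qed

lemma cutoff_diff_le_1: "\<bar>cutoff c N x - cutoff c N y\<bar> \<le> 1"
  using cutoff_bounds[of c N x] cutoff_bounds[of c N y] by linarith

text \<open>The majorant bounds the kernel at every point and not just almost everywhere;
  \<open>dominated_borel_representative\<close> arranges this. Near and far parts of a kernel are
  again instances, with truncated profiles.\<close>

locale dominated_kernel =
  fixes K :: "'n::finite kernel" and r :: "real \<Rightarrow> ennreal"
  assumes measurable_K: "(\<lambda>(x, y). K x y) \<in> borel_measurable (borel \<Otimes>\<^sub>M borel)"
    and K_le: "ennreal (cmod (K x y)) \<le> r (infnorm (x - y))"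
    and r_antimono: "antimono r"
    and r_mass: "radmass TYPE('n) r < top"
begin

lemma measurable_r [measurable]: "r \<in> borel_measurable borel"
  by (rule measurable_antimono) (rule r_antimono)

lemma measurable_K_comp [measurable (raw)]:
  assumes "f \<in> borel_measurable M" "g \<in> borel_measurable M"
  shows "(\<lambda>x. K (f x) (g x)) \<in> borel_measurable M"
  using measurable_compose[OF measurable_Pair[OF assms] measurable_K] by simp

lemma measurable_kernel_op [measurable]:
  assumes [measurable]: "\<phi> \<in> borel_measurable borel"
  shows "kernel_op K \<phi> \<in> borel_measurable borel"
  unfolding kernel_op_def by measurable

lemma nn_integral_kernel_le: "(\<integral>\<^sup>+y. ennreal (cmod (K x y * \<phi> y)) \<partial>lborel) \<le> radconv r (eabs \<phi>) x"
  unfolding radconv_def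
  by (intro nn_integral_mono) (simp add: norm_mult ennreal_mult K_le mult_right_mono)

lemma integrable_kernel:
  assumes [measurable]: "\<phi> \<in> borel_measurable borel" and "radconv r (eabs \<phi>) x < top"
  shows "integrable lborel (\<lambda>y. K x y * \<phi> y)"
  using nn_integral_kernel_le[of x \<phi>] assms(2)
  by (intro integrableI_bounded) (auto intro: le_less_trans)

text \<open>No integrability is assumed: where it fails, the Bochner integral is 0 by
  convention.\<close>

lemma norm_kernel_op_le: "ennreal (cmod (kernel_op K \<phi> x)) \<le> radconv r (eabs \<phi>) x"
proof (cases "integrable lborel (\<lambda>y. K x y * \<phi> y)")
  case True
  then have "ennreal (cmod (kernel_op K \<phi> x)) \<le> (\<integral>\<^sup>+y. ennreal (cmod (K x y * \<phi> y)) \<partial>lborel)"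
    unfolding kernel_op_def by (rule integral_norm_bound_ennreal)
  then show ?thesis
    using nn_integral_kernel_le by (rule order_trans)
qed (simp add: kernel_op_def not_integrable_integral_eq)

lemma radconv_bounded:
  fixes x :: "real ^ 'n"
  assumes "\<And>y. cmod (\<phi> y) \<le> M"
  shows "radconv r (eabs \<phi>) x \<le> radmass TYPE('n) r * ennreal M"
proof -
  have "radconv r (eabs \<phi>) x \<le> radconv r (\<lambda>_. ennreal M) x"
    by (intro radconv_mono ennreal_leI assms)
  then show ?thesis
    by (simp add: radconv_const)
qed

lemma integrable_kernel_bounded:
  assumes "\<phi> \<in> borel_measurable borel" "\<And>y. cmod (\<phi> y) \<le> M"
  shows "integrable lborel (\<lambda>y. K x y * \<phi> y)"
  using radconv_bounded[of \<phi> M x] assms r_mass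
  by (intro integrable_kernel) (auto intro: le_less_trans simp: ennreal_mult_less_top)

lemma kernel_op_bounded:
  assumes "\<And>y. cmod (\<phi> y) \<le> M" "0 \<le> M"
  shows "cmod (kernel_op K \<phi> x) \<le> enn2real (radmass TYPE('n) r) * M"
proof -
  have "ennreal (cmod (kernel_op K \<phi> x)) \<le> radmass TYPE('n) r * ennreal M"
    using norm_kernel_op_le radconv_bounded[OF assms(1)] by (rule order_trans)
  also have "\<dots> = ennreal (enn2real (radmass TYPE('n) r) * M)"
    using r_mass assms by (simp add: ennreal_mult)
  finally show ?thesis
    using assms by (simp add: ennreal_le_iff)
qed

lemma kernel_op_diff:
  assumes "radconv r (eabs \<phi>) x < top" "radconv r (eabs \<psi>) x < top"
    "\<phi> \<in> borel_measurable borel" "\<psi> \<in> borel_measurable borel"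
  shows "kernel_op K (\<lambda>y. \<phi> y - \<psi> y) x = kernel_op K \<phi> x - kernel_op K \<psi> x"
  unfolding kernel_op_def right_diff_distrib
  by (intro Bochner_Integration.integral_diff integrable_kernel assms)

text \<open>The kernel that controls \<open>\<bar>\<psi>(x) - \<psi>(y)\<bar> \<bar>K(x,y)\<bar>\<close> for a cutoff \<open>\<psi>\<close> at scale \<open>L\<^sup>2\<close>:
  the difference is at most \<open>1 / L\<close> when \<open>\<bar>x - y\<bar> \<le> L\<close>.\<close>
definition commutator_kernel :: "real \<Rightarrow> real \<Rightarrow> ennreal" where
  "commutator_kernel L t = ennreal (1 / L) * r t + r (max t L)"

lemma antimono_commutator_kernel: "antimono (commutator_kernel L)"
  unfolding commutator_kernel_def
  by (intro antimonoI add_mono mult_left_mono antimonoD[OF r_antimono]) auto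

lemma measurable_commutator_kernel [measurable]: "commutator_kernel L \<in> borel_measurable borel"
  by (rule measurable_antimono) (rule antimono_commutator_kernel)

text \<open>With \<psi> the cutoff, (z - T)(\<psi> h) is \<psi> (z - T) h plus the integral of
  (\<psi>(x) - \<psi>(y)) K(x,y) h(y). For |c - y| at most 4N the commutator kernel applies. For |c
  - y| > 4N we have \<psi>(y) = 0, so only |c - x| < 2N contributes, and there |x - y| is at least
  |c - y| / 2; hence the far integral does not depend on \<open>x\<close>.\<close>

lemma commutator_bound:
  fixes h :: "real ^ 'n \<Rightarrow> complex" and c x :: "real ^ 'n"
  assumes [measurable]: "h \<in> borel_measurable borel" and h: "\<And>y. cmod (h y) \<le> M"
    and L: "1 \<le> L" and N: "N = L\<^sup>2"
  shows "eabs (\<lambda>x. z * (cutoff c N x * h x) - kernel_op K (\<lambda>y. cutoff c N y * h y) x) x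
    \<le> indicator {u. infnorm (c - u) \<le> 2 * N} x
        * (eabs (\<lambda>x. z * h x - kernel_op K h x) x
          + (\<integral>\<^sup>+y. indicator {u. 4 * N < infnorm (c - u)} y * r (infnorm (c - y) / 2) * eabs h y \<partial>lborel))
      + radconv (commutator_kernel L) (\<lambda>y. indicator {u. infnorm (c - u) \<le> 4 * N} y * eabs h y) x"
proof -
  let ?\<psi> = "cutoff c N"
  let ?I = "indicator {u. infnorm (c - u) \<le> 2 * N} x :: ennreal"
  let ?far = "\<lambda>y. indicator {u. 4 * N < infnorm (c - u)} y * r (infnorm (c - y) / 2) * eabs h y"
  let ?near = "\<lambda>y. commutator_kernel L (infnorm (x - y)) * (indicator {u. infnorm (c - u) \<le> 4 * N} y * eabs h y)"
  have N_pos: "0 < N"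
    using L N by simp
  have \<psi>h: "cmod (?\<psi> y * h y) \<le> M" for y
    using h[of y] cutoff_bounds[of c N y] mult_left_le_one_le[of "cmod (h y)" "?\<psi> y"]
    by (simp add: norm_mult)
  have int1: "integrable lborel (\<lambda>y. K x y * h y)"
    using h by (intro integrable_kernel_bounded) auto
  have int2: "integrable lborel (\<lambda>y. K x y * (?\<psi> y * h y))"
    using \<psi>h by (intro integrable_kernel_bounded) auto
  have diff: "?\<psi> x * kernel_op K h x - kernel_op K (\<lambda>y. ?\<psi> y * h y) x
      = (LINT y|lborel. (?\<psi> x - ?\<psi> y) * (K x y * h y))"
  proof -
    have "(LINT y|lborel. (?\<psi> x - ?\<psi> y) * (K x y * h y))
        = (LINT y|lborel. ?\<psi> x * (K x y * h y) - K x y * (?\<psi> y * h y))"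
      by (intro Bochner_Integration.integral_cong) (auto simp: algebra_simps)
    also have "\<dots> = (LINT y|lborel. ?\<psi> x * (K x y * h y)) - (LINT y|lborel. K x y * (?\<psi> y * h y))"
      using int1 int2 by (intro Bochner_Integration.integral_diff) auto
    finally show ?thesis
      by (simp add: kernel_op_def)
  qed
  have pointwise: "ennreal (cmod ((?\<psi> x - ?\<psi> y) * (K x y * h y))) \<le> ?I * ?far y + ?near y" for y
  proof -
    have "ennreal (cmod ((?\<psi> x - ?\<psi> y) * (K x y * h y)))
        = ennreal \<bar>?\<psi> x - ?\<psi> y\<bar> * ennreal (cmod (K x y)) * eabs h y"
      unfolding of_real_diff[symmetric] norm_mult norm_of_real by (simp add: ennreal_mult mult.assoc)
    also have "\<dots> \<le> ennreal \<bar>?\<psi> x - ?\<psi> y\<bar> * r (infnorm (x - y)) * eabs h y"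
      by (intro mult_right_mono mult_left_mono K_le) auto
    also have "\<dots> \<le> ?I * ?far y + ?near y"
    proof (cases "infnorm (c - y) \<le> 4 * N")
      case True
      have "ennreal \<bar>?\<psi> x - ?\<psi> y\<bar> * r (infnorm (x - y)) \<le> commutator_kernel L (infnorm (x - y))"
      proof (cases "infnorm (x - y) \<le> L")
        case True
        have "\<bar>?\<psi> x - ?\<psi> y\<bar> \<le> infnorm (x - y) / N"
          by (rule cutoff_lipschitz[OF N_pos])
        also have "\<dots> \<le> L / N"
          using True N_pos by (simp add: divide_right_mono)
        also have "\<dots> = 1 / L"
          using L by (simp add: N power2_eq_square)
        finally have "ennreal \<bar>?\<psi> x - ?\<psi> y\<bar> * r (infnorm (x - y)) \<le> ennreal (1 / L) * r (infnorm (x - y))"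
          by (intro mult_right_mono ennreal_leI) auto
        then show ?thesis
          unfolding commutator_kernel_def by (rule add_increasing2[rotated]) simp
      next
        case False
        have "ennreal \<bar>?\<psi> x - ?\<psi> y\<bar> * r (infnorm (x - y)) \<le> 1 * r (infnorm (x - y))"
          using cutoff_diff_le_1[of c N x y] by (intro mult_right_mono) (auto simp: ennreal_le_1)
        then show ?thesis
          unfolding commutator_kernel_def using False by (simp add: max_def add_increasing)
      qed
      then have "ennreal \<bar>?\<psi> x - ?\<psi> y\<bar> * r (infnorm (x - y)) * eabs h y \<le> ?near y"
        using True by (simp add: mult_right_mono)
      then show ?thesis
        by (rule add_increasing[rotated]) simp
    next
      case False
      then have y0: "?\<psi> y = 0"
        using N_pos by (intro cutoff_eq_0) auto
      show ?thesis
      proof (cases "infnorm (c - x) \<le> 2 * N")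
        case True
        have "r (infnorm (x - y)) \<le> r (infnorm (c - y) / 2)"
          using True False infnorm_triangle_sub[of c y x] by (intro antimonoD[OF r_antimono]) linarith
        then have "ennreal \<bar>?\<psi> x - ?\<psi> y\<bar> * r (infnorm (x - y)) * eabs h y \<le> 1 * r (infnorm (c - y) / 2) * eabs h y"
          using cutoff_diff_le_1[of c N x y] by (intro mult_right_mono mult_mono) (auto simp: ennreal_le_1)
        then show ?thesis
          using True False by (simp add: add_increasing2)
      next
        case False
        then have "?\<psi> x = 0"
          using N_pos by (intro cutoff_eq_0) auto
        then show ?thesis
          by (simp add: y0)
      qed
    qed
    finally show ?thesis .
  qed
  have "z * (?\<psi> x * h x) - kernel_op K (\<lambda>y. ?\<psi> y * h y) x
      = ?\<psi> x * (z * h x - kernel_op K h x) + (LINT y|lborel. (?\<psi> x - ?\<psi> y) * (K x y * h y))"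
    unfolding diff[symmetric] by (simp add: algebra_simps)
  then have "cmod (z * (?\<psi> x * h x) - kernel_op K (\<lambda>y. ?\<psi> y * h y) x)
      \<le> ?\<psi> x * cmod (z * h x - kernel_op K h x) + cmod (LINT y|lborel. (?\<psi> x - ?\<psi> y) * (K x y * h y))"
    using norm_triangle_ineq[of "?\<psi> x * (z * h x - kernel_op K h x)"] cutoff_bounds[of c N x]
    by (simp add: norm_mult)
  then have "eabs (\<lambda>x. z * (?\<psi> x * h x) - kernel_op K (\<lambda>y. ?\<psi> y * h y) x) x
      \<le> ennreal (?\<psi> x) * eabs (\<lambda>x. z * h x - kernel_op K h x) x
        + ennreal (cmod (LINT y|lborel. (?\<psi> x - ?\<psi> y) * (K x y * h y)))"
    using cutoff_bounds[of c N x] by (simp add: ennreal_leI flip: ennreal_mult ennreal_plus)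
  also have "\<dots> \<le> ?I * eabs (\<lambda>x. z * h x - kernel_op K h x) x
      + (\<integral>\<^sup>+y. ennreal (cmod ((?\<psi> x - ?\<psi> y) * (K x y * h y))) \<partial>lborel)"
  proof (rule add_mono)
    show "ennreal (?\<psi> x) * eabs (\<lambda>x. z * h x - kernel_op K h x) x \<le> ?I * eabs (\<lambda>x. z * h x - kernel_op K h x) x"
      using cutoff_bounds[of c N x] cutoff_eq_0[OF N_pos, of c x]
      by (intro mult_right_mono) (auto simp: indicator_def ennreal_le_1)
    have "integrable lborel (\<lambda>y. ?\<psi> x * (K x y * h y) - K x y * (?\<psi> y * h y))"
      using int1 int2 by (intro Bochner_Integration.integrable_diff) auto
    then have "integrable lborel (\<lambda>y. (?\<psi> x - ?\<psi> y) * (K x y * h y))"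
      by (rule Bochner_Integration.integrable_cong[OF refl, THEN iffD1, rotated]) (auto simp: algebra_simps)
    then show "ennreal (cmod (LINT y|lborel. (?\<psi> x - ?\<psi> y) * (K x y * h y)))
        \<le> (\<integral>\<^sup>+y. ennreal (cmod ((?\<psi> x - ?\<psi> y) * (K x y * h y))) \<partial>lborel)"
      by (rule integral_norm_bound_ennreal)
  qed
  also have "\<dots> \<le> ?I * eabs (\<lambda>x. z * h x - kernel_op K h x) x + (\<integral>\<^sup>+y. ?I * ?far y + ?near y \<partial>lborel)"
    by (intro add_left_mono nn_integral_mono pointwise)
  also have "(\<integral>\<^sup>+y. ?I * ?far y + ?near y \<partial>lborel) = ?I * (\<integral>\<^sup>+y. ?far y \<partial>lborel) + (\<integral>\<^sup>+y. ?near y \<partial>lborel)"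
    by (subst nn_integral_add) (auto simp: nn_integral_cmult)
  finally show ?thesis
    by (simp add: distrib_left add.assoc radconv_def)
qed

end

section \<open>The local estimate\<close>

context dominated_kernel
begin

text \<open>The tail of \<open>r\<close> beyond \<open>L\<close>, cut to zero inside, is not
  decreasing. Flattening \<open>r\<close> to the constant \<open>r L\<close> inside gives a
  decreasing majorant of the tail, to which \<open>wint_radconv\<close> applies.\<close>

lemma antimono_r_max: "antimono (\<lambda>t. r (max t L))"
  by (intro antimonoI antimonoD[OF r_antimono]) auto

lemma tail_tendsto_0:
  "(\<lambda>k. radmass TYPE('n) (\<lambda>t. r t * indicator {real k<..} t)) \<longlonglongrightarrow> 0"
proof -
  have "(\<lambda>k. \<integral>\<^sup>+x. r (infnorm (x :: real ^ 'n)) * indicator {real k<..} (infnorm x) \<partial>lborel)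
      \<longlonglongrightarrow> (\<integral>\<^sup>+x. (\<lambda>_ :: real ^ 'n. 0) x \<partial>lborel)"
  proof (rule nn_integral_dominated_convergence)
    show "(\<integral>\<^sup>+x. r (infnorm (x :: real ^ 'n)) \<partial>lborel) < \<infinity>"
      using r_mass by (simp add: radmass_def)
    show "AE x in lborel. (\<lambda>k. r (infnorm (x :: real ^ 'n)) * indicator {real k<..} (infnorm x)) \<longlonglongrightarrow> 0"
    proof (rule AE_I2)
      fix x :: "real ^ 'n"
      obtain k0 :: nat where "infnorm x \<le> real k0"
        using real_arch_simple by blast
      then have "\<forall>\<^sub>F k in sequentially. r (infnorm x) * indicator {real k<..} (infnorm x) = 0"
        by (auto simp: eventually_sequentially indicator_def intro!: exI[of _ k0])
      then show "(\<lambda>k. r (infnorm x) * indicator {real k<..} (infnorm x)) \<longlonglongrightarrow> 0"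
        by (rule tendsto_eventually)
    qed
  qed (auto simp: indicator_def)
  then show ?thesis
    by (simp add: radmass_def)
qed

text \<open>The flat part has mass r(L) (2L)^d. By \<open>radmass_shell\<close> it is charged to the
  shell between L/2 and L, where \<open>r\<close> is at least r(L) and which lies in the tail beyond
  \<open>s\<close>. So flattening does not spoil smallness of the tail.\<close>

lemma radmass_r_max_le:
  assumes L: "0 < L" and s: "s \<le> L / 2"
  shows "radmass TYPE('n) (\<lambda>t. r (max t L))
    \<le> ennreal (1 + 2 ^ CARD('n)) * radmass TYPE('n) (\<lambda>t. r t * indicator {s<..} t)"
proof -
  let ?\<tau> = "radmass TYPE('n) (\<lambda>t. r t * indicator {s<..} t)"
  have "radmass TYPE('n) (\<lambda>t. r (max t L))
      \<le> radmass TYPE('n) (\<lambda>t. r L * indicator {..L} t + r t * indicator {s<..} t)"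
    using L s by (intro radmass_mono) (auto simp: max_def indicator_def)
  also have "\<dots> = r L * ennreal ((2 * L) ^ CARD('n)) + ?\<tau>"
    using L by (simp add: radmass_add radmass_cmult radmass_indicator)
  also have "r L * ennreal ((2 * L) ^ CARD('n)) \<le> ennreal (2 ^ CARD('n)) * ?\<tau>"
  proof -
    have "r L * ennreal (L ^ CARD('n)) \<le> r L * radmass TYPE('n) (indicator {L / 2<..L})"
      using L by (intro mult_left_mono radmass_shell) auto
    also have "\<dots> = radmass TYPE('n) (\<lambda>t. r L * indicator {L / 2<..L} t)"
      by (simp add: radmass_cmult)
    also have "\<dots> \<le> ?\<tau>"
      using s by (intro radmass_mono) (auto simp: indicator_def intro: antimonoD[OF r_antimono])
    finally have "ennreal (2 ^ CARD('n)) * (r L * ennreal (L ^ CARD('n))) \<le> ennreal (2 ^ CARD('n)) * ?\<tau>"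
      by (rule mult_left_mono) simp
    moreover have "ennreal ((2 * L) ^ CARD('n)) = ennreal (2 ^ CARD('n)) * ennreal (L ^ CARD('n))"
      using L by (simp add: power_mult_distrib ennreal_mult)
    ultimately show ?thesis
      by (simp only: mult_ac)
  qed
  also have "ennreal (2 ^ CARD('n)) * ?\<tau> + ?\<tau> = ennreal (1 + 2 ^ CARD('n)) * ?\<tau>"
    by (simp add: distrib_right add.commute)
  finally show ?thesis
    by (simp add: add_right_mono)
qed

lemma r_max_mass_small:
  assumes "0 < e"
  shows "\<exists>L0\<ge>1. \<forall>L\<ge>L0. radmass TYPE('n) (\<lambda>t. r (max t L)) \<le> ennreal e"
proof -
  have "0 < ennreal (e / (1 + 2 ^ CARD('n)))"
    using assms by (simp add: add_pos_pos)
  then have "\<forall>\<^sub>F k in sequentially.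
      radmass TYPE('n) (\<lambda>t. r t * indicator {real k<..} t) < ennreal (e / (1 + 2 ^ CARD('n)))"
    by (rule order_tendstoD(2)[OF tail_tendsto_0])
  then obtain k where k: "radmass TYPE('n) (\<lambda>t. r t * indicator {real k<..} t) < ennreal (e / (1 + 2 ^ CARD('n)))"
    by (auto simp: eventually_sequentially)
  have "radmass TYPE('n) (\<lambda>t. r (max t L)) \<le> ennreal e" if L: "2 * real k + 1 \<le> L" for L
  proof -
    have "radmass TYPE('n) (\<lambda>t. r (max t L))
        \<le> ennreal (1 + 2 ^ CARD('n)) * radmass TYPE('n) (\<lambda>t. r t * indicator {real k<..} t)"
      using L by (intro radmass_r_max_le) auto
    also have "\<dots> \<le> ennreal (1 + 2 ^ CARD('n)) * ennreal (e / (1 + 2 ^ CARD('n)))"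
      using k by (intro mult_left_mono) auto
    also have "\<dots> = ennreal e"
      using assms by (subst ennreal_mult[symmetric]) (auto simp: add_nonneg_eq_0_iff)
    finally show ?thesis .
  qed
  then show ?thesis
    by (intro exI[of _ "2 * real k + 1"]) auto
qed

lemma r_max_mass_finite:
  assumes "0 < L"
  shows "radmass TYPE('n) (\<lambda>t. r (max t L)) < top"
proof -
  have "radmass TYPE('n) (\<lambda>t. r (max t L))
      \<le> ennreal (1 + 2 ^ CARD('n)) * radmass TYPE('n) (\<lambda>t. r t * indicator {0<..} t)"
    using assms by (intro radmass_r_max_le) auto
  also have "\<dots> \<le> ennreal (1 + 2 ^ CARD('n)) * radmass TYPE('n) r"
    by (intro mult_left_mono radmass_mono) (auto simp: indicator_def)
  also have "\<dots> < top"
    using r_mass by (simp add: ennreal_mult_less_top)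
  finally show ?thesis .
qed

lemma commutator_mass:
  assumes "0 < L"
  shows "radmass TYPE('n) (commutator_kernel L)
    = ennreal (1 / L) * radmass TYPE('n) r + radmass TYPE('n) (\<lambda>t. r (max t L))"
proof -
  note [measurable] = measurable_antimono[OF antimono_r_max]
  show ?thesis
    unfolding commutator_kernel_def by (simp add: radmass_add radmass_cmult)
qed

end

text \<open>Stability is stated for the functions that will be tested, bounded ones with bounded
  support, and for powers of norms: \<open>C0\<close> is a power of the original constant.\<close>

locale stable_kernel = muckenhoupt p w A + dominated_kernel K r
  for p and w :: "real ^ 'n::finite \<Rightarrow> ennreal" and A and K :: "'n kernel" and r +
  fixes z :: complex and C0 :: real
  assumes C0: "0 < C0"
    and stable: "\<lbrakk>\<phi> \<in> borel_measurable borel; \<And>x. cmod (\<phi> x) \<le> M; \<And>x. R < infnorm x \<Longrightarrow> \<phi> x = 0\<rbrakk> \<Longrightarrow>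
      ennreal C0 * wint p w (eabs \<phi>) \<le> wint p w (eabs (\<lambda>x. z * \<phi> x - kernel_op K \<phi> x))"
begin

text \<open>The factor 2^p comes from \<open>wint_add_le\<close>; 16 is the ratio of the radii 8N
  and N/2, between which \<open>doubling\<close> is applied; the 1 belongs to the terms supported
  near the cell and \<open>conv_const\<close> with 12^d to the commutator; \<open>C0\<close> is the
  stability constant.\<close>

definition "local_const = (2 powr p * (A * (16 ^ CARD('n)) powr p) * (1 + conv_const * 12 ^ CARD('n)) / C0) powr (1 / p)"

lemma local_const_pos: "0 < local_const"
proof -
  have "0 < 1 + conv_const * 12 ^ CARD('n)"
    using conv_const_pos by (intro add_pos_pos) auto
  then show ?thesis
    using A C0 by (simp add: local_const_def)
qed

text \<open>The far integral is centred at \<open>c\<close> but has to become a convolution at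
  \<open>x\<close>. For |c - y| > 4N, moving \<open>c\<close> to \<open>x\<close> and
  \<open>y\<close> within its cell changes the distance by at most 3N/2, so |c - y| / 2 exceeds both
  |x - y'| / 8 and 2N / 8. The factor 8 is generous; the maximum with 2N keeps only the tail of
  \<open>r\<close>.\<close>

lemma far_le:
  fixes x :: "real ^ 'n"
  assumes [measurable]: "H \<in> borel_measurable borel" and N: "0 < N"
  defines "c \<equiv> cell_center N x"
  shows "(\<integral>\<^sup>+y. indicator {u. 4 * N < infnorm (c - u)} y * r (infnorm (c - y) / 2) * H y \<partial>lborel)
    \<le> ennreal (A powr (1 / p)) * radconv (\<lambda>t. r (max t (2 * N) / 8)) (local_norm N H) x"
proof -
  have [measurable]: "(\<lambda>t. r (max t (2 * N) / 8)) \<in> borel_measurable borel"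
    by measurable
  have "(\<integral>\<^sup>+y. indicator {u. 4 * N < infnorm (c - u)} y * r (infnorm (c - y) / 2) * H y \<partial>lborel)
      \<le> ennreal (1 / N ^ CARD('n)) * (\<integral>\<^sup>+y. r (max (infnorm (x - y)) (2 * N) / 8) * ballint (N / 2) H (cell_center N y) \<partial>lborel)"
  proof (rule nn_integral_le_cell_averages[OF _ _ _ N])
    fix y y' :: "real ^ 'n" assume y: "infnorm (y - y') \<le> N"
    show "indicator {u. 4 * N < infnorm (c - u)} y * r (infnorm (c - y) / 2) \<le> r (max (infnorm (x - y')) (2 * N) / 8)"
    proof (cases "4 * N < infnorm (c - y)")
      case True
      have "infnorm (x - y') \<le> infnorm (x - c) + infnorm (c - y) + infnorm (y - y')"
        using infnorm_triangle_sub[of x y' c] infnorm_triangle_sub[of c y' y] by linarith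
      moreover have "infnorm (x - c) \<le> N / 2"
        using infnorm_cell_center[OF N, of x] by (simp add: c_def infnorm_sub)
      ultimately have "max (infnorm (x - y')) (2 * N) / 8 \<le> infnorm (c - y) / 2"
        using y True N by (simp add: max_def)
      then show ?thesis
        using True by (simp add: antimonoD[OF r_antimono])
    qed simp
  qed measurable
  also have "\<dots> \<le> ennreal (1 / N ^ CARD('n)) * (\<integral>\<^sup>+y. r (max (infnorm (x - y)) (2 * N) / 8)
      * (ennreal (A powr (1 / p) * N ^ CARD('n)) * local_norm N H y) \<partial>lborel)"
    using N by (intro mult_left_mono nn_integral_mono ballint_le_local_norm) auto
  also have "\<dots> = ennreal (1 / N ^ CARD('n)) * (ennreal (A powr (1 / p) * N ^ CARD('n))
      * radconv (\<lambda>t. r (max t (2 * N) / 8)) (local_norm N H) x)"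
    by (subst radconv_cmult[symmetric]) (auto simp: radconv_def)
  also have "\<dots> = ennreal (A powr (1 / p)) * radconv (\<lambda>t. r (max t (2 * N) / 8)) (local_norm N H) x"
    using N by (simp add: mult.assoc[symmetric] ennreal_mult[symmetric])
  finally show ?thesis .
qed

text \<open>Test stability with the cutoff of \<open>h\<close> about the cell. The left side is at
  least a multiple of \<alpha>(x)^p times the weight of the cell; every term on the right is a
  weight-free quantity times the weight of a ball inside the ball of radius 8N. Doubling compares
  the two weights, and they cancel.\<close>

lemma local_estimate:
  fixes h :: "real ^ 'n \<Rightarrow> complex" and x :: "real ^ 'n"
  assumes [measurable]: "h \<in> borel_measurable borel" and h: "\<And>y. cmod (h y) \<le> M"
    and L: "1 \<le> L" and N: "N = L\<^sup>2"
    and U: "\<And>x'. infnorm (x - x') \<le> 5 * N \<Longrightarrow> eabs (\<lambda>x. z * h x - kernel_op K h x) x' \<le> U"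
  defines "\<alpha> \<equiv> local_norm N (eabs h)"
  shows "\<alpha> x \<le> ennreal local_const * (U
      + ennreal (A powr (1 / p)) * radconv (\<lambda>t. r (max t (2 * N) / 8)) \<alpha> x
      + radmass TYPE('n) (commutator_kernel L) * (ennreal (1 / N ^ CARD('n)) * ballint (7 * N) \<alpha> x))"
proof -
  have N_pos: "0 < N"
    using L N by simp
  define c where "c = cell_center N x"
  have c: "infnorm (c - x) \<le> N / 2" "infnorm (x - c) \<le> N / 2"
    using infnorm_cell_center[OF N_pos, of x] by (auto simp: c_def infnorm_sub)
  let ?H = "eabs h" and ?W = "ballint (N / 2) w c" and ?W8 = "ballint (8 * N) w c"
  let ?Hp = "\<lambda>y. epowr (?H y) p * w y"
  let ?I = "\<lambda>k. indicator {u. infnorm (c - u) \<le> k * N} :: _ \<Rightarrow> ennreal"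
  define F where "F = (\<integral>\<^sup>+y. indicator {u. 4 * N < infnorm (c - u)} y * r (infnorm (c - y) / 2) * ?H y \<partial>lborel)"
  define a where "a = ennreal (1 / N ^ CARD('n)) * ballint (7 * N) \<alpha> x"
  define J where "J = radmass TYPE('n) (commutator_kernel L)"
  \<comment> \<open>\<open>X\<close> collects the weight-free quantities: the local bound of (z - T)
    h, the far integral, and the mass of the commutator times an average of local norms.\<close>
  define X where "X = U + F + J * a"
  define D where "D = A * (16 ^ CARD('n)) powr p"
  have D_pos: "0 < D"
    using A by (simp add: D_def)
  define Q where "Q = 2 powr p * (1 + conv_const * 12 ^ CARD('n))"
  have "0 < 1 + conv_const * 12 ^ CARD('n)"
    using conv_const_pos by (intro add_pos_pos) auto
  then have Q_pos: "0 < Q"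
    by (simp add: Q_def)
  have local_const: "local_const = (Q * D / C0) powr (1 / p)"
    by (simp add: local_const_def Q_def D_def mult_ac)
  have J_fin: "J < top"
    unfolding J_def using L r_mass r_max_mass_finite[of L]
    by (subst commutator_mass) (auto simp: ennreal_mult_less_top)
  have W8: "?W8 \<le> ennreal D * ?W"
    using doubling[of "N / 2" c c "8 * N"] N_pos by (simp add: infnorm_0 D_def)
  have le1: "(U + F) \<le> X" and le2: "J * a \<le> X"
    by (auto simp: X_def add_increasing add_increasing2)
  let ?\<phi> = "\<lambda>y. cutoff c N y * h y"
  have \<phi>_bound: "cmod (?\<phi> y) \<le> M" for y
    using h[of y] cutoff_bounds[of c N y] mult_left_le_one_le[of "cmod (h y)" "cutoff c N y"]
    by (simp add: norm_mult)
  have \<phi>_supp: "?\<phi> y = 0" if "infnorm c + 2 * N < infnorm y" for y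
  proof -
    have "infnorm y \<le> infnorm c + infnorm (c - y)"
      using infnorm_triangle_sub[of y 0 c] infnorm_sub[of y c] by simp
    then show ?thesis
      using that cutoff_eq_0[OF N_pos, of c y] by simp
  qed
  have "epowr (\<alpha> x) p * ?W = ballint (N / 2) ?Hp c"
    unfolding \<alpha>_def c_def by (rule epowr_local_norm[OF N_pos])
  also have "\<dots> \<le> wint p w (eabs ?\<phi>)"
    unfolding radconv_def wint_def
  proof (intro nn_integral_mono)
    fix y
    show "indicator {..N / 2} (infnorm (c - y)) * ?Hp y \<le> epowr (eabs ?\<phi> y) p * w y"
    proof (cases "infnorm (c - y) \<le> N / 2")
      case True
      then have "cutoff c N y = 1"
        using N_pos by (intro cutoff_eq_1) auto
      then show ?thesis
        using True by simp
    qed simp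
  qed
  finally have "ennreal C0 * (epowr (\<alpha> x) p * ?W) \<le> ennreal C0 * wint p w (eabs ?\<phi>)"
    by (rule mult_left_mono) simp
  also have "\<dots> \<le> wint p w (eabs (\<lambda>x. z * ?\<phi> x - kernel_op K ?\<phi> x))"
    using \<phi>_bound \<phi>_supp by (intro stable) auto
  also have "\<dots> \<le> wint p w (\<lambda>x'. ?I 2 x' * (U + F) + radconv (commutator_kernel L) (\<lambda>y. ?I 4 y * ?H y) x')"
  proof (intro wint_mono)
    fix x'
    have "?I 2 x' * (eabs (\<lambda>x. z * h x - kernel_op K h x) x' + F) \<le> ?I 2 x' * (U + F)"
    proof (cases "infnorm (c - x') \<le> 2 * N")
      case True
      then have "infnorm (x - x') \<le> 5 * N"
        using infnorm_triangle_sub[of x x' c] c N_pos by linarith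
      then show ?thesis
        by (intro mult_left_mono add_right_mono U) auto
    qed simp
    then show "eabs (\<lambda>x. z * ?\<phi> x - kernel_op K ?\<phi> x) x'
        \<le> ?I 2 x' * (U + F) + radconv (commutator_kernel L) (\<lambda>y. ?I 4 y * ?H y) x'"
      using commutator_bound[OF _ h L N, where z = z and c = c and x = x'] unfolding F_def
      by (meson add_right_mono assms(1) order_trans)
  qed simp
  also have "\<dots> \<le> ennreal (2 powr p) * (wint p w (\<lambda>x'. ?I 2 x' * (U + F))
      + wint p w (radconv (commutator_kernel L) (\<lambda>y. ?I 4 y * ?H y)))"
    by (intro wint_add_le) auto
  also have "\<dots> \<le> ennreal (2 powr p) * (epowr X p * ?W8
      + ennreal conv_const * (ennreal (12 ^ CARD('n)) * (epowr X p * ?W8)))"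
  proof (intro mult_left_mono add_mono)
    have "wint p w (\<lambda>x'. ?I 2 x' * (U + F)) = (\<integral>\<^sup>+y. epowr (U + F) p * (indicator {..2 * N} (infnorm (c - y)) * w y) \<partial>lborel)"
      unfolding wint_def by (intro nn_integral_cong) (auto simp: indicator_def)
    also have "\<dots> = epowr (U + F) p * ballint (2 * N) w c"
      unfolding radconv_def by (rule nn_integral_cmult) measurable
    also have "\<dots> \<le> epowr X p * ?W8"
      using N_pos by (intro mult_mono epowr_mono le1 ballint_mono_radius) auto
    finally show "wint p w (\<lambda>x'. ?I 2 x' * (U + F)) \<le> epowr X p * ?W8" .
    have "wint p w (radconv (commutator_kernel L) (\<lambda>y. ?I 4 y * ?H y))
        \<le> ennreal conv_const * epowr J p * wint p w (\<lambda>y. ?I 4 y * ?H y)"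
      unfolding J_def using J_fin by (intro wint_radconv antimono_commutator_kernel) (auto simp: J_def)
    also have "wint p w (\<lambda>y. ?I 4 y * ?H y) = ballint (4 * N) ?Hp c"
      unfolding wint_def radconv_def by (intro nn_integral_cong) (auto simp: indicator_def)
    also have "\<dots> \<le> ballint (5 * N) ?Hp x"
      using c N_pos by (intro ballint_le_ballint) auto
    also have "\<dots> \<le> ennreal (12 ^ CARD('n)) * epowr a p * ballint (7 * N) w x"
      unfolding a_def \<alpha>_def by (intro ballint_le_average_local_norm N_pos) auto
    also have "\<dots> \<le> ennreal (12 ^ CARD('n)) * epowr a p * ?W8"
      using c N_pos by (intro mult_left_mono ballint_le_ballint) auto
    also have "ennreal conv_const * epowr J p * (ennreal (12 ^ CARD('n)) * epowr a p * ?W8)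
        = ennreal conv_const * (ennreal (12 ^ CARD('n)) * (epowr (J * a) p * ?W8))"
      by (simp add: epowr_mult mult_ac)
    also have "\<dots> \<le> ennreal conv_const * (ennreal (12 ^ CARD('n)) * (epowr X p * ?W8))"
      by (intro mult_left_mono mult_right_mono epowr_mono le2) auto
    finally show "wint p w (radconv (commutator_kernel L) (\<lambda>y. ?I 4 y * ?H y))
        \<le> ennreal conv_const * (ennreal (12 ^ CARD('n)) * (epowr X p * ?W8))"
      by (simp add: mult_left_mono)
  qed auto
  also have "\<dots> = ennreal Q * epowr X p * ?W8"
    using conv_const_pos by (simp add: Q_def ennreal_mult distrib_left distrib_right mult_ac)
  also have "\<dots> \<le> ennreal Q * epowr X p * (ennreal D * ?W)"
    by (intro mult_left_mono W8) auto
  finally have "ennreal C0 * epowr (\<alpha> x) p * ?W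
      \<le> ennreal Q * ennreal D * epowr X p * ?W"
    by (simp only: mult_ac)
  \<comment> \<open>The weight of the cell is positive and finite and cancels; from here on
    \<open>w\<close> is present only inside \<alpha>.\<close>
  then have "ennreal C0 * epowr (\<alpha> x) p
      \<le> ennreal Q * ennreal D * epowr X p"
    using ball_pos[of "N / 2" c] ball_finite[of "N / 2" c] N_pos
    by (subst (asm) mult.commute, subst (asm) mult.commute[of _ ?W], subst (asm) ennreal_mult_le_mult_iff) auto
  then have "ennreal (1 / C0) * (ennreal C0 * epowr (\<alpha> x) p)
      \<le> ennreal (1 / C0) * (ennreal Q * ennreal D * epowr X p)"
    by (rule mult_left_mono) simp
  also have "\<dots> = ennreal (Q * D / C0) * epowr X p"
  proof -
    have "ennreal (1 / C0) * (ennreal Q * ennreal D) = ennreal (Q * D / C0)"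
      using C0 D_pos Q_pos by (simp add: ennreal_mult[symmetric])
    then show ?thesis
      by (simp only: mult.assoc[symmetric])
  qed
  also have "ennreal (Q * D / C0) = epowr (ennreal local_const) p"
    using C0 D_pos Q_pos p by (simp add: local_const epowr_ennreal powr_powr)
  finally have "epowr (\<alpha> x) p \<le> epowr (ennreal local_const * X) p"
    using C0 by (simp add: epowr_mult mult.assoc[symmetric] ennreal_mult[symmetric])
  then have "\<alpha> x \<le> ennreal local_const * X"
    by (simp add: epowr_le_iff)
  also have "\<dots> \<le> ennreal local_const * (U + ennreal (A powr (1 / p)) * radconv (\<lambda>t. r (max t (2 * N) / 8)) \<alpha> x + J * a)"
    unfolding X_def F_def c_def \<alpha>_def
    by (intro mult_left_mono add_mono far_le N_pos order_refl) auto
  finally show ?thesis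
    unfolding J_def a_def .
qed

end

text \<open>The two smallness conditions of \<open>wint_absorb\<close>, solved for the mass. The
  threshold depends only on the weight in which absorption takes place, so it can be fixed before
  the scales are chosen.\<close>

lemma (in muckenhoupt) absorption_threshold:
  obtains e where "0 < e"
    and "\<And>\<rho>. radmass TYPE('n) \<rho> \<le> ennreal e \<Longrightarrow> radmass TYPE('n) \<rho> \<le> 1 / 2"
    and "\<And>\<rho>. radmass TYPE('n) \<rho> \<le> ennreal e \<Longrightarrow>
      ennreal (2 powr p * conv_const) * epowr (radmass TYPE('n) \<rho>) p \<le> 1 / 2"
proof
  define Q where "Q = 2 powr p * conv_const"
  have Q: "0 < Q"
    using conv_const_pos by (simp add: Q_def)
  let ?e = "min (1 / 2) ((1 / (2 * Q)) powr (1 / p))"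
  have half: "(1 / 2 :: ennreal) = ennreal (1 / 2)"
    by (simp add: divide_ennreal_def)
  show "0 < ?e"
    using Q by simp
  fix \<rho> assume \<rho>: "radmass TYPE('n) \<rho> \<le> ennreal ?e"
  also have "\<dots> \<le> ennreal (1 / 2)"
    by (intro ennreal_leI) simp
  finally show "radmass TYPE('n) \<rho> \<le> 1 / 2"
    unfolding half .
  have "epowr (radmass TYPE('n) \<rho>) p \<le> epowr (ennreal ((1 / (2 * Q)) powr (1 / p))) p"
    by (intro epowr_mono order_trans[OF \<rho>] ennreal_leI) auto
  also have "\<dots> = ennreal (1 / (2 * Q))"
    using Q p by (simp add: epowr_ennreal powr_powr)
  finally have "ennreal Q * epowr (radmass TYPE('n) \<rho>) p \<le> ennreal Q * ennreal (1 / (2 * Q))"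
    by (rule mult_left_mono) simp
  also have "\<dots> = ennreal (1 / 2)"
    using Q by (simp add: ennreal_mult[symmetric])
  finally show "ennreal (2 powr p * conv_const) * epowr (radmass TYPE('n) \<rho>) p \<le> 1 / 2"
    unfolding half Q_def .
qed

section \<open>Small mass near the diagonal and inversion of the near part\<close>

context dominated_kernel
begin

lemma near_tendsto_0:
  "(\<lambda>k. radmass TYPE('n) (\<lambda>t. r t * indicator {..<1 / real (Suc k)} t)) \<longlonglongrightarrow> 0"
proof -
  have "(\<lambda>k. \<integral>\<^sup>+x. r (infnorm (x :: real ^ 'n)) * indicator {..<1 / real (Suc k)} (infnorm x) \<partial>lborel)
      \<longlonglongrightarrow> (\<integral>\<^sup>+x. (\<lambda>_ :: real ^ 'n. 0) x \<partial>lborel)"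
  proof (rule nn_integral_dominated_convergence)
    show "(\<integral>\<^sup>+x. r (infnorm (x :: real ^ 'n)) \<partial>lborel) < \<infinity>"
      using r_mass by (simp add: radmass_def)
    show "AE x in lborel. (\<lambda>k. r (infnorm (x :: real ^ 'n)) * indicator {..<1 / real (Suc k)} (infnorm x)) \<longlonglongrightarrow> 0"
    \<comment> \<open>The origin lies in every ball and \<open>r 0\<close> may be infinite; it is
      discarded as a null set.\<close>
    proof (rule eventually_mono[OF AE_lborel_singleton[of 0]])
      fix x :: "real ^ 'n" assume "x \<noteq> 0"
      then have x: "0 < infnorm x"
        by (simp add: infnorm_pos_lt)
      have "\<forall>\<^sub>F k in sequentially. 1 / real (Suc k) < infnorm x"
        using LIMSEQ_Suc[OF lim_1_over_n] x by (intro order_tendstoD(2)) auto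
      then have "\<forall>\<^sub>F k in sequentially. r (infnorm x) * indicator {..<1 / real (Suc k)} (infnorm x) = 0"
        by eventually_elim (auto simp: indicator_def)
      then show "(\<lambda>k. r (infnorm x) * indicator {..<1 / real (Suc k)} (infnorm x)) \<longlonglongrightarrow> 0"
        by (rule tendsto_eventually)
    qed
  qed (auto simp: indicator_def)
  then show ?thesis
    by (simp add: radmass_def)
qed

lemma near_mass_small:
  assumes "0 < e"
  obtains \<eta> where "0 < \<eta>" "radmass TYPE('n) (\<lambda>t. r t * indicator {..<\<eta>} t) \<le> ennreal e"
proof -
  have "\<forall>\<^sub>F k in sequentially. radmass TYPE('n) (\<lambda>t. r t * indicator {..<1 / real (Suc k)} t) < ennreal e"
    using assms by (intro order_tendstoD(2)[OF near_tendsto_0]) auto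
  then obtain k where "radmass TYPE('n) (\<lambda>t. r t * indicator {..<1 / real (Suc k)} t) < ennreal e"
    by (auto simp: eventually_sequentially)
  then show ?thesis
    by (intro that[of "1 / real (Suc k)"]) auto
qed

text \<open>A shift of the radius is compared with a dilation, which changes the mass only by a
  factor. The slope \<open>c\<close> is chosen so that the line c t reaches \<eta> exactly at t = s
  + \<eta>, where t - s overtakes \<eta>; hence max(t - s, \<eta>) is at least both c t and c
  \<eta>.\<close>

lemma shifted_mass_finite:
  assumes \<eta>: "0 < \<eta>" and s: "0 \<le> s"
  shows "radmass TYPE('n) (\<lambda>t. r (max (t - s) \<eta>)) < top"
proof -
  define c where "c = \<eta> / (s + \<eta>)"
  have c: "0 < c" "c \<le> 1"
    using assms by (auto simp: c_def)
  note [measurable] = measurable_antimono[OF antimono_r_max]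
  have "max (t / (1 / c)) (c * \<eta>) \<le> max (t - s) \<eta>" for t
  proof (cases "t \<le> s + \<eta>")
    case True
    have "c * t \<le> c * (s + \<eta>)"
      using True c by (intro mult_left_mono) auto
    also have "\<dots> = \<eta>"
      using assms by (simp add: c_def)
    finally have "t * c \<le> \<eta>"
      by (simp add: mult.commute)
    moreover have "c * \<eta> \<le> \<eta>"
      using c \<eta> by simp
    ultimately show ?thesis
      by (simp add: le_max_iff_disj)
  next
    case False
    have "(s + \<eta>) * (1 - c) \<le> t * (1 - c)"
      using False c by (intro mult_right_mono) auto
    moreover have "(s + \<eta>) * (1 - c) = s"
      using assms by (simp add: c_def right_diff_distrib)
    ultimately have "t * c \<le> t - s"
      by (simp add: algebra_simps)
    moreover have "c * \<eta> \<le> \<eta>"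
      using c \<eta> by simp
    ultimately show ?thesis
      using max.mono[of "t * c" "t - s" "c * \<eta>" \<eta>] by simp
  qed
  then have "radmass TYPE('n) (\<lambda>t. r (max (t - s) \<eta>)) \<le> radmass TYPE('n) (\<lambda>t. r (max (t / (1 / c)) (c * \<eta>)))"
    by (intro radmass_mono antimonoD[OF r_antimono])
  also have "\<dots> = ennreal ((1 / c) ^ CARD('n)) * radmass TYPE('n) (\<lambda>t. r (max t (c * \<eta>)))"
    using c by (intro radmass_scale) auto
  also have "\<dots> < top"
    using r_max_mass_finite[of "c * \<eta>"] c \<eta> by (simp add: ennreal_mult_less_top)
  finally show ?thesis .
qed

lemma antimono_shifted: "antimono (\<lambda>t. r (max (t - s) \<eta>))"
  by (intro antimonoI antimonoD[OF r_antimono]) auto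

text \<open>Neumann series for \<open>(z - K)\<^sup>-\<^sup>1\<close> in the supremum norm.\<close>
lemma bounded_resolvent:
  assumes [measurable]: "g \<in> borel_measurable borel" and g: "\<And>x. cmod (g x) \<le> M"
    and z: "z \<noteq> 0" and small: "radmass TYPE('n) r \<le> ennreal (cmod z / 2)"
  obtains G B where "G \<in> borel_measurable borel" "\<And>x. cmod (G x) \<le> B"
    "\<And>x. z * G x = g x + kernel_op K G x"
proof -
  have M: "0 \<le> M"
    using g[of 0] norm_ge_zero[of "g 0"] by linarith
  define B where "B = M / cmod z"
  have B: "0 \<le> B"
    using M z by (simp add: B_def)
  have R: "enn2real (radmass TYPE('n) r) \<le> cmod z / 2"
    using small by (intro enn2real_leI) auto
  \<comment> \<open>Mass at most |z| / 2 makes division by z after the operator a contraction with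
    factor 1/2.\<close>
  have op_le: "cmod (kernel_op K \<phi> x / z) \<le> b / 2" if "\<And>y. cmod (\<phi> y) \<le> b" "0 \<le> b" for \<phi> b x
  proof -
    have "cmod (kernel_op K \<phi> x) \<le> cmod z / 2 * b"
      using kernel_op_bounded[OF that, where x = x] R that(2) by (meson mult_right_mono order_trans)
    then show ?thesis
      using z by (simp add: norm_divide field_simps)
  qed
  define S where "S k = ((\<lambda>G x. (g x + kernel_op K G x) / z) ^^ k) (\<lambda>_. 0)" for k
  have S_0: "S 0 = (\<lambda>_. 0)" and S_Suc: "S (Suc k) = (\<lambda>x. (g x + kernel_op K (S k) x) / z)" for k
    by (auto simp: S_def)
  have S_meas [measurable]: "S k \<in> borel_measurable borel" for k
    by (induction k) (simp_all add: S_0 S_Suc)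
  have S_bound: "cmod (S k x) \<le> 2 * B" for k x
  proof (induction k arbitrary: x)
    case (Suc k)
    have "cmod (S (Suc k) x) \<le> cmod (g x / z) + cmod (kernel_op K (S k) x / z)"
      unfolding S_Suc add_divide_distrib by (rule norm_triangle_ineq)
    also have "\<dots> \<le> B + 2 * B / 2"
      using g[of x] z B Suc by (intro add_mono op_le) (auto simp: B_def norm_divide divide_right_mono)
    finally show ?case by simp
  qed (use B in \<open>simp add: S_0\<close>)
  have conv_fin: "radconv r (eabs \<phi>) x < top" if "\<And>y. cmod (\<phi> y) \<le> b" for \<phi> b and x :: "real ^ 'n"
    by (rule le_less_trans[OF radconv_bounded[of \<phi> b x, OF that]]) (use r_mass in \<open>simp add: ennreal_mult_less_top\<close>)
  have op_diff: "kernel_op K (\<lambda>y. \<phi> y - \<psi> y) x = kernel_op K \<phi> x - kernel_op K \<psi> x"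
    if "\<phi> \<in> borel_measurable borel" "\<psi> \<in> borel_measurable borel" "\<And>y. cmod (\<phi> y) \<le> b" "\<And>y. cmod (\<psi> y) \<le> b"
    for \<phi> \<psi> b and x :: "real ^ 'n"
    using that by (intro kernel_op_diff conv_fin)
  have step: "cmod (S (Suc k) x - S k x) \<le> B / 2 ^ k" for k x
  proof (induction k arbitrary: x)
    case 0
    show ?case
      using g[of x] z by (simp add: S_Suc S_0 kernel_op_def B_def norm_divide divide_right_mono)
  next
    case (Suc k)
    have "S (Suc (Suc k)) x - S (Suc k) x = kernel_op K (\<lambda>y. S (Suc k) y - S k y) x / z"
    proof -
      have "kernel_op K (\<lambda>y. S (Suc k) y - S k y) x = kernel_op K (S (Suc k)) x - kernel_op K (S k) x"
        by (rule op_diff[OF S_meas S_meas S_bound S_bound])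
      then show ?thesis
        unfolding S_Suc[of "Suc k"] by (simp add: S_Suc[of k] diff_divide_distrib add_divide_distrib)
    qed
    then have "cmod (S (Suc (Suc k)) x - S (Suc k) x) \<le> B / 2 ^ k / 2"
      using op_le[OF Suc.IH] B by simp
    then show ?case
      by (simp add: mult.commute)
  qed
  have dist: "cmod (S m x - S k x) \<le> 2 * B / 2 ^ k - 2 * B / 2 ^ m" if "k \<le> m" for k m x
    using that
  proof (induction m rule: dec_induct)
    case (step m)
    have "cmod (S (Suc m) x - S k x) \<le> cmod (S (Suc m) x - S m x) + cmod (S m x - S k x)"
      using norm_triangle_ineq[of "S (Suc m) x - S m x" "S m x - S k x"] by simp
    also have "\<dots> \<le> B / 2 ^ m + (2 * B / 2 ^ k - 2 * B / 2 ^ m)"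
      by (intro add_mono \<open>\<And>k x. cmod (S (Suc k) x - S k x) \<le> B / 2 ^ k\<close> step.IH)
    finally show ?case
      by (simp add: field_simps)
  qed simp
  have tail0: "(\<lambda>k. 2 * B / 2 ^ k) \<longlonglongrightarrow> 0"
    by (rule LIMSEQ_divide_realpow_zero) simp
  have "Cauchy (\<lambda>k. S k x)" for x
  proof (rule CauchyI')
    fix e :: real assume "0 < e"
    then have "\<forall>\<^sub>F k in sequentially. 2 * B / 2 ^ k < e"
      using tail0 by (intro order_tendstoD(2))
    then obtain k0 where k0: "\<And>k. k0 \<le> k \<Longrightarrow> 2 * B / 2 ^ k < e"
      by (auto simp: eventually_sequentially)
    have "cmod (S k x - S m x) < e" if "k0 \<le> k" "k < m" for k m
    proof -
      have "0 \<le> 2 * B / 2 ^ m"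
        using B by simp
      then show ?thesis
        using dist[of k m x] k0[of k] that by (simp add: norm_minus_commute)
    qed
    then show "\<exists>k0. \<forall>k\<ge>k0. \<forall>m>k. dist (S k x) (S m x) < e"
      unfolding dist_norm by blast
  qed
  then have "\<exists>l. (\<lambda>k. S k x) \<longlonglongrightarrow> l" for x
    by (simp add: Cauchy_convergent_iff convergent_def)
  then obtain G where G: "\<And>x. (\<lambda>k. S k x) \<longlonglongrightarrow> G x"
    by metis
  have [measurable]: "G \<in> borel_measurable borel"
    by (rule borel_measurable_LIMSEQ_metric[OF S_meas]) (rule G)
  have G_bound: "cmod (G x) \<le> 2 * B" for x
    by (rule LIMSEQ_le_const2[OF tendsto_norm[OF G]]) (use S_bound in blast)
  have G_dist: "cmod (G x - S k x) \<le> 2 * B / 2 ^ k" for x k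
  proof (rule LIMSEQ_le_const2[OF tendsto_norm[OF tendsto_diff[OF G tendsto_const]]])
    have "cmod (S m x - S k x) \<le> 2 * B / 2 ^ k" if "k \<le> m" for m
    proof -
      have "0 \<le> 2 * B / 2 ^ m"
        using B by simp
      then show ?thesis
        using dist[OF that, of x] by linarith
    qed
    then show "\<exists>N. \<forall>n\<ge>N. cmod (S n x - S k x) \<le> 2 * B / 2 ^ k"
      by blast
  qed
  have "z * G x = g x + kernel_op K G x" for x
  proof -
    have close: "cmod (kernel_op K (S k) x / z - kernel_op K G x / z) \<le> 2 * B / 2 ^ k / 2" for k
    proof -
      have "kernel_op K (\<lambda>y. S k y - G y) x = kernel_op K (S k) x - kernel_op K G x"
        using S_bound G_bound by (intro op_diff[where b = "2 * B"]) auto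
      then show ?thesis
        using op_le[of "\<lambda>y. S k y - G y" "2 * B / 2 ^ k" x] G_dist B
        by (simp add: diff_divide_distrib norm_minus_commute)
    qed
    have "(\<lambda>k. 2 * B / 2 ^ k / 2) \<longlonglongrightarrow> 0"
      using tendsto_divide[OF tail0 tendsto_const[of 2]] by simp
    then have "(\<lambda>k. kernel_op K (S k) x / z - kernel_op K G x / z) \<longlonglongrightarrow> 0"
      by (rule Lim_null_comparison[OF always_eventually[OF allI[OF close]]])
    then have "(\<lambda>k. kernel_op K (S k) x / z) \<longlonglongrightarrow> kernel_op K G x / z"
      by (rule LIM_zero_cancel)
    then have "(\<lambda>k. S (Suc k) x) \<longlonglongrightarrow> (g x + kernel_op K G x) / z"
      unfolding S_Suc add_divide_distrib by (rule tendsto_add[OF tendsto_const])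
    then have "G x = (g x + kernel_op K G x) / z"
      using LIMSEQ_Suc[OF G] by (rule LIMSEQ_unique[rotated])
    then show ?thesis
      using z by (simp add: field_simps)
  qed
  then show ?thesis
    using G_bound by (intro that[of G "2 * B"]) auto
qed

end

section \<open>Choice of the scale\<close>

text \<open>\<open>N\<close> and \<rho> are fixed before \<open>h\<close> and \<open>U\<close>, so
  the inequality is uniform. The ball of radius 7N contributes mass 14^d at every scale; what
  becomes small is its coefficient, the mass of the commutator kernel.\<close>

lemma (in stable_kernel) exists_local_estimate:
  assumes e: "0 < e"
  obtains N \<rho> where "1 \<le> N" "antimono \<rho>" "radmass TYPE('n) \<rho> \<le> ennreal e"
    and "\<And>h M U x. \<lbrakk>h \<in> borel_measurable borel; \<And>y. cmod (h y) \<le> M;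
        \<And>x x'. infnorm (x - x') \<le> 5 * N \<Longrightarrow> eabs (\<lambda>x. z * h x - kernel_op K h x) x' \<le> U x\<rbrakk>
      \<Longrightarrow> local_norm N (eabs h) x \<le> ennreal local_const * U x + radconv \<rho> (local_norm N (eabs h)) x"
proof -
  define a where "a = A powr (1 / p)"
  \<comment> \<open>Solved from the final mass: 8^d is the cost of dilating by 8, 14^d is the
    normalised volume of the ball of radius 7N, and the commutator mass is at most 2d for this
    \<open>d\<close>.\<close>
  define d where "d = e / (local_const * (a * 8 ^ CARD('n) + 2 * 14 ^ CARD('n)))"
  have a: "0 < a"
    using A by (simp add: a_def)
  have den: "0 < local_const * (a * 8 ^ CARD('n) + 2 * 14 ^ CARD('n))"
    using a local_const_pos by (simp add: add_pos_pos)
  then have d: "0 < d"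
    using e by (simp add: d_def)
  obtain L0 where L0: "1 \<le> L0" "\<And>L. L0 \<le> L \<Longrightarrow> radmass TYPE('n) (\<lambda>t. r (max t L)) \<le> ennreal d"
    using r_max_mass_small[OF d] by blast
  define R where "R = enn2real (radmass TYPE('n) r)"
  have R: "radmass TYPE('n) r = ennreal R" "0 \<le> R"
    using r_mass by (auto simp: R_def)
  \<comment> \<open>\<open>L \<ge> 4\<close> gives \<open>L \<le> N / 4\<close>, so the dilated tail
    starts beyond \<open>L0\<close>; \<open>R / d \<le> L\<close> makes the Lipschitz part of the
    commutator mass at most \<open>d\<close>.\<close>
  define L where "L = max 4 (max L0 (R / d))"
  define N where "N = L\<^sup>2"
  have L: "4 \<le> L" "L0 \<le> L" "R / d \<le> L"
    by (auto simp: L_def)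
  have N4: "L \<le> N / 4"
    using L(1) mult_right_mono[of 4 L L] by (simp add: N_def power2_eq_square)
  have N: "1 \<le> N"
    using N4 L by linarith
  define J where "J = radmass TYPE('n) (commutator_kernel L)"
  have "J = ennreal (1 / L) * ennreal R + radmass TYPE('n) (\<lambda>t. r (max t L))"
    unfolding J_def using L R by (subst commutator_mass) auto
  also have "\<dots> \<le> ennreal d + ennreal d"
  proof (rule add_mono)
    have "R / L \<le> d"
      using L d by (simp add: field_simps)
    then show "ennreal (1 / L) * ennreal R \<le> ennreal d"
      using L R by (simp add: ennreal_mult[symmetric] ennreal_leI)
  qed (use L0 L in auto)
  finally have J: "J \<le> ennreal (2 * d)"
    using d by (simp flip: ennreal_plus)
  note [measurable] = measurable_antimono[OF antimono_r_max]
  have r8: "r (max t (2 * N) / 8) = (\<lambda>s. r (max s (N / 4))) (t / 8)" for t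
    by (simp add: max_def divide_right_mono)
  define \<rho> where "\<rho> t = ennreal local_const * (ennreal a * r (max t (2 * N) / 8)
      + J * (ennreal (1 / N ^ CARD('n)) * indicator {..7 * N} t))" for t
  have antimono_\<rho>: "antimono \<rho>"
    unfolding \<rho>_def
    by (intro antimonoI mult_left_mono add_mono antimonoD[OF r_antimono]) (auto simp: indicator_def)
  have r8_meas [measurable]: "(\<lambda>t. r (max t (2 * N) / 8)) \<in> borel_measurable borel"
    by measurable
  have "radmass TYPE('n) \<rho> = ennreal local_const * (ennreal a * radmass TYPE('n) (\<lambda>t. r (max t (2 * N) / 8))
      + J * (ennreal (1 / N ^ CARD('n)) * radmass TYPE('n) (indicator {..7 * N})))"
    unfolding \<rho>_def by (simp add: radmass_add radmass_cmult)
  also have "radmass TYPE('n) (\<lambda>t. r (max t (2 * N) / 8)) = ennreal (8 ^ CARD('n)) * radmass TYPE('n) (\<lambda>t. r (max t (N / 4)))"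
    unfolding r8 by (rule radmass_scale) auto
  also have "ennreal (1 / N ^ CARD('n)) * radmass TYPE('n) (indicator {..7 * N}) = ennreal (14 ^ CARD('n))"
  proof -
    have "(2 * (7 * N)) ^ CARD('n) = (14 * N) ^ CARD('n)"
      by (rule arg_cong[where f = "\<lambda>x. x ^ CARD('n)"]) simp
    also have "\<dots> = 14 ^ CARD('n) * N ^ CARD('n)"
      by (rule power_mult_distrib)
    finally have "1 / N ^ CARD('n) * (2 * (7 * N)) ^ CARD('n) = 14 ^ CARD('n)"
      using N by simp
    then show ?thesis
      using N by (subst radmass_indicator) (auto simp: ennreal_mult[symmetric])
  qed
  also have "ennreal local_const * (ennreal a * (ennreal (8 ^ CARD('n)) * radmass TYPE('n) (\<lambda>t. r (max t (N / 4))))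
        + J * ennreal (14 ^ CARD('n)))
      \<le> ennreal local_const * (ennreal a * (ennreal (8 ^ CARD('n)) * ennreal d) + ennreal (2 * d) * ennreal (14 ^ CARD('n)))"
    using N4 L(2) by (intro mult_left_mono add_mono mult_right_mono J L0) auto
  also have "\<dots> = ennreal (local_const * (a * (8 ^ CARD('n) * d) + 2 * d * 14 ^ CARD('n)))"
    using local_const_pos a d by (simp only: ennreal_mult ennreal_plus mult_nonneg_nonneg add_nonneg_nonneg
      less_imp_le zero_le_power zero_le_numeral)
  also have "local_const * (a * (8 ^ CARD('n) * d) + 2 * d * 14 ^ CARD('n)) = e"
  proof -
    have "local_const * (a * (8 ^ CARD('n) * d) + 2 * d * 14 ^ CARD('n))
        = d * (local_const * (a * 8 ^ CARD('n) + 2 * 14 ^ CARD('n)))"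
      by (simp add: algebra_simps)
    also have "\<dots> = e"
      using den unfolding d_def by (intro nonzero_eq_divide_eq[THEN iffD1]) auto
    finally show ?thesis .
  qed
  finally have mass: "radmass TYPE('n) \<rho> \<le> ennreal e" .
  show ?thesis
  proof (rule that[OF N antimono_\<rho> mass])
    fix h :: "real ^ 'n \<Rightarrow> complex" and M U x
    assume h [measurable]: "h \<in> borel_measurable borel" and bound: "\<And>y. cmod (h y) \<le> M"
      and U: "\<And>x x'. infnorm (x - x') \<le> 5 * N \<Longrightarrow> eabs (\<lambda>x. z * h x - kernel_op K h x) x' \<le> U x"
    let ?\<alpha> = "local_norm N (eabs h)"
    have "?\<alpha> x \<le> ennreal local_const * (U x
        + ennreal a * radconv (\<lambda>t. r (max t (2 * N) / 8)) ?\<alpha> x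
        + J * (ennreal (1 / N ^ CARD('n)) * ballint (7 * N) ?\<alpha> x))"
      unfolding J_def a_def using L by (intro local_estimate[OF h bound _ N_def U]) auto
    also have "\<dots> = ennreal local_const * U x + radconv \<rho> ?\<alpha> x"
      unfolding \<rho>_def by (simp add: radconv_add_kernel radconv_cmult_kernel distrib_left add.assoc)
    finally show "?\<alpha> x \<le> ennreal local_const * U x + radconv \<rho> ?\<alpha> x" .
  qed
qed

section \<open>Transfer of stability\<close>

text \<open>Moving the evaluation point by at most \<open>s\<close> shifts the radius by at most
  \<open>s\<close>. The lower truncation at \<eta> keeps the shifted profile away from a possible
  singularity of \<rho> at 0.\<close>

lemma radconv_shift_le:
  fixes x x' :: "real ^ 'n::finite"
  assumes "antimono \<rho>" "infnorm (x - x') \<le> s"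
  shows "radconv (\<lambda>t. \<rho> (max t \<eta>)) \<phi> x' \<le> radconv (\<lambda>t. \<rho> (max (t - s) \<eta>)) \<phi> x"
  unfolding radconv_def
proof (intro nn_integral_mono mult_right_mono antimonoD[OF assms(1)])
  fix y
  show "max (infnorm (x - y) - s) \<eta> \<le> max (infnorm (x' - y)) \<eta>"
    using assms(2) infnorm_triangle_sub[of x y x'] by (intro max.mono) auto
qed simp

context dominated_kernel
begin

definition near_part :: "real \<Rightarrow> 'n kernel" where
  "near_part \<eta> x y = (if infnorm (x - y) < \<eta> then K x y else 0)"

definition far_part :: "real \<Rightarrow> 'n kernel" where
  "far_part \<eta> x y = (if infnorm (x - y) < \<eta> then 0 else K x y)"

lemma dominated_near_part: "dominated_kernel (near_part \<eta>) (\<lambda>t. r t * indicator {..<\<eta>} t)"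
proof
  note [measurable] = measurable_K
  show "(\<lambda>(x, y). near_part \<eta> x y) \<in> borel_measurable (borel \<Otimes>\<^sub>M borel)"
    unfolding near_part_def by measurable
  show "ennreal (cmod (near_part \<eta> x y)) \<le> r (infnorm (x - y)) * indicator {..<\<eta>} (infnorm (x - y))" for x y
    using K_le[of x y] by (simp add: near_part_def)
  show "antimono (\<lambda>t. r t * indicator {..<\<eta>} t)"
    by (intro antimonoI mult_mono antimonoD[OF r_antimono]) (auto simp: indicator_def)
  have "radmass TYPE('n) (\<lambda>t. r t * indicator {..<\<eta>} t) \<le> radmass TYPE('n) r"
    by (intro radmass_mono) (auto simp: indicator_def)
  then show "radmass TYPE('n) (\<lambda>t. r t * indicator {..<\<eta>} t) < top"
    using r_mass by (rule le_less_trans)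
qed

lemma dominated_far_part:
  assumes "0 < \<eta>"
  shows "dominated_kernel (far_part \<eta>) (\<lambda>t. r (max t \<eta>))"
proof
  note [measurable] = measurable_K
  show "(\<lambda>(x, y). far_part \<eta> x y) \<in> borel_measurable (borel \<Otimes>\<^sub>M borel)"
    unfolding far_part_def by measurable
  show "ennreal (cmod (far_part \<eta> x y)) \<le> r (max (infnorm (x - y)) \<eta>)" for x y
    using K_le[of x y] by (auto simp: far_part_def max_def)
qed (use assms in \<open>auto intro: antimono_r_max r_max_mass_finite\<close>)

lemma kernel_op_split:
  assumes [measurable]: "\<phi> \<in> borel_measurable borel" and "\<And>y. cmod (\<phi> y) \<le> M" and \<eta>: "0 < \<eta>"
  shows "kernel_op K \<phi> x = kernel_op (near_part \<eta>) \<phi> x + kernel_op (far_part \<eta>) \<phi> x"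
proof -
  interpret near: dominated_kernel "near_part \<eta>" "\<lambda>t. r t * indicator {..<\<eta>} t"
    by (rule dominated_near_part)
  interpret far: dominated_kernel "far_part \<eta>" "\<lambda>t. r (max t \<eta>)"
    by (rule dominated_far_part[OF \<eta>])
  have "kernel_op K \<phi> x = (LINT y|lborel. near_part \<eta> x y * \<phi> y + far_part \<eta> x y * \<phi> y)"
    unfolding kernel_op_def
    by (intro Bochner_Integration.integral_cong) (auto simp: near_part_def far_part_def)
  also have "\<dots> = kernel_op (near_part \<eta>) \<phi> x + kernel_op (far_part \<eta>) \<phi> x"
    unfolding kernel_op_def using assms
    by (intro Bochner_Integration.integral_add near.integrable_kernel_bounded far.integrable_kernel_bounded) auto
  finally show ?thesis .
qed

end

text \<open>The truncated profile tolerates a shift by the width of a cell, so only cell averages of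
  \<open>H\<close> matter, and \<open>ballint_le_local_norm\<close> bounds these. This recovers the
  far operator applied to \<open>h\<close> from its local norms.\<close>

lemma (in muckenhoupt) radconv_far_le_local_norm:
  assumes \<rho>: "antimono \<rho>" and [measurable]: "H \<in> borel_measurable borel" and N: "0 < N"
  shows "radconv (\<lambda>t. \<rho> (max t \<eta>)) H x
    \<le> ennreal (A powr (1 / p)) * radconv (\<lambda>t. \<rho> (max (t - N) \<eta>)) (local_norm N H) x"
proof -
  have [measurable]: "\<rho> \<in> borel_measurable borel"
    by (rule measurable_antimono[OF \<rho>])
  have "radconv (\<lambda>t. \<rho> (max t \<eta>)) H x = (\<integral>\<^sup>+y. \<rho> (max (infnorm (x - y)) \<eta>) * H y \<partial>lborel)"
    by (simp add: radconv_def)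
  also have "\<dots> \<le> ennreal (1 / N ^ CARD('n))
      * (\<integral>\<^sup>+y. \<rho> (max (infnorm (x - y) - N) \<eta>) * ballint (N / 2) H (cell_center N y) \<partial>lborel)"
  proof (rule nn_integral_le_cell_averages[OF _ _ _ N])
    fix y y' :: "real ^ 'n" assume y: "infnorm (y - y') \<le> N"
    have "infnorm (x - y') - N \<le> infnorm (x - y)"
      using y infnorm_triangle_sub[of x y' y] by linarith
    then show "\<rho> (max (infnorm (x - y)) \<eta>) \<le> \<rho> (max (infnorm (x - y') - N) \<eta>)"
      by (intro antimonoD[OF \<rho>] max.mono) auto
  qed measurable
  also have "\<dots> \<le> ennreal (1 / N ^ CARD('n)) * (\<integral>\<^sup>+y. \<rho> (max (infnorm (x - y) - N) \<eta>)
      * (ennreal (A powr (1 / p) * N ^ CARD('n)) * local_norm N H y) \<partial>lborel)"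
    using N by (intro mult_left_mono nn_integral_mono ballint_le_local_norm) auto
  also have "\<dots> = ennreal (1 / N ^ CARD('n)) * (ennreal (A powr (1 / p) * N ^ CARD('n))
      * radconv (\<lambda>t. \<rho> (max (t - N) \<eta>)) (local_norm N H) x)"
    by (subst radconv_cmult[symmetric]) (auto simp: radconv_def)
  also have "\<dots> = ennreal (A powr (1 / p)) * radconv (\<lambda>t. \<rho> (max (t - N) \<eta>)) (local_norm N H) x"
    using N by (simp add: mult.assoc[symmetric] ennreal_mult[symmetric])
  finally show ?thesis .
qed

text \<open>The constant depends neither on \<open>f\<close> nor on its bound. Boundedness makes the
  kernel integrals converge and starts the iteration of \<open>wint_absorb\<close>, which is run
  three times: for \<open>G\<close>, for the local norms of \<open>h\<close>, and for
  \<open>h\<close>.\<close>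

theorem (in stable_kernel) bounded_transfer:
  assumes "muckenhoupt q v B" and z: "z \<noteq> 0"
  obtains C where "C < top"
    and "\<And>f M. \<lbrakk>f \<in> borel_measurable borel; \<And>x. cmod (f x) \<le> M\<rbrakk> \<Longrightarrow>
      wint q v (eabs f) \<le> C * wint q v (eabs (\<lambda>x. z * f x - kernel_op K f x))"
proof -
  interpret V: muckenhoupt q v B
    by fact
  define i where "i = 1 / cmod z"
  have i: "0 < i"
    using z by (simp add: i_def)
  obtain e where e: "0 < e"
    and half: "\<And>\<rho>. radmass TYPE('n) \<rho> \<le> ennreal e \<Longrightarrow> radmass TYPE('n) \<rho> \<le> 1 / 2"
      "\<And>\<rho>. radmass TYPE('n) \<rho> \<le> ennreal e \<Longrightarrow>
        ennreal (2 powr q * V.conv_const) * epowr (radmass TYPE('n) \<rho>) q \<le> 1 / 2"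
    using V.absorption_threshold by blast
  have absorb: "wint q v \<alpha> \<le> ennreal (2 * 2 powr q) * wint q v \<beta>"
    if "\<alpha> \<in> borel_measurable borel" "\<beta> \<in> borel_measurable borel" "antimono \<rho>" "\<And>x. \<alpha> x \<le> ennreal M"
      "\<And>x. \<alpha> x \<le> \<beta> x + radconv \<rho> \<alpha> x" "radmass TYPE('n) \<rho> \<le> ennreal e" for \<alpha> \<beta> \<rho> M
    using that by (intro V.wint_absorb[of _ _ \<rho>]) (auto intro!: half)
  \<comment> \<open>Two demands on the near mass: at most |z| / 2 for the Neumann series, and at
    most e |z| so that after division by |z| it falls below the absorption threshold.\<close>
  have "0 < min (e * cmod z) (cmod z / 2)"
    using e z by simp
  then obtain \<eta> where \<eta>: "0 < \<eta>"
    and near_mass: "radmass TYPE('n) (\<lambda>t. r t * indicator {..<\<eta>} t) \<le> ennreal (min (e * cmod z) (cmod z / 2))"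
    using near_mass_small by blast
  define r1 where "r1 = (\<lambda>t. r t * indicator {..<\<eta>} t)"
  interpret near: dominated_kernel "near_part \<eta>" r1
    unfolding r1_def by (rule dominated_near_part)
  interpret far: dominated_kernel "far_part \<eta>" "\<lambda>t. r (max t \<eta>)"
    by (rule dominated_far_part[OF \<eta>])
  define \<sigma> where "\<sigma> t = ennreal i * r1 t" for t
  have \<sigma>: "antimono \<sigma>"
    unfolding \<sigma>_def by (intro antimonoI mult_left_mono antimonoD[OF near.r_antimono]) auto
  have radconv_\<sigma>: "radconv \<sigma> \<phi> x = ennreal i * radconv r1 \<phi> x"
    if "\<phi> \<in> borel_measurable borel" for \<phi> and x :: "real ^ 'n"
    unfolding \<sigma>_def using that by (intro radconv_cmult_kernel) auto
  have \<sigma>_mass: "radmass TYPE('n) \<sigma> \<le> ennreal e"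
  proof -
    have "radmass TYPE('n) \<sigma> = ennreal i * radmass TYPE('n) r1"
      unfolding \<sigma>_def by (intro radmass_cmult) auto
    also have "\<dots> \<le> ennreal i * ennreal (e * cmod z)"
      unfolding r1_def by (intro mult_left_mono order_trans[OF near_mass] ennreal_leI) auto
    also have "\<dots> = ennreal e"
      using z e by (simp add: i_def ennreal_mult[symmetric])
    finally show ?thesis .
  qed
  obtain N \<rho> where N: "1 \<le> N" and \<rho>: "antimono \<rho>" "radmass TYPE('n) \<rho> \<le> ennreal e"
    and local: "\<And>h M U x. \<lbrakk>h \<in> borel_measurable borel; \<And>y. cmod (h y) \<le> M;
        \<And>x x'. infnorm (x - x') \<le> 5 * N \<Longrightarrow> eabs (\<lambda>x. z * h x - kernel_op K h x) x' \<le> U x\<rbrakk>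
      \<Longrightarrow> local_norm N (eabs h) x \<le> ennreal local_const * U x + radconv \<rho> (local_norm N (eabs h)) x"
    using exists_local_estimate[OF e] by blast
  define \<tau> where "\<tau> s t = r (max (t - s) \<eta>)" for s t :: real
  have \<tau>: "antimono (\<tau> s)" for s
    unfolding \<tau>_def by (rule antimono_shifted)
  note [measurable] = measurable_antimono[OF \<tau>] measurable_antimono[OF \<sigma>] measurable_antimono[OF \<rho>(1)]
  have \<tau>_mass: "radmass TYPE('n) (\<tau> s) < top" if "0 \<le> s" for s
    unfolding \<tau>_def using \<eta> that by (rule shifted_mass_finite)
  define c where "c s = ennreal V.conv_const * epowr (radmass TYPE('n) (\<tau> s)) q" for s
  have c_fin: "c s < top" if "0 \<le> s" for s
    using \<tau>_mass[OF that] by (simp add: c_def ennreal_mult_less_top)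
  have wint_\<tau>: "wint q v (radconv (\<tau> s) \<phi>) \<le> c s * wint q v \<phi>"
    if "0 \<le> s" "\<phi> \<in> borel_measurable borel" for s \<phi>
    unfolding c_def using that by (intro V.wint_radconv \<tau> \<tau>_mass)
  \<comment> \<open>\<open>C1\<close> to \<open>C5\<close> bound, in this order, the norms of
    \<open>G\<close>, of the local bound \<open>U\<close>, of the local norms \<alpha>, of the
    convolution \<open>P\<close> of \<alpha>, and of \<open>h\<close>.\<close>
  let ?k = "ennreal (2 * 2 powr q)" and ?i = "epowr (ennreal i) q" and ?a = "ennreal (A powr (1 / p))"
  define C1 where "C1 = ?k * ?i"
  define C2 where "C2 = c (5 * N) * C1"
  define C3 where "C3 = ?k * epowr (ennreal local_const) q * C2"
  define C4 where "C4 = c N * C3"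
  define C5 where "C5 = ?k * ?i * (ennreal (2 powr q) * (C2 + epowr ?a q * C4))"
  define C where "C = ennreal (2 powr q) * (C1 + C5)"
  show ?thesis
  proof (rule that[of C])
    show "C < top"
      using c_fin N by (simp add: C_def C5_def C4_def C3_def C2_def C1_def ennreal_mult_less_top)
    fix f :: "real ^ 'n \<Rightarrow> complex" and M
    assume f [measurable]: "f \<in> borel_measurable borel" and f_bound: "\<And>x. cmod (f x) \<le> M"
    have M: "0 \<le> M"
      using f_bound[of 0] norm_ge_zero[of "f 0"] by linarith
    define g where "g x = z * f x - kernel_op K f x" for x
    have [measurable]: "g \<in> borel_measurable borel"
      unfolding g_def by measurable
    have g_bound: "cmod (g x) \<le> cmod z * M + enn2real (radmass TYPE('n) r) * M" for x
    proof -
      have "cmod (g x) \<le> cmod (z * f x) + cmod (kernel_op K f x)"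
        unfolding g_def by (rule norm_triangle_ineq4)
      also have "\<dots> \<le> cmod z * M + enn2real (radmass TYPE('n) r) * M"
        unfolding norm_mult by (intro add_mono mult_left_mono f_bound kernel_op_bounded M) auto
      finally show ?thesis .
    qed
    have small: "radmass TYPE('n) r1 \<le> ennreal (cmod z / 2)"
      unfolding r1_def by (intro order_trans[OF near_mass] ennreal_leI) simp
    obtain G M' where [measurable]: "G \<in> borel_measurable borel" and G_bound: "\<And>x. cmod (G x) \<le> M'"
      and G: "\<And>x. z * G x = g x + kernel_op (near_part \<eta>) G x"
      by (rule near.bounded_resolvent[of g, OF _ g_bound z small]) auto
    let ?W = "wint q v (eabs g)"
    have scale: "ennreal (cmod y) \<le> ennreal i * X" if "ennreal (cmod (z * y)) \<le> X" for y X
    proof -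
      have "ennreal (cmod y) = ennreal i * ennreal (cmod (z * y))"
        using z by (simp add: i_def norm_mult ennreal_mult[symmetric])
      then show ?thesis
        using that by (simp add: mult_left_mono)
    qed
    have wint_G: "wint q v (eabs G) \<le> C1 * ?W"
    proof -
      have "eabs G x \<le> ennreal i * eabs g x + radconv \<sigma> (eabs G) x" for x
      proof -
        have "ennreal (cmod (z * G x)) \<le> eabs g x + ennreal (cmod (kernel_op (near_part \<eta>) G x))"
          unfolding G by (simp add: norm_triangle_ineq ennreal_leI flip: ennreal_plus)
        also have "\<dots> \<le> eabs g x + radconv r1 (eabs G) x"
          by (intro add_left_mono near.norm_kernel_op_le)
        finally have "ennreal (cmod (z * G x)) \<le> eabs g x + radconv r1 (eabs G) x" .
        from scale[OF this] show ?thesis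
          by (simp add: radconv_\<sigma> distrib_left)
      qed
      then have "wint q v (eabs G) \<le> ?k * wint q v (\<lambda>x. ennreal i * eabs g x)"
        using G_bound by (intro absorb[where \<rho> = \<sigma> and M = M'] \<sigma> \<sigma>_mass ennreal_leI) auto
      then show ?thesis
        by (simp add: wint_cmult C1_def mult.assoc)
    qed
    define h where "h x = f x - G x" for x
    have [measurable]: "h \<in> borel_measurable borel"
      unfolding h_def by measurable
    have h_bound: "cmod (h x) \<le> M + M'" for x
      unfolding h_def using norm_triangle_ineq4[of "f x" "G x"] f_bound[of x] G_bound[of x] by linarith
    \<comment> \<open>The equation for \<open>G\<close> cancels \<open>g\<close> and the near part:
      (z - T) h = g - (z G - T G), and z G - T G is \<open>g\<close> minus the far part applied to
      \<open>G\<close>.\<close>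
    have h_eq: "z * h x - kernel_op K h x = kernel_op (far_part \<eta>) G x" for x
    proof -
      have "kernel_op K h x = kernel_op K f x - kernel_op K G x"
        unfolding h_def
      proof (rule kernel_op_diff)
        show "radconv r (eabs f) x < top"
          by (rule le_less_trans[OF radconv_bounded[of f M x, OF f_bound]]) (use r_mass in \<open>simp add: ennreal_mult_less_top\<close>)
        show "radconv r (eabs G) x < top"
          by (rule le_less_trans[OF radconv_bounded[of G M' x, OF G_bound]]) (use r_mass in \<open>simp add: ennreal_mult_less_top\<close>)
      qed auto
      moreover have "kernel_op K G x = kernel_op (near_part \<eta>) G x + kernel_op (far_part \<eta>) G x"
        by (rule kernel_op_split[OF _ G_bound \<eta>]) simp
      moreover have "z * h x = z * f x - z * G x"
        by (simp add: h_def right_diff_distrib)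
      ultimately show ?thesis
        unfolding G by (simp add: g_def)
    qed
    define U where "U = radconv (\<tau> (5 * N)) (eabs G)"
    have [measurable]: "U \<in> borel_measurable borel"
      unfolding U_def by measurable
    have U: "eabs (\<lambda>x. z * h x - kernel_op K h x) x' \<le> U x" if "infnorm (x - x') \<le> 5 * N" for x x'
    proof -
      have "eabs (\<lambda>x. z * h x - kernel_op K h x) x' \<le> radconv (\<lambda>t. r (max t \<eta>)) (eabs G) x'"
        unfolding h_eq by (rule far.norm_kernel_op_le)
      also have "\<dots> \<le> U x"
        unfolding U_def \<tau>_def by (rule radconv_shift_le[OF r_antimono that])
      finally show ?thesis .
    qed
    have wint_U: "wint q v U \<le> C2 * ?W"
    proof -
      have "wint q v U \<le> c (5 * N) * wint q v (eabs G)"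
        unfolding U_def using N by (intro wint_\<tau>) auto
      also have "\<dots> \<le> c (5 * N) * (C1 * ?W)"
        by (intro mult_left_mono wint_G) auto
      finally show ?thesis
        by (simp add: C2_def mult.assoc)
    qed
    define \<alpha> where "\<alpha> = local_norm N (eabs h)"
    have [measurable]: "\<alpha> \<in> borel_measurable borel"
      unfolding \<alpha>_def by measurable
    have wint_\<alpha>: "wint q v \<alpha> \<le> C3 * ?W"
    proof -
      have "wint q v \<alpha> \<le> ?k * wint q v (\<lambda>x. ennreal local_const * U x)"
      proof (rule absorb[where \<rho> = \<rho> and M = "M + M'"])
        show "\<alpha> x \<le> ennreal (M + M')" for x
          unfolding \<alpha>_def using N h_bound by (intro local_norm_le ennreal_leI) auto
        show "\<alpha> x \<le> ennreal local_const * U x + radconv \<rho> \<alpha> x" for x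
          unfolding \<alpha>_def by (rule local[OF _ h_bound U]) auto
      qed (use \<rho> in auto)
      also have "\<dots> \<le> ?k * (epowr (ennreal local_const) q * (C2 * ?W))"
        using wint_U by (intro mult_left_mono) (auto simp: wint_cmult mult_left_mono)
      finally show ?thesis
        by (simp add: C3_def mult.assoc)
    qed
    define P where "P = radconv (\<tau> N) \<alpha>"
    have [measurable]: "P \<in> borel_measurable borel"
      unfolding P_def by measurable
    have wint_P: "wint q v P \<le> C4 * ?W"
    proof -
      have "wint q v P \<le> c N * wint q v \<alpha>"
        unfolding P_def using N by (intro wint_\<tau>) auto
      also have "\<dots> \<le> c N * (C3 * ?W)"
        by (intro mult_left_mono wint_\<alpha>) auto
      finally show ?thesis
        by (simp add: C4_def mult.assoc)
    qed
    have wint_h: "wint q v (eabs h) \<le> C5 * ?W"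
    proof -
      have "eabs h x \<le> ennreal i * (U x + ?a * P x) + radconv \<sigma> (eabs h) x" for x
      proof -
        have "kernel_op K h x = kernel_op (near_part \<eta>) h x + kernel_op (far_part \<eta>) h x"
          by (rule kernel_op_split[OF _ h_bound \<eta>]) simp
        \<comment> \<open>Only the near term contains \<open>h\<close> itself and is absorbed; the
          other two are bounded by \<open>U\<close> and by local norms of \<open>h\<close>.\<close>
        then have "z * h x = (z * h x - kernel_op K h x) + kernel_op (far_part \<eta>) h x + kernel_op (near_part \<eta>) h x"
          by simp
        then have "cmod (z * h x) \<le> cmod (z * h x - kernel_op K h x) + cmod (kernel_op (far_part \<eta>) h x)
            + cmod (kernel_op (near_part \<eta>) h x)"
          by (metis norm_triangle_ineq norm_triangle_mono order_refl)
        then have "ennreal (cmod (z * h x)) \<le> ennreal (cmod (z * h x - kernel_op K h x))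
            + ennreal (cmod (kernel_op (far_part \<eta>) h x)) + ennreal (cmod (kernel_op (near_part \<eta>) h x))"
          by (simp add: ennreal_leI flip: ennreal_plus)
        also have "\<dots> \<le> U x + ?a * P x + radconv r1 (eabs h) x"
        proof (intro add_mono)
          show "ennreal (cmod (z * h x - kernel_op K h x)) \<le> U x"
            using U[of x x] N by (simp add: infnorm_0)
          have "ennreal (cmod (kernel_op (far_part \<eta>) h x)) \<le> radconv (\<lambda>t. r (max t \<eta>)) (eabs h) x"
            by (rule far.norm_kernel_op_le)
          also have "\<dots> \<le> ?a * P x"
            unfolding P_def \<alpha>_def \<tau>_def using N by (intro radconv_far_le_local_norm r_antimono) auto
          finally show "ennreal (cmod (kernel_op (far_part \<eta>) h x)) \<le> ?a * P x" .
        qed (rule near.norm_kernel_op_le)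
        finally have "ennreal (cmod (z * h x)) \<le> U x + ?a * P x + radconv r1 (eabs h) x" .
        from scale[OF this] show ?thesis
          by (simp add: radconv_\<sigma> distrib_left)
      qed
      then have "wint q v (eabs h) \<le> ?k * wint q v (\<lambda>x. ennreal i * (U x + ?a * P x))"
        using h_bound by (intro absorb[where \<rho> = \<sigma> and M = "M + M'"] \<sigma> \<sigma>_mass ennreal_leI) auto
      also have "wint q v (\<lambda>x. ennreal i * (U x + ?a * P x)) = ?i * wint q v (\<lambda>x. U x + ?a * P x)"
        by (rule wint_cmult) auto
      also have "wint q v (\<lambda>x. U x + ?a * P x) \<le> ennreal (2 powr q) * (wint q v U + wint q v (\<lambda>x. ?a * P x))"
        by (rule wint_add_le) auto
      also have "wint q v (\<lambda>x. ?a * P x) = epowr ?a q * wint q v P"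
        by (rule wint_cmult) auto
      also have "ennreal (2 powr q) * (wint q v U + epowr ?a q * wint q v P)
          \<le> ennreal (2 powr q) * (C2 * ?W + epowr ?a q * (C4 * ?W))"
        by (intro mult_left_mono add_mono wint_U wint_P) auto
      finally show ?thesis
        by (simp add: C5_def distrib_right mult.assoc mult_left_mono)
    qed
    have "eabs f x \<le> eabs G x + eabs h x" for x
      unfolding h_def using norm_triangle_ineq[of "G x" "f x - G x"] by (simp add: ennreal_leI flip: ennreal_plus)
    then have "wint q v (eabs f) \<le> wint q v (\<lambda>x. eabs G x + eabs h x)"
      by (intro wint_mono) auto
    also have "\<dots> \<le> ennreal (2 powr q) * (wint q v (eabs G) + wint q v (eabs h))"
      by (rule wint_add_le) auto
    also have "\<dots> \<le> ennreal (2 powr q) * (C1 * ?W + C5 * ?W)"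
      by (intro mult_left_mono add_mono wint_G wint_h) auto
    finally show "wint q v (eabs f) \<le> C * wint q v (eabs (\<lambda>x. z * f x - kernel_op K f x))"
      by (simp add: C_def g_def[abs_def] distrib_right mult.assoc)
  qed
qed

section \<open>From bounded functions to the whole weighted space\<close>

lemma wint_zero_imp_AE:
  assumes [measurable]: "\<phi> \<in> borel_measurable borel" "v \<in> borel_measurable borel"
    and "\<And>x. 0 < v x" and "wint q v \<phi> < top"
  shows "AE x in lborel. \<phi> x < top"
proof -
  have "AE x in lborel. epowr (\<phi> x) q * v x \<noteq> \<infinity>"
    using assms(4) unfolding wint_def by (intro nn_integral_noteq_infinite) auto
  then show ?thesis
  proof eventually_elim
    case (elim x)
    have "v x \<noteq> 0"
      using assms(3)[of x] by simp
    then show ?case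
      using elim by (auto simp: ennreal_mult_eq_top_iff less_top[symmetric])
  qed
qed

text \<open>Truncate in height: \<open>a k\<close> is bounded, and the remainder \<open>b k\<close>
  tends to 0 in the weighted space by dominated convergence. Boundedness of the operator then makes
  its effect on \<open>b k\<close> disappear in the limit.\<close>

theorem (in stable_kernel) transfer:
  assumes "muckenhoupt q v B" and z: "z \<noteq> 0" and v_pos: "\<And>x. 0 < v x"
  obtains C where "C < top"
    and "\<And>f. \<lbrakk>f \<in> borel_measurable borel; wint q v (eabs f) < top\<rbrakk> \<Longrightarrow>
      wint q v (eabs f) \<le> C * wint q v (eabs (\<lambda>x. z * f x - kernel_op K f x))"
proof -
  interpret V: muckenhoupt q v B
    by fact
  obtain C where C: "C < top" and bounded: "\<And>f M. \<lbrakk>f \<in> borel_measurable borel; \<And>x. cmod (f x) \<le> M\<rbrakk> \<Longrightarrow>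
      wint q v (eabs f) \<le> C * wint q v (eabs (\<lambda>x. z * f x - kernel_op K f x))"
    using bounded_transfer[OF assms(1) z] by blast
  let ?k = "ennreal (2 powr q)"
  define c where "c = ennreal V.conv_const * epowr (radmass TYPE('n) r) q"
  have c: "c < top"
    using r_mass by (simp add: c_def ennreal_mult_less_top)
  define D where "D = ?k * (epowr (ennreal (cmod z)) q + c)"
  have D: "D < top"
    using c by (simp add: D_def ennreal_mult_less_top)
  let ?V = "wint q v"
  show ?thesis
  proof (rule that[of "?k * C * ?k"])
    show "?k * C * ?k < top"
      using C by (simp add: ennreal_mult_less_top)
    fix f :: "real ^ 'n \<Rightarrow> complex"
    assume f [measurable]: "f \<in> borel_measurable borel" and fin: "?V (eabs f) < top"
    define g where "g x = z * f x - kernel_op K f x" for x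
    have [measurable]: "g \<in> borel_measurable borel"
      unfolding g_def by measurable
    define a where "a k x = (if cmod (f x) \<le> real k then f x else 0)" for k x
    define b where "b k x = (if cmod (f x) \<le> real k then 0 else f x)" for k x
    let ?Sb = "\<lambda>k x. z * b k x - kernel_op K (b k) x"
    have [measurable]: "a k \<in> borel_measurable borel" "b k \<in> borel_measurable borel" for k
      unfolding a_def b_def by measurable
    have "?V (radconv r (eabs f)) \<le> c * ?V (eabs f)"
      unfolding c_def by (intro V.wint_radconv r_antimono r_mass) auto
    also have "\<dots> < top"
      using c fin by (simp add: ennreal_mult_less_top)
    \<comment> \<open>Finiteness of the majorant at almost every point makes both kernel integrals
      converge there, so the operator may be split along f = a_k + b_k.\<close>
    finally have conv_fin: "AE x in lborel. radconv r (eabs f) x < top"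
      using v_pos by (intro wint_zero_imp_AE[where q = q and v = v]) auto
    have wint_b: "?V (eabs (?Sb k)) \<le> D * ?V (eabs (b k))" for k
    proof -
      have "eabs (?Sb k) x \<le> ennreal (cmod z) * eabs (b k) x + radconv r (eabs (b k)) x" for x
      proof -
        have "eabs (?Sb k) x \<le> ennreal (cmod (z * b k x)) + eabs (kernel_op K (b k)) x"
          using norm_triangle_ineq4[of "z * b k x" "kernel_op K (b k) x"] by (simp add: ennreal_leI flip: ennreal_plus)
        also have "\<dots> \<le> ennreal (cmod z) * eabs (b k) x + radconv r (eabs (b k)) x"
          by (intro add_mono norm_kernel_op_le) (simp add: norm_mult ennreal_mult)
        finally show ?thesis .
      qed
      then have "?V (eabs (?Sb k))
          \<le> ?V (\<lambda>x. ennreal (cmod z) * eabs (b k) x + radconv r (eabs (b k)) x)"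
        by (intro wint_mono) auto
      also have "\<dots> \<le> ?k * (?V (\<lambda>x. ennreal (cmod z) * eabs (b k) x) + ?V (radconv r (eabs (b k))))"
        by (intro wint_add_le) auto
      also have "\<dots> \<le> ?k * (epowr (ennreal (cmod z)) q * ?V (eabs (b k)) + c * ?V (eabs (b k)))"
        unfolding c_def by (intro mult_left_mono add_mono V.wint_radconv r_antimono r_mass) (auto simp: wint_cmult)
      finally show ?thesis
        by (simp add: D_def distrib_left distrib_right mult.assoc)
    qed
    have wint_a: "?V (eabs (a k)) \<le> C * (?k * (?V (eabs g) + D * ?V (eabs (b k))))" for k
    proof -
      have "cmod (a k x) \<le> real k" for x
        by (simp add: a_def)
      then have "?V (eabs (a k)) \<le> C * ?V (eabs (\<lambda>x. z * a k x - kernel_op K (a k) x))"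
        by (intro bounded) auto
      also have "?V (eabs (\<lambda>x. z * a k x - kernel_op K (a k) x))
          \<le> ?V (\<lambda>x. eabs g x + eabs (?Sb k) x)"
      proof (intro wint_mono_AE)
        show "AE x in lborel. eabs (\<lambda>x. z * a k x - kernel_op K (a k) x) x
            \<le> eabs g x + eabs (?Sb k) x"
          using conv_fin
        proof eventually_elim
          case (elim x)
          have "radconv r (eabs (b k)) x \<le> radconv r (eabs f) x"
            by (intro radconv_mono) (simp add: b_def)
          then have "radconv r (eabs (b k)) x < top"
            using elim by (rule le_less_trans)
          then have "kernel_op K (\<lambda>y. f y - b k y) x = kernel_op K f x - kernel_op K (b k) x"
            using elim by (intro kernel_op_diff) auto
          moreover have "(\<lambda>y. f y - b k y) = a k"
            by (auto simp: a_def b_def)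
          moreover have "z * a k x = z * f x - z * b k x"
            by (simp add: a_def b_def)
          ultimately have "z * a k x - kernel_op K (a k) x = g x - (z * b k x - kernel_op K (b k) x)"
            by (simp add: g_def algebra_simps)
          then show ?case
            using norm_triangle_ineq4[of "g x" "z * b k x - kernel_op K (b k) x"]
            by (simp add: ennreal_leI flip: ennreal_plus)
        qed
      qed simp
      also have "\<dots> \<le> ?k * (?V (eabs g) + ?V (eabs (?Sb k)))"
        by (intro wint_add_le) auto
      also have "\<dots> \<le> ?k * (?V (eabs g) + D * ?V (eabs (b k)))"
        by (intro mult_left_mono add_left_mono wint_b) auto
      finally show ?thesis
        by (simp add: mult_left_mono)
    qed
    have b_lim: "(\<lambda>k. ?V (eabs (b k))) \<longlonglongrightarrow> 0"
    proof -
      have "(\<lambda>k. ?V (eabs (b k))) \<longlonglongrightarrow> (\<integral>\<^sup>+x. (\<lambda>_ :: real ^ 'n. 0) x \<partial>lborel)"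
        unfolding wint_def
      proof (rule nn_integral_dominated_convergence[where w = "\<lambda>x. epowr (eabs f x) q * v x"])
        show "(\<integral>\<^sup>+x. epowr (eabs f x) q * v x \<partial>lborel) < \<infinity>"
          using fin by (simp add: wint_def)
        show "AE x in lborel. epowr (eabs (b k) x) q * v x \<le> epowr (eabs f x) q * v x" for k
          by (intro AE_I2 mult_right_mono epowr_mono) (auto simp: b_def)
        show "AE x in lborel. (\<lambda>k. epowr (eabs (b k) x) q * v x) \<longlonglongrightarrow> 0"
        proof (rule AE_I2)
          fix x
          obtain k0 :: nat where "cmod (f x) \<le> real k0"
            using real_arch_simple by blast
          then have "\<forall>\<^sub>F k in sequentially. epowr (eabs (b k) x) q * v x = 0"
            by (auto simp: eventually_sequentially b_def intro!: exI[of _ k0])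
          then show "(\<lambda>k. epowr (eabs (b k) x) q * v x) \<longlonglongrightarrow> 0"
            by (rule tendsto_eventually)
        qed
      qed auto
      then show ?thesis by simp
    qed
    have "?V (eabs f) \<le> ?k * (C * (?k * (?V (eabs g) + D * ?V (eabs (b k)))) + ?V (eabs (b k)))" for k
    proof -
      have "?V (eabs f) \<le> ?V (\<lambda>x. eabs (a k) x + eabs (b k) x)"
        by (intro wint_mono) (auto simp: a_def b_def)
      also have "\<dots> \<le> ?k * (?V (eabs (a k)) + ?V (eabs (b k)))"
        by (intro wint_add_le) auto
      also have "\<dots> \<le> ?k * (C * (?k * (?V (eabs g) + D * ?V (eabs (b k)))) + ?V (eabs (b k)))"
        by (intro mult_left_mono add_right_mono wint_a) auto
      finally show ?thesis .
    qed
    moreover have "(\<lambda>k. ?k * (C * (?k * (?V (eabs g) + D * ?V (eabs (b k)))) + ?V (eabs (b k))))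
        \<longlonglongrightarrow> ?k * (C * (?k * (?V (eabs g) + D * 0)) + 0)"
      using C D by (intro tendsto_add tendsto_const b_lim ennreal_tendsto_cmult) (auto simp: less_top[symmetric])
    ultimately have "?V (eabs f) \<le> ?k * (C * (?k * (?V (eabs g) + D * 0)) + 0)"
      by (intro LIMSEQ_le_const) auto
    then show "?V (eabs f) \<le> ?k * C * ?k * ?V (eabs (\<lambda>x. z * f x - kernel_op K f x))"
      by (simp add: g_def[abs_def] mult.assoc)
  qed
qed

section \<open>The A_p condition as an averaging inequality\<close>

lemma average_infnorm_cball:
  fixes w w' :: "real ^ 'n::finite \<Rightarrow> real"
  assumes [measurable]: "w' \<in> borel_measurable borel" and "AE x in lborel. w x = w' x" and t: "0 < t"
  shows "average {y. infnorm (y - x) \<le> t} w = ballint t (\<lambda>x. ennreal (w' x)) x / ennreal ((2 * t) ^ CARD('n))"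
proof -
  have eq: "{y. infnorm (y - x) \<le> t} = {y. infnorm (x - y) \<le> t}"
    by (simp add: infnorm_sub)
  have "{y. infnorm (x - y) \<le> t} \<in> sets borel"
    by measurable
  then have "emeasure lebesgue {y. infnorm (x - y) \<le> t} = ennreal ((2 * t) ^ CARD('n))"
    using t by (simp add: emeasure_infnorm_cball)
  moreover have "(\<integral>\<^sup>+y\<in>{y. infnorm (x - y) \<le> t}. ennreal (w y) \<partial>lebesgue) = ballint t (\<lambda>x. ennreal (w' x)) x"
    unfolding nn_integral_completion radconv_def using assms(2)
    by (intro nn_integral_cong_AE) (auto elim!: eventually_mono simp: indicator_def)
  ultimately show ?thesis
    unfolding average_def eq by simp
qed

text \<open>For \<open>p = 1\<close>, the weight of a ball is at most A times its volume times w(y)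
  for each y in it; multiply by \<phi>(y) and integrate. For \<open>p > 1\<close>, with \<sigma> =
  w^(-1/(p-1)), apply Jensen's inequality to \<phi> / \<sigma> under the measure \<sigma> dy on the
  ball; since \<sigma>^(1-p) = w, this is Hoelder's inequality in the form \<sigma> (\<phi> /
  \<sigma>)^p = \<phi>^p w.\<close>

lemma Ap_weight_imp_muckenhoupt:
  fixes w w' :: "real ^ 'n::finite \<Rightarrow> real"
  assumes w: "Ap_weight p w" and p: "1 \<le> p"
    and w' [measurable]: "w' \<in> borel_measurable borel" and ae: "AE x in lborel. w x = w' x" and pos: "\<And>x. 0 < w' x"
  obtains A where "muckenhoupt p (\<lambda>x. ennreal (w' x)) A"
proof -
  let ?w = "\<lambda>x. ennreal (w' x)"
  have weight: "weight w"
    using w by (simp add: Ap_weight_def)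
  have fin: "ballint t ?w x < top" for t and x :: "real ^ 'n"
  proof -
    let ?B = "{y. infnorm (x - y) \<le> t}"
    have "compact ?B"
      unfolding infnorm_cball_eq_cbox by (rule compact_cbox)
    then have "w absolutely_integrable_on ?B"
      using weight by (simp add: weight_def)
    then have "(\<integral>\<^sup>+y. ennreal (norm (indicator ?B y *\<^sub>R w y)) \<partial>lebesgue) < \<infinity>"
      unfolding set_integrable_def by (simp add: integrable_iff_bounded)
    also have "(\<integral>\<^sup>+y. ennreal (norm (indicator ?B y *\<^sub>R w y)) \<partial>lebesgue) = ballint t ?w x"
      unfolding nn_integral_completion radconv_def using ae pos
      by (intro nn_integral_cong_AE) (auto elim!: eventually_mono simp: indicator_def less_imp_le)
    finally show ?thesis by simp
  qed
  have ball_pos: "0 < ballint t (\<lambda>x. ennreal (u x)) x"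
    if "0 < t" "\<And>x. 0 < u x" "u \<in> borel_measurable borel" for t and u :: "real ^ 'n \<Rightarrow> real" and x
  proof (rule ccontr)
    note [measurable] = that(3)
    assume "\<not> ?thesis"
    then have "AE y in lborel. indicator {..t} (infnorm (x - y)) * ennreal (u y) = 0"
      unfolding radconv_def by (subst (asm) not_gr_zero, subst (asm) nn_integral_0_iff_AE) auto
    then have "AE y in lborel. y \<notin> {y. infnorm (x - y) \<le> t}"
    proof eventually_elim
      case (elim y)
      then show ?case
        using that(2)[of y] by (auto simp: indicator_def)
    qed
    then have "emeasure lborel {y. infnorm (x - y) \<le> t} = 0"
      by (subst (asm) AE_iff_measurable[OF _ refl]) auto
    then show False
      using emeasure_infnorm_cball[of t x] that(1) by simp
  qed
  have cube: "{y. infnorm (y - x) \<le> t} \<in> cubes" if "0 < t" for t and x :: "real ^ 'n"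
    using that unfolding cubes_def by blast
  have times: "X \<le> ennreal a * V" if "X / V \<le> ennreal a" "0 < V" "V < top" for X V :: ennreal and a
  proof -
    have "X = X / V * V"
      using that by (simp add: ennreal_divide_times ennreal_times_divide[symmetric])
    also have "\<dots> \<le> ennreal a * V"
      using that by (intro mult_right_mono) auto
    finally show ?thesis .
  qed
  show ?thesis
  proof (cases "p = 1")
    case True
    then obtain A0 where A0: "\<And>Q. Q \<in> cubes \<Longrightarrow> average Q w \<le> ennreal A0 * ennreal (INF x\<in>Q. w x)"
      using w by (auto simp: Ap_weight_def)
    \<comment> \<open>The constant supplied by the definition may be zero or negative, while the
      locale asks for a positive one.\<close>
    define A where "A = max A0 1"
    have le: "ballint t ?w x \<le> ennreal (A * (2 * t) ^ CARD('n)) * ennreal (w y)"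
      if t: "0 < t" and y: "infnorm (x - y) \<le> t" for t and x y :: "real ^ 'n"
    proof -
      have "(INF x\<in>{y. infnorm (y - x) \<le> t}. w x) \<le> w y"
        using weight y by (intro cINF_lower bdd_belowI[of _ 0]) (auto simp: weight_def infnorm_sub less_imp_le)
      then have "ballint t ?w x / ennreal ((2 * t) ^ CARD('n)) \<le> ennreal A * ennreal (w y)"
        using A0[OF cube[OF t, of x]] unfolding average_infnorm_cball[OF w' ae t]
        by (elim order_trans) (intro mult_mono ennreal_leI, auto simp: A_def)
      also have "\<dots> = ennreal (A * w y)"
        using weight by (subst ennreal_mult) (auto simp: A_def weight_def less_imp_le)
      finally have "ballint t ?w x \<le> ennreal (A * w y) * ennreal ((2 * t) ^ CARD('n))"
        using t by (intro times) auto
      also have "\<dots> = ennreal (A * (2 * t) ^ CARD('n)) * ennreal (w y)"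
        using t weight by (simp add: A_def weight_def less_imp_le ennreal_mult mult_ac)
      finally show ?thesis .
    qed
    have "muckenhoupt p ?w A"
    proof
      fix \<phi> :: "real ^ 'n \<Rightarrow> ennreal" and t :: real and x :: "real ^ 'n"
      assume [measurable]: "\<phi> \<in> borel_measurable borel" and t: "0 < t"
      have "ballint t \<phi> x * ballint t ?w x = (\<integral>\<^sup>+y. indicator {..t} (infnorm (x - y)) * \<phi> y * ballint t ?w x \<partial>lborel)"
        unfolding radconv_def[of _ \<phi>] by (subst nn_integral_multc) auto
      also have "\<dots> \<le> (\<integral>\<^sup>+y. ennreal (A * (2 * t) ^ CARD('n)) * (indicator {..t} (infnorm (x - y)) * (\<phi> y * ?w y)) \<partial>lborel)"
      proof (intro nn_integral_mono_AE, use ae in eventually_elim)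
        fix y assume eq: "w y = w' y"
        show "indicator {..t} (infnorm (x - y)) * \<phi> y * ballint t ?w x
            \<le> ennreal (A * (2 * t) ^ CARD('n)) * (indicator {..t} (infnorm (x - y)) * (\<phi> y * ?w y))"
        proof (cases "infnorm (x - y) \<le> t")
          case True
          have "\<phi> y * ballint t ?w x \<le> \<phi> y * (ennreal (A * (2 * t) ^ CARD('n)) * ennreal (w y))"
            by (intro mult_left_mono le t True) auto
          then show ?thesis
            using True by (simp add: eq mult_ac)
        qed simp
      qed
      also have "\<dots> = ennreal (A * (2 * t) ^ CARD('n)) * ballint t (\<lambda>y. \<phi> y * ?w y) x"
        unfolding radconv_def by (rule nn_integral_cmult) measurable
      finally show "epowr (ballint t \<phi> x) p * ballint t ?w x
          \<le> ennreal (A * ((2 * t) ^ CARD('n)) powr p) * ballint t (\<lambda>y. epowr (\<phi> y) p * ?w y) x"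
        using t True by simp
    qed (use p fin ball_pos[of _ w'] pos in \<open>auto simp: A_def\<close>)
    then show ?thesis
      by (rule that)
  next
    case False
    then have p1: "1 < p"
      using p by simp
    define \<sigma> where "\<sigma> x = w' x powr (- 1 / (p - 1))" for x
    have [measurable]: "\<sigma> \<in> borel_measurable borel"
      unfolding \<sigma>_def by measurable
    have \<sigma>_pos: "0 < \<sigma> x" for x
      using pos[of x] by (simp add: \<sigma>_def)
    have ae_\<sigma>: "AE x in lborel. w x powr (- 1 / (p - 1)) = \<sigma> x"
      using ae by (auto elim!: eventually_mono simp: \<sigma>_def)
    obtain A0 where A0: "\<And>Q. Q \<in> cubes \<Longrightarrow>
        average Q w * epowr (average Q (\<lambda>x. w x powr (- 1 / (p - 1)))) (p - 1) \<le> ennreal A0"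
      using w False by (auto simp: Ap_weight_def)
    define A where "A = max A0 1"
    let ?\<sigma> = "\<lambda>x. ennreal (\<sigma> x)"
    have "muckenhoupt p ?w A"
    proof
      fix \<phi> :: "real ^ 'n \<Rightarrow> ennreal" and t :: real and x :: "real ^ 'n"
      assume [measurable]: "\<phi> \<in> borel_measurable borel" and t: "0 < t"
      define V where "V = (2 * t) ^ CARD('n)"
      have V: "0 < V"
        using t by (simp add: V_def)
      let ?W = "ballint t ?w x" and ?S = "ballint t ?\<sigma> x"
      obtain W where W: "?W = ennreal W" "0 < W"
        using fin[of t x] ball_pos[OF t pos w', where x = x] by (cases ?W) auto
      have "?W / ennreal V * epowr (?S / ennreal V) (p - 1) \<le> ennreal A0"
        using A0[OF cube[OF t, of x]] unfolding V_def average_infnorm_cball[OF w' ae t]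
        by (subst (asm) average_infnorm_cball[OF _ ae_\<sigma> t]) auto
      also have "\<dots> \<le> ennreal A"
        by (intro ennreal_leI) (simp add: A_def)
      finally have A: "ennreal (W / V) * epowr (?S / ennreal V) (p - 1) \<le> ennreal A"
        using W V by (simp add: divide_ennreal)
      \<comment> \<open>Integrability of the dual weight is a consequence of the A_p bound: as the
        average of \<open>w\<close> is positive, an infinite \<open>?S\<close> would make the
        product infinite.\<close>
      have "?S \<noteq> top"
      proof
        assume "?S = top"
        then have "ennreal (W / V) * epowr (?S / ennreal V) (p - 1) = top"
          using W V by (simp add: ennreal_top_divide ennreal_mult_top)
        then show False
          using A by (simp add: top_unique)
      qed
      then obtain S where S: "?S = ennreal S" "0 < S"
        using ball_pos[of t \<sigma> x] t \<sigma>_pos by (cases ?S) auto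
      have A_real: "W * S powr (p - 1) \<le> A * V powr p"
      proof -
        have "W / V * (S / V) powr (p - 1) \<le> A"
          using A S W V by (simp add: divide_ennreal epowr_ennreal A_def ennreal_le_iff flip: ennreal_mult)
        then have "W / V * (S powr (p - 1) / V powr (p - 1)) \<le> A"
          using S V by (simp add: powr_divide)
        moreover have "V * V powr (p - 1) = V powr p"
          using V by (simp add: powr_mult_base)
        ultimately show ?thesis
          using V by (simp add: field_simps)
      qed
      define M where "M = density lborel (\<lambda>y. indicator {..t} (infnorm (x - y)) * ?\<sigma> y)"
      have [measurable_cong]: "sets M = sets borel"
        by (simp add: M_def)
      have mass: "emeasure M (space M) = ennreal S"
        unfolding M_def S(1)[symmetric] by (simp add: emeasure_density radconv_def)
      have cancel: "ennreal (\<sigma> y) * (\<phi> y / ennreal (\<sigma> y)) = \<phi> y" for y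
        using \<sigma>_pos[of y] by (simp add: ennreal_times_divide mult.commute[of "ennreal (\<sigma> y)"] ennreal_mult_divide_eq)
      have int1: "(\<integral>\<^sup>+y. \<phi> y / ennreal (\<sigma> y) \<partial>M) = ballint t \<phi> x"
        unfolding M_def radconv_def by (subst nn_integral_density) (auto simp: mult.assoc cancel)
      have int2: "(\<integral>\<^sup>+y. epowr (\<phi> y / ennreal (\<sigma> y)) p \<partial>M) = ballint t (\<lambda>y. epowr (\<phi> y) p * ?w y) x"
      proof -
        have "ennreal (\<sigma> y) * epowr (\<phi> y / ennreal (\<sigma> y)) p = epowr (\<phi> y) p * ?w y" for y
        proof -
          have "\<phi> y / ennreal (\<sigma> y) = \<phi> y * ennreal (1 / \<sigma> y)"
            using \<sigma>_pos[of y] by (simp add: divide_ennreal_def inverse_ennreal inverse_eq_divide)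
          then have "ennreal (\<sigma> y) * epowr (\<phi> y / ennreal (\<sigma> y)) p = epowr (\<phi> y) p * ennreal (\<sigma> y * (1 / \<sigma> y) powr p)"
            using \<sigma>_pos[of y] p1 by (simp add: epowr_mult epowr_ennreal ennreal_mult mult_ac)
          also have "\<sigma> y * (1 / \<sigma> y) powr p = w' y"
          proof -
            have "\<sigma> y * (1 / \<sigma> y) powr p = \<sigma> y powr (1 - p)"
              using \<sigma>_pos[of y] by (simp add: powr_divide powr_diff)
            also have "\<dots> = w' y powr (- 1 / (p - 1) * (1 - p))"
              by (simp add: \<sigma>_def powr_powr)
            also have "- 1 / (p - 1) * (1 - p) = 1"
              using p1 by (simp add: field_simps)
            finally show ?thesis
              using pos[of y] by simp
          qed
          finally show ?thesis .
        qed
        then show ?thesis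
          unfolding M_def radconv_def by (subst nn_integral_density) (auto simp: mult.assoc)
      qed
      have "epowr (ballint t \<phi> x) p * ennreal S \<le> ennreal (S powr p) * ballint t (\<lambda>y. epowr (\<phi> y) p * ?w y) x"
        using nn_integral_Jensen[of "\<lambda>y. \<phi> y / ennreal (\<sigma> y)" M p] p S
        unfolding int1 int2 mass by (simp add: epowr_ennreal)
      then have "epowr (ballint t \<phi> x) p * ennreal S * ennreal (W / S)
          \<le> ennreal (S powr p) * ballint t (\<lambda>y. epowr (\<phi> y) p * ?w y) x * ennreal (W / S)"
        by (rule mult_right_mono) simp
      moreover have "epowr (ballint t \<phi> x) p * ennreal S * ennreal (W / S) = epowr (ballint t \<phi> x) p * ?W"
        using S W by (simp add: mult.assoc flip: ennreal_mult)
      moreover have "ennreal (S powr p) * ballint t (\<lambda>y. epowr (\<phi> y) p * ?w y) x * ennreal (W / S)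
          = ennreal (W * S powr (p - 1)) * ballint t (\<lambda>y. epowr (\<phi> y) p * ?w y) x"
      proof -
        have "S powr p * (W / S) = W * S powr (p - 1)"
          using S by (simp add: powr_diff)
        then have "ennreal (S powr p) * ennreal (W / S) = ennreal (W * S powr (p - 1))"
          using S W by (simp flip: ennreal_mult)
        moreover have "ennreal (S powr p) * ballint t (\<lambda>y. epowr (\<phi> y) p * ?w y) x * ennreal (W / S)
            = ennreal (S powr p) * ennreal (W / S) * ballint t (\<lambda>y. epowr (\<phi> y) p * ?w y) x"
          by (simp only: mult_ac)
        ultimately show ?thesis
          by (simp only:)
      qed
      moreover have "ennreal (W * S powr (p - 1)) * ballint t (\<lambda>y. epowr (\<phi> y) p * ?w y) x
          \<le> ennreal (A * V powr p) * ballint t (\<lambda>y. epowr (\<phi> y) p * ?w y) x"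
        by (intro mult_right_mono ennreal_leI A_real) auto
      ultimately show "epowr (ballint t \<phi> x) p * ?W
          \<le> ennreal (A * ((2 * t) ^ CARD('n)) powr p) * ballint t (\<lambda>y. epowr (\<phi> y) p * ?w y) x"
        unfolding V_def by simp
    qed (use p fin ball_pos[of _ w'] pos in \<open>auto simp: A_def\<close>)
    then show ?thesis
      by (rule that)
  qed
qed

section \<open>Lebesgue measurable data\<close>

lemma complex_borel_representative:
  fixes f :: "'a::euclidean_space \<Rightarrow> complex"
  assumes "f \<in> borel_measurable lebesgue"
  obtains f' where "f' \<in> borel_measurable borel" "AE x in lborel. f x = f' x"
proof -
  have "(\<lambda>x. Re (f x)) \<in> borel_measurable lebesgue" "(\<lambda>x. Im (f x)) \<in> borel_measurable lebesgue"
    using assms by measurable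
  then obtain u v where [measurable]: "u \<in> borel_measurable borel" "v \<in> borel_measurable borel"
    and "AE x in lborel. Re (f x) = u x" "AE x in lborel. Im (f x) = v x"
    by (auto dest!: completion_ex_borel_measurable_real)
  then have "AE x in lborel. f x = Complex (u x) (v x)"
    by (auto elim: AE_mp simp: complex_eq_iff)
  moreover have "(\<lambda>x. Complex (u x) (v x)) \<in> borel_measurable borel"
    unfolding Complex_eq by measurable
  ultimately show ?thesis
    by (rule that[rotated])
qed

text \<open>Measurability follows from local integrability by exhausting the space with balls.
  Changing the Borel version to 1 where it is not positive affects a null set and makes it positive
  everywhere.\<close>

lemma weight_borel_representative:
  fixes w :: "real ^ 'n::finite \<Rightarrow> real"
  assumes w: "weight w"
  obtains w' where "w' \<in> borel_measurable borel" "AE x in lborel. w x = w' x" "\<And>x. 0 < w' x"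
proof -
  have "w \<in> borel_measurable lebesgue"
  proof (rule borel_measurable_LIMSEQ_real)
    fix x :: "real ^ 'n"
    obtain k0 :: nat where "norm x \<le> real k0"
      using real_arch_simple by blast
    then have "\<forall>\<^sub>F k in sequentially. indicator (cball 0 (real k)) x *\<^sub>R w x = w x"
      by (auto simp: eventually_sequentially intro!: exI[of _ k0])
    then show "(\<lambda>k. indicator (cball 0 (real k)) x *\<^sub>R w x) \<longlonglongrightarrow> w x"
      by (rule tendsto_eventually)
  next
    fix k :: nat
    have "w absolutely_integrable_on cball 0 (real k)"
      using w by (simp add: weight_def)
    then show "(\<lambda>x. indicator (cball 0 (real k)) x *\<^sub>R w x) \<in> borel_measurable lebesgue"
      unfolding set_integrable_def by (rule borel_measurable_integrable)
  qed
  then obtain u where [measurable]: "u \<in> borel_measurable borel" and u: "AE x in lborel. w x = u x"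
    by (auto dest!: completion_ex_borel_measurable_real)
  show ?thesis
  proof (rule that[of "\<lambda>x. if 0 < u x then u x else 1"])
    show "AE x in lborel. w x = (if 0 < u x then u x else 1)"
      using u by eventually_elim (use w in \<open>metis weight_def\<close>)
  qed auto
qed

lemma Lp_norm_eq_wint:
  assumes "AE x in lborel. w x = w' x" "\<And>x. 0 < w' x"
  shows "Lp_norm p w f = epowr (wint p (\<lambda>x. ennreal (w' x)) (eabs f)) (1 / p)"
proof -
  have "(\<integral>\<^sup>+x. ennreal (cmod (f x) powr p * w x) \<partial>lborel) = wint p (\<lambda>x. ennreal (w' x)) (eabs f)"
    unfolding wint_def using assms(1)
  proof (intro nn_integral_cong_AE, eventually_elim)
    case (elim x)
    then show ?case
      using assms(2)[of x] by (simp add: epowr_ennreal ennreal_mult)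
  qed
  then show ?thesis
    by (simp add: Lp_norm_def nn_integral_completion)
qed

lemma wint_cong_AE:
  assumes "AE x in lborel. \<phi> x = \<psi> x"
  shows "wint p w \<phi> = wint p w \<psi>"
  unfolding wint_def using assms by (intro nn_integral_cong_AE) (auto elim!: eventually_mono)

text \<open>Passing to \<open>p\<close>-th powers replaces \<open>C\<close> by
  \<open>C powr p\<close>, and the converse takes the \<open>p\<close>-th root.\<close>

lemma has_stability_iff_wint:
  assumes "AE x in lborel. w x = w' x" "\<And>x. 0 < w' x" and p: "1 \<le> p"
  defines "W \<equiv> wint p (\<lambda>x. ennreal (w' x))"
  shows "has_stability S p w \<longleftrightarrow>
    (\<exists>C>0. \<forall>f\<in>borel_measurable lebesgue. W (eabs f) < top \<longrightarrow> ennreal C * W (eabs f) \<le> W (eabs (S f)))"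
    (is "_ \<longleftrightarrow> ?R")
proof
  have eq: "Lp_norm p w f = epowr (W (eabs f)) (1 / p)" for f
    unfolding W_def by (rule Lp_norm_eq_wint[OF assms(1,2)])
  have le_iff: "ennreal C * Lp_norm p w f \<le> Lp_norm p w (S f)
      \<longleftrightarrow> ennreal (C powr p) * W (eabs f) \<le> W (eabs (S f))" if "0 < C" for C f
  proof -
    have "ennreal C * Lp_norm p w f = epowr (ennreal (C powr p) * W (eabs f)) (1 / p)"
      using p that by (simp add: eq epowr_mult epowr_ennreal powr_powr)
    then show ?thesis
      using p by (simp add: eq epowr_le_iff)
  qed
  {
    assume "has_stability S p w"
    then obtain C where C: "0 < C" "\<And>f. f \<in> Lp_space p w \<Longrightarrow> ennreal C * Lp_norm p w f \<le> Lp_norm p w (S f)"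
      unfolding has_stability_def by blast
    then have "ennreal (C powr p) * W (eabs f) \<le> W (eabs (S f))"
      if "f \<in> borel_measurable lebesgue" "W (eabs f) < top" for f
      using that by (subst le_iff[symmetric]) (auto simp: Lp_space_def eq)
    then show ?R
      using C(1) by (intro exI[of _ "C powr p"]) auto
  next
    assume ?R
    then obtain C where C: "0 < C" "\<And>f. f \<in> borel_measurable lebesgue \<Longrightarrow> W (eabs f) < top \<Longrightarrow>
        ennreal C * W (eabs f) \<le> W (eabs (S f))"
      by blast
    have "ennreal (C powr (1 / p)) * Lp_norm p w f \<le> Lp_norm p w (S f)" if "f \<in> Lp_space p w" for f
      using C that p by (subst le_iff) (auto simp: Lp_space_def eq powr_powr)
    then show "has_stability S p w"
      unfolding has_stability_def using C(1) by (intro exI[of _ "C powr (1 / p)"]) auto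
  }
qed

section \<open>Passage to Borel kernels and functions\<close>

text \<open>\<open>radial_sup\<close> depends on its argument only through the norm; as a function
  of that number it fits \<open>radmass\<close> and \<open>antimono\<close>. At nonpositive
  \<open>t\<close> it is the supremum over all pairs.\<close>

definition radial_profile :: "(real ^ 'n::finite \<Rightarrow> real ^ 'n \<Rightarrow> ennreal) \<Rightarrow> real \<Rightarrow> ennreal" where
  "radial_profile M t = (SUP (y, y') \<in> {(y, y'). infnorm (y - y') \<ge> t}. M y y')"

lemma radial_sup_eq: "radial_sup M x = radial_profile M (infnorm x)"
  by (simp add: radial_sup_def radial_profile_def)

lemma antimono_radial_profile: "antimono (radial_profile M)"
  unfolding radial_profile_def by (intro antimonoI SUP_subset_mono) auto

lemma radial_profile_upper: "t \<le> infnorm (x - y) \<Longrightarrow> M x y \<le> radial_profile M t"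
  unfolding radial_profile_def by (rule SUP_upper2[of "(x, y)"]) auto

lemma L1_norm_radial_sup:
  "L1_norm (radial_sup M) = radmass TYPE('n) (radial_profile (M :: real ^ 'n::finite \<Rightarrow> _))"
  by (simp add: L1_norm_def radmass_def nn_integral_completion radial_sup_eq)

lemma L1_norm_radial_sup_indicator:
  "L1_norm (\<lambda>x. radial_sup M x * indicator {x. infnorm x \<le> \<delta>} x)
    = radmass TYPE('n) (\<lambda>t. radial_profile (M :: real ^ 'n::finite \<Rightarrow> _) t * indicator {..\<delta>} t)"
  unfolding L1_norm_def radmass_def nn_integral_completion radial_sup_eq
  by (intro nn_integral_cong) (auto simp: indicator_def)

text \<open>Take a Borel version on the product space and set it to 0 where it violates the bound.
  As \<open>K\<close> satisfies the bound everywhere, nothing changes where the two agree. Fubini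
  turns agreement almost everywhere on the product into agreement on almost all sections.\<close>

lemma dominated_borel_representative:
  fixes K :: "'n::finite kernel"
  assumes K: "kernel_function K" and fin: "radmass TYPE('n) (radial_profile (kernel_abs K)) < top"
  obtains K' where "dominated_kernel K' (radial_profile (kernel_abs K))"
    "AE x in lborel. AE y in lborel. K x y = K' x y"
proof -
  let ?r = "radial_profile (kernel_abs K)"
  note [measurable] = measurable_antimono[OF antimono_radial_profile]
  have "case_prod K \<in> borel_measurable lebesgue"
    using K by (simp add: kernel_function_def)
  then obtain K0 where [measurable]: "K0 \<in> borel_measurable borel" and K0: "AE z in lborel. case_prod K z = K0 z"
    by (rule complex_borel_representative)
  define K' where "K' x y = (if ennreal (cmod (K0 (x, y))) \<le> ?r (infnorm (x - y)) then K0 (x, y) else 0)" for x y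
  have "AE z in lborel \<Otimes>\<^sub>M lborel. case_prod K z = K0 z"
    unfolding lborel_prod by (rule K0)
  then have "AE x in lborel. AE y in lborel. case_prod K (x, y) = K0 (x, y)"
    by (rule lborel_pair.AE_pair)
  moreover have "K x y = K' x y" if "case_prod K (x, y) = K0 (x, y)" for x y
    using that radial_profile_upper[of "infnorm (x - y)" x y "kernel_abs K"] by (auto simp: K'_def kernel_abs_def)
  ultimately have "AE x in lborel. AE y in lborel. K x y = K' x y"
    by (auto elim!: eventually_mono)
  moreover have "dominated_kernel K' ?r"
  proof
    have [measurable]: "K0 \<in> borel_measurable (borel \<Otimes>\<^sub>M borel)"
      by (simp add: borel_prod)
    show "(\<lambda>(x, y). K' x y) \<in> borel_measurable (borel \<Otimes>\<^sub>M borel)"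
      unfolding K'_def by measurable
  qed (auto simp: K'_def antimono_radial_profile fin)
  ultimately show ?thesis
    by (rule that[rotated])
qed

text \<open>For almost every \<open>x\<close> the two integrands agree almost everywhere.
  Measurability of the integrand with \<open>K\<close> and \<open>f\<close> follows from that of the
  Borel one by completeness.\<close>

lemma integral_operator_eq_kernel_op:
  fixes K :: "'n::finite kernel"
  assumes "dominated_kernel K' r" and K: "AE x in lborel. AE y in lborel. K x y = K' x y"
    and [measurable]: "f' \<in> borel_measurable borel" and f: "AE x in lborel. f x = f' x"
  shows "AE x in lborel. integral_operator K f x = kernel_op K' f' x"
  using K
proof eventually_elim
  case (elim x)
  interpret dominated_kernel K' r
    by fact
  have meas: "(\<lambda>y. K' x y * f' y) \<in> borel_measurable borel"
    by measurable
  have ae: "AE y in lebesgue. K' x y * f' y = K x y * f y"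
    using elim f by (intro AE_completion) (auto elim!: eventually_elim2)
  have "integral_operator K f x = (LINT y|lebesgue. K' x y * f' y)"
    unfolding integral_operator_def
  proof (rule integral_cong_AE)
    show "(\<lambda>y. K' x y * f' y) \<in> borel_measurable lebesgue"
      using meas by (simp add: measurable_completion)
    then show "(\<lambda>y. K x y * f y) \<in> borel_measurable lebesgue"
      using ae by (rule borel_measurable_AE)
    show "AE y in lebesgue. K x y * f y = K' x y * f' y"
      using ae by (auto elim!: eventually_mono)
  qed
  also have "\<dots> = kernel_op K' f' x"
    unfolding kernel_op_def using meas by (intro integral_completion) auto
  finally show ?case .
qed

section \<open>The case z = 0\<close>

lemma lborel_integral_odd_eq_0:
  fixes f :: "real ^ 'n::finite \<Rightarrow> complex"
  assumes [measurable]: "f \<in> borel_measurable borel" and odd: "\<And>x. f (- x) = - f x"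
  shows "(LINT x|lborel. f x) = 0"
proof -
  have "(LINT x|lborel. f x) = (LINT x|density (distr lborel borel (\<lambda>x. 0 + (- 1) *\<^sub>R x)) (\<lambda>_. ennreal (\<bar>- 1\<bar> ^ DIM(real ^ 'n))). f x)"
    by (rule arg_cong[where f = "\<lambda>M. integral\<^sup>L M f"]) (rule lborel_affine, simp)
  also have "\<dots> = (LINT x|lborel. f (- x))"
    by (simp add: density_1 integral_distr)
  also have "\<dots> = - (LINT x|lborel. f x)"
    by (simp add: odd)
  finally show ?thesis by simp
qed

text \<open>The sign of one coordinate gives mean zero by symmetry, while the modulus is almost
  everywhere the indicator of the cube, so the power of the weighted norm is exactly the weight of
  the cube.\<close>

definition odd_bump :: "'n::finite \<Rightarrow> real \<Rightarrow> real ^ 'n \<Rightarrow> complex" where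
  "odd_bump i \<delta> y = (if infnorm y \<le> \<delta> then of_real (sgn (y $ i)) else 0)"

lemma measurable_odd_bump [measurable]: "odd_bump i \<delta> \<in> borel_measurable borel"
  unfolding odd_bump_def by measurable

lemma eabs_odd_bump_le: "eabs (odd_bump i \<delta>) y \<le> indicator {..\<delta>} (infnorm y)"
  by (auto simp: odd_bump_def indicator_def sgn_if)

lemma AE_eabs_odd_bump:
  fixes i :: "'n::finite"
  shows "AE y in lborel. eabs (odd_bump i \<delta>) y = indicator {..\<delta>} (infnorm y)"
proof -
  have "AE y in lborel. (y :: real ^ 'n) \<bullet> axis i 1 \<noteq> 0"
    by (rule AE_lborel_inner_neq) (simp add: axis_in_Basis_iff)
  then show ?thesis
    by eventually_elim (auto simp: odd_bump_def indicator_def inner_axis sgn_if)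
qed

text \<open>Since \<open>odd_bump\<close> has mean zero, away from its support \<open>K(x,y)\<close> may be replaced by
  \<open>K(x,y) - K(x,0)\<close>, which the modulus of continuity controls.\<close>
lemma integral_operator_odd_bump_le:
  fixes K :: "'n::finite kernel" and x :: "real ^ 'n"
  assumes \<delta>: "0 < \<delta>"
  shows "eabs (integral_operator K (odd_bump i \<delta>)) x
    \<le> radconv (\<lambda>t. radial_profile (mod_continuity \<delta> K) t + radial_profile (kernel_abs K) t * indicator {..6 * \<delta>} t)
        (\<lambda>y. indicator {..\<delta>} (infnorm y)) x" (is "_ \<le> radconv ?\<rho> ?I x")
proof (cases "integrable lebesgue (\<lambda>y. K x y * odd_bump i \<delta> y)")
  \<comment> \<open>The operator then takes the default value 0 at \<open>x\<close>.\<close>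
  case False
  then show ?thesis
    by (simp add: integral_operator_def not_integrable_integral_eq)
next
  case True
  show ?thesis
  \<comment> \<open>For |x| < 5\<delta> all relevant distances |x - y| are at most 6\<delta>, the
    range of the diagonal term; otherwise they are at least 4\<delta>, where the modulus of
    continuity is not set to 0.\<close>
  proof (cases "infnorm x < 5 * \<delta>")
    case near: True
    have "eabs (integral_operator K (odd_bump i \<delta>)) x \<le> (\<integral>\<^sup>+y. ennreal (cmod (K x y * odd_bump i \<delta> y)) \<partial>lebesgue)"
      unfolding integral_operator_def using True by (rule integral_norm_bound_ennreal)
    also have "\<dots> \<le> radconv ?\<rho> ?I x"
      unfolding nn_integral_completion radconv_def
    proof (intro nn_integral_mono)
      fix y
      show "ennreal (cmod (K x y * odd_bump i \<delta> y)) \<le> ?\<rho> (infnorm (x - y)) * ?I y"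
      proof (cases "infnorm y \<le> \<delta>")
        case True
        then have "infnorm (x - y) \<le> 6 * \<delta>"
          using near infnorm_triangle_sub[of x y 0] by (simp add: infnorm_neg)
        then have "ennreal (cmod (K x y)) \<le> ?\<rho> (infnorm (x - y))"
          using radial_profile_upper[of "infnorm (x - y)" x y "kernel_abs K"]
          by (simp add: kernel_abs_def add_increasing)
        then have "ennreal (cmod (K x y)) * eabs (odd_bump i \<delta>) y \<le> ?\<rho> (infnorm (x - y)) * ?I y"
          by (intro mult_mono eabs_odd_bump_le) auto
        then show ?thesis
          by (simp add: norm_mult ennreal_mult)
      qed (simp add: odd_bump_def)
    qed
    finally show ?thesis .
  next
    case far: False
    have int: "integrable lebesgue (\<lambda>y. K x 0 * odd_bump i \<delta> y)"
    proof -
      have "(\<integral>\<^sup>+y. eabs (odd_bump i \<delta>) y \<partial>lborel) \<le> radmass TYPE('n) (indicator {..\<delta>})"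
        unfolding radmass_def by (intro nn_integral_mono eabs_odd_bump_le)
      then have "integrable lborel (odd_bump i \<delta>)"
        using \<delta> by (intro integrableI_bounded) (auto simp: radmass_indicator intro: le_less_trans)
      then have "integrable lebesgue (odd_bump i \<delta>)"
        by (simp add: integrable_completion)
      then show ?thesis by simp
    qed
    have "(LINT y|lebesgue. odd_bump i \<delta> y) = (LINT y|lborel. odd_bump i \<delta> y)"
      by (rule integral_completion) simp
    also have "\<dots> = 0"
      by (rule lborel_integral_odd_eq_0) (auto simp: odd_bump_def infnorm_neg sgn_minus)
    finally have "(LINT y|lebesgue. K x 0 * odd_bump i \<delta> y) = 0"
      by simp
    then have "integral_operator K (odd_bump i \<delta>) x = (LINT y|lebesgue. K x y * odd_bump i \<delta> y - K x 0 * odd_bump i \<delta> y)"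
      unfolding integral_operator_def using True int by (subst Bochner_Integration.integral_diff) auto
    then have "eabs (integral_operator K (odd_bump i \<delta>)) x
        \<le> (\<integral>\<^sup>+y. ennreal (cmod (K x y * odd_bump i \<delta> y - K x 0 * odd_bump i \<delta> y)) \<partial>lebesgue)"
      using True int by (simp only:) (intro integral_norm_bound_ennreal Bochner_Integration.integrable_diff)
    also have "\<dots> \<le> radconv ?\<rho> ?I x"
      unfolding nn_integral_completion radconv_def
    proof (intro nn_integral_mono)
      fix y
      show "ennreal (cmod (K x y * odd_bump i \<delta> y - K x 0 * odd_bump i \<delta> y)) \<le> ?\<rho> (infnorm (x - y)) * ?I y"
      proof (cases "infnorm y \<le> \<delta>")
        case True
        then have "4 * \<delta> \<le> infnorm (x - y)"
          using far infnorm_triangle_sub[of x 0 y] by simp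
        then have "ennreal (cmod (K x 0 - K x y)) \<le> mod_continuity \<delta> K x y"
          unfolding mod_continuity_def using True \<delta>
          by (auto intro!: SUP_upper2[of "(x, 0)"] simp: infnorm_neg infnorm_0)
        also have "\<dots> \<le> ?\<rho> (infnorm (x - y))"
          by (intro add_increasing2 radial_profile_upper) auto
        finally have "ennreal (cmod (K x 0 - K x y)) * eabs (odd_bump i \<delta>) y \<le> ?\<rho> (infnorm (x - y)) * ?I y"
          by (intro mult_mono eabs_odd_bump_le) auto
        moreover have "K x y * odd_bump i \<delta> y - K x 0 * odd_bump i \<delta> y = - ((K x 0 - K x y) * odd_bump i \<delta> y)"
          by (simp add: algebra_simps)
        ultimately show ?thesis
          by (simp only: norm_minus_cancel norm_mult) (simp add: ennreal_mult)
      qed (simp add: odd_bump_def)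
    qed
    finally show ?thesis .
  qed
qed

lemma le_powr_of_SUP_le:
  fixes X :: "real \<Rightarrow> ennreal"
  assumes "(SUP \<delta>\<in>{0<..1::real}. ennreal (\<delta> powr - \<alpha>) * X \<delta>) \<le> ennreal M" and \<delta>: "0 < \<delta>" "\<delta> \<le> 1" and M: "0 \<le> M"
  shows "X \<delta> \<le> ennreal (M * \<delta> powr \<alpha>)"
proof -
  have "ennreal (\<delta> powr - \<alpha>) * X \<delta> \<le> ennreal M"
    using \<delta> by (intro order_trans[OF SUP_upper assms(1)]) auto
  then have le: "ennreal (\<delta> powr \<alpha>) * (ennreal (\<delta> powr - \<alpha>) * X \<delta>) \<le> ennreal (\<delta> powr \<alpha>) * ennreal M"
    by (rule mult_left_mono) simp
  have "ennreal (\<delta> powr \<alpha>) * ennreal (\<delta> powr - \<alpha>) = 1"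
    using \<delta> by (simp add: powr_minus ennreal_mult[symmetric])
  with le have "X \<delta> \<le> ennreal (\<delta> powr \<alpha>) * ennreal M"
    unfolding mult.assoc[symmetric] by simp
  also have "\<dots> = ennreal (M * \<delta> powr \<alpha>)"
    using M by (subst ennreal_mult[symmetric]) (auto simp: mult.commute)
  finally show ?thesis .
qed

text \<open>Test the operator on a mean zero bump at scale \<open>\<delta> \<rightarrow> 0\<close>.\<close>
lemma not_stable_zero:
  fixes K :: "'n::finite kernel" and w :: "real ^ 'n \<Rightarrow> real"
  assumes \<alpha>: "0 < \<alpha>" and M: "0 \<le> M"
    and cont: "\<And>\<delta>. 0 < \<delta> \<Longrightarrow> \<delta> \<le> 1 \<Longrightarrow>
      radmass TYPE('n) (radial_profile (mod_continuity \<delta> K)) \<le> ennreal (M * \<delta> powr \<alpha>)"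
    and diag: "\<And>\<delta>. 0 < \<delta> \<Longrightarrow> \<delta> \<le> 1 \<Longrightarrow>
      radmass TYPE('n) (\<lambda>t. radial_profile (kernel_abs K) t * indicator {..\<delta>} t) \<le> ennreal (M * \<delta> powr \<alpha>)"
    and w: "AE x in lborel. w x = w' x" "\<And>x. 0 < w' x" "muckenhoupt p (\<lambda>x. ennreal (w' x)) A"
  shows "\<not> has_stability (\<lambda>f x. 0 * f x - integral_operator K f x) p w"
proof
  interpret muckenhoupt p "\<lambda>x. ennreal (w' x)" A
    by fact
  let ?W = "wint p (\<lambda>x. ennreal (w' x))"
  assume "has_stability (\<lambda>f x. 0 * f x - integral_operator K f x) p w"
  then obtain C where C: "0 < C" and stable: "\<And>f. f \<in> borel_measurable lebesgue \<Longrightarrow> ?W (eabs f) < top \<Longrightarrow>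
      ennreal C * ?W (eabs f) \<le> ?W (eabs (\<lambda>x. 0 * f x - integral_operator K f x))"
    unfolding has_stability_iff_wint[OF w(1,2) p] by blast
  \<comment> \<open>Chosen so that \<open>conv_const * e powr p = C / 2\<close>, half the assumed
    stability constant.\<close>
  define e where "e = (C / (2 * conv_const)) powr (1 / p)"
  have e: "0 < e"
    using C conv_const_pos by (simp add: e_def)
  \<comment> \<open>This makes (2M + 1) s^\<alpha> at most \<open>e\<close>; the 1 avoids division
    by zero. Then \<delta> = s / 6, because the diagonal bound is used at radius 6\<delta>.\<close>
  define s where "s = min 1 ((e / (2 * M + 1)) powr (1 / \<alpha>))"
  have s: "0 < s" "s \<le> 1"
    using e M by (auto simp: s_def)
  define \<delta> where "\<delta> = s / 6"
  have \<delta>: "0 < \<delta>" "\<delta> \<le> 1" "6 * \<delta> = s"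
    using s by (auto simp: \<delta>_def)
  let ?\<rho> = "\<lambda>t. radial_profile (mod_continuity \<delta> K) t + radial_profile (kernel_abs K) t * indicator {..6 * \<delta>} t"
  let ?I = "\<lambda>y :: real ^ 'n. indicator {..\<delta>} (infnorm y) :: ennreal"
  note [measurable] = measurable_antimono[OF antimono_radial_profile]
  have "s powr \<alpha> \<le> ((e / (2 * M + 1)) powr (1 / \<alpha>)) powr \<alpha>"
    using s \<alpha> by (intro powr_mono2) (auto simp: s_def)
  also have "\<dots> = e / (2 * M + 1)"
    using \<alpha> e M by (simp add: powr_powr)
  finally have s_le: "(2 * M + 1) * s powr \<alpha> \<le> e"
    using M by (simp add: pos_le_divide_eq mult.commute)
  have "radmass TYPE('n) ?\<rho> = radmass TYPE('n) (radial_profile (mod_continuity \<delta> K))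
      + radmass TYPE('n) (\<lambda>t. radial_profile (kernel_abs K) t * indicator {..6 * \<delta>} t)"
    by (rule radmass_add) measurable
  also have "\<dots> \<le> ennreal (M * \<delta> powr \<alpha>) + ennreal (M * (6 * \<delta>) powr \<alpha>)"
    using \<delta> s by (intro add_mono cont diag) auto
  also have "\<dots> = ennreal (M * \<delta> powr \<alpha> + M * s powr \<alpha>)"
    unfolding \<delta>(3) using M by (intro ennreal_plus[symmetric]) auto
  also have "\<dots> \<le> ennreal e"
  proof (rule ennreal_leI)
    have "M * \<delta> powr \<alpha> \<le> M * s powr \<alpha>"
      using \<delta> \<alpha> M s by (intro mult_left_mono powr_mono2) auto
    moreover have "0 \<le> s powr \<alpha>"
      by simp
    ultimately show "M * \<delta> powr \<alpha> + M * s powr \<alpha> \<le> e"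
      using s_le unfolding distrib_right by linarith
  qed
  finally have mass: "radmass TYPE('n) ?\<rho> \<le> ennreal e" .
  obtain i :: 'n where True by blast
  let ?f = "odd_bump i \<delta> :: real ^ 'n \<Rightarrow> complex"
  have f_eq: "?W (eabs ?f) = ?W ?I"
    by (rule wint_cong_AE[OF AE_eabs_odd_bump])
  have "?W ?I = ballint \<delta> (\<lambda>x. ennreal (w' x)) 0"
    unfolding wint_def radconv_def by (intro nn_integral_cong) (auto simp: indicator_def infnorm_neg)
  then have I: "0 < ?W ?I" "?W ?I < top"
    using ball_pos[OF \<delta>(1), of 0] ball_finite[of \<delta> 0] by auto
  have "?f \<in> borel_measurable lebesgue"
    by (rule measurable_completion) measurable
  then have "ennreal C * ?W ?I \<le> ?W (eabs (\<lambda>x. 0 * ?f x - integral_operator K ?f x))"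
    using stable[of ?f] I by (simp add: f_eq)
  also have "\<dots> \<le> ?W (radconv ?\<rho> ?I)"
    using integral_operator_odd_bump_le[OF \<delta>(1), of K i] by (intro wint_mono) auto
  also have "\<dots> \<le> ennreal conv_const * epowr (radmass TYPE('n) ?\<rho>) p * ?W ?I"
  proof (rule wint_radconv)
    show "antimono ?\<rho>"
      by (intro antimonoI add_mono mult_mono antimonoD[OF antimono_radial_profile]) (auto simp: indicator_def)
    show "radmass TYPE('n) ?\<rho> < top"
      using mass by (rule le_less_trans) simp
  qed measurable
  also have "\<dots> \<le> ennreal conv_const * epowr (ennreal e) p * ?W ?I"
    by (intro mult_right_mono mult_left_mono epowr_mono mass) auto
  also have "ennreal conv_const * epowr (ennreal e) p = ennreal (C / 2)"
    using C conv_const_pos p e by (simp add: e_def epowr_ennreal powr_powr ennreal_mult[symmetric])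
  finally have "ennreal C \<le> ennreal (C / 2)"
    using I by (subst (asm) mult.commute, subst (asm) mult.commute, subst (asm) ennreal_mult_le_mult_iff) auto
  then show False
    using C by (simp add: ennreal_le_iff)
qed

section \<open>The case of nonzero z and the conclusion\<close>

lemma stability_transfer:
  fixes K :: "'n::finite kernel" and w w' :: "real ^ 'n \<Rightarrow> real"
  assumes K: "kernel_function K" and fin: "radmass TYPE('n) (radial_profile (kernel_abs K)) < top"
    and z: "z \<noteq> 0" and p: "1 \<le> p" "Ap_weight p w" and q: "1 \<le> q" "Ap_weight q v"
    and stab: "has_stability (\<lambda>f x. z * f x - integral_operator K f x) p w"
  shows "has_stability (\<lambda>f x. z * f x - integral_operator K f x) q v"
proof -
  let ?r = "radial_profile (kernel_abs K)"
  let ?S = "\<lambda>f x. z * f x - integral_operator K f x"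
  obtain K' where K': "dominated_kernel K' ?r" and ae_K: "AE x in lborel. AE y in lborel. K x y = K' x y"
    using dominated_borel_representative[OF K fin] by blast
  interpret dominated_kernel K' ?r
    by fact
  have S_eq: "AE x in lborel. eabs (?S f) x = eabs (\<lambda>x. z * f' x - kernel_op K' f' x) x"
    if "f' \<in> borel_measurable borel" "AE x in lborel. f x = f' x" for f f'
    using integral_operator_eq_kernel_op[OF K' ae_K that] that(2) by eventually_elim simp
  obtain w' where w': "w' \<in> borel_measurable borel" "AE x in lborel. w x = w' x" "\<And>x. 0 < w' x"
    using p weight_borel_representative[of w] by (auto simp: Ap_weight_def)
  obtain v' where v': "v' \<in> borel_measurable borel" "AE x in lborel. v x = v' x" "\<And>x. 0 < v' x"
    using q weight_borel_representative[of v] by (auto simp: Ap_weight_def)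
  obtain A where A: "muckenhoupt p (\<lambda>x. ennreal (w' x)) A"
    using Ap_weight_imp_muckenhoupt[OF p(2,1) w'] by blast
  obtain B where B: "muckenhoupt q (\<lambda>x. ennreal (v' x)) B"
    using Ap_weight_imp_muckenhoupt[OF q(2,1) v'] by blast
  let ?W = "wint p (\<lambda>x. ennreal (w' x))" and ?V = "wint q (\<lambda>x. ennreal (v' x))"
  interpret W: muckenhoupt p "\<lambda>x. ennreal (w' x)" A
    by (rule A)
  obtain C0 where C0: "0 < C0" and stable: "\<And>f. f \<in> borel_measurable lebesgue \<Longrightarrow> ?W (eabs f) < top \<Longrightarrow>
      ennreal C0 * ?W (eabs f) \<le> ?W (eabs (?S f))"
    using stab unfolding has_stability_iff_wint[OF w'(2,3) p(1)] by blast
  interpret stable_kernel p "\<lambda>x. ennreal (w' x)" A K' ?r z C0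
  proof
    fix \<phi> :: "real ^ 'n \<Rightarrow> complex" and M R
    assume \<phi> [measurable]: "\<phi> \<in> borel_measurable borel" and M: "\<And>x. cmod (\<phi> x) \<le> M"
      and R: "\<And>x. R < infnorm x \<Longrightarrow> \<phi> x = 0"
    \<comment> \<open>Local integrability of the weight puts bounded functions with bounded support
      into the space, so the assumed stability applies to them.\<close>
    have "?W (eabs \<phi>) \<le> (\<integral>\<^sup>+y. epowr (ennreal M) p * (indicator {..R} (infnorm (0 - y)) * ennreal (w' y)) \<partial>lborel)"
      unfolding wint_def
    proof (intro nn_integral_mono)
      fix y
      show "epowr (eabs \<phi> y) p * ennreal (w' y) \<le> epowr (ennreal M) p * (indicator {..R} (infnorm (0 - y)) * ennreal (w' y))"
      proof (cases "infnorm y \<le> R")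
        case True
        then show ?thesis
          using M[of y] by (auto simp: infnorm_neg intro!: mult_right_mono epowr_mono ennreal_leI)
      qed (use R[of y] in simp)
    qed
    also have "\<dots> = epowr (ennreal M) p * ballint R (\<lambda>y. ennreal (w' y)) 0"
      unfolding radconv_def by (rule nn_integral_cmult) measurable
    also have "\<dots> < top"
      using W.ball_finite[of R 0] by (simp add: ennreal_mult_less_top)
    finally have "ennreal C0 * ?W (eabs \<phi>) \<le> ?W (eabs (?S \<phi>))"
      by (intro stable measurable_completion) auto
    also have "\<dots> = ?W (eabs (\<lambda>x. z * \<phi> x - kernel_op K' \<phi> x))"
      by (intro wint_cong_AE S_eq) auto
    finally show "ennreal C0 * ?W (eabs \<phi>) \<le> ?W (eabs (\<lambda>x. z * \<phi> x - kernel_op K' \<phi> x))" .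
  qed (rule C0)
  obtain C where C: "C < top" and transfer: "\<And>f. \<lbrakk>f \<in> borel_measurable borel; ?V (eabs f) < top\<rbrakk> \<Longrightarrow>
      ?V (eabs f) \<le> C * ?V (eabs (\<lambda>x. z * f x - kernel_op K' f x))"
    using transfer[OF B z] v'(3) by auto
  \<comment> \<open>\<open>C\<close> may be 0; adding 1 gives a constant that can be
    inverted.\<close>
  define c where "c = enn2real C + 1"
  have c: "0 < c" "C \<le> ennreal c"
    using C by (cases C; auto simp: c_def ennreal_leI add_nonneg_pos)+
  have "ennreal (1 / c) * ?V (eabs f) \<le> ?V (eabs (?S f))"
    if f: "f \<in> borel_measurable lebesgue" and finite: "?V (eabs f) < top" for f
  proof -
    obtain f' where f': "f' \<in> borel_measurable borel" "AE x in lborel. f x = f' x"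
      using complex_borel_representative[OF f] by blast
    have eq: "?V (eabs f) = ?V (eabs f')"
      by (intro wint_cong_AE) (use f'(2) in \<open>auto elim!: eventually_mono\<close>)
    have "?V (eabs f') \<le> C * ?V (eabs (\<lambda>x. z * f' x - kernel_op K' f' x))"
      using f' finite by (intro transfer) (auto simp: eq)
    also have "\<dots> = C * ?V (eabs (?S f))"
      by (simp only: wint_cong_AE[OF S_eq[OF f']])
    also have "\<dots> \<le> ennreal c * ?V (eabs (?S f))"
      by (intro mult_right_mono c) auto
    finally have "ennreal (1 / c) * ?V (eabs f') \<le> ennreal (1 / c) * (ennreal c * ?V (eabs (?S f)))"
      by (rule mult_left_mono) simp
    then show ?thesis
      using c(1) by (simp add: eq mult.assoc[symmetric] ennreal_mult[symmetric])
  qed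
  then show ?thesis
    unfolding has_stability_iff_wint[OF v'(2,3) q(1)] using c(1) by (intro exI[of _ "1 / c"]) auto
qed

theorem theorem1p1:
  fixes z :: complex
    and K :: "'n::finite kernel"
    and \<alpha> :: real
    and p :: real
    and w :: "real ^ 'n \<Rightarrow> real"
  defines "T \<equiv> integral_operator K"
  assumes "kernel_function K"
    and "0 < \<alpha>" and "\<alpha> \<le> 1"
    and "L1_norm (radial_sup (kernel_abs K))
         + (SUP \<delta>\<in>{0<..1::real}.
              ennreal (\<delta> powr - \<alpha>) * L1_norm (radial_sup (mod_continuity \<delta> K)))
         + (SUP \<delta>\<in>{0<..1::real}.
              ennreal (\<delta> powr - \<alpha>) *
              L1_norm (\<lambda>x. radial_sup (kernel_abs K) x * indicator {x. infnorm x \<le> \<delta>} x))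
         < \<infinity>"
    and "1 \<le> p" and "Ap_weight p w"
    and "has_stability (\<lambda>f x. z * f x - T f x) p w"
  shows "\<forall>(p'::real) (w' :: real ^ 'n \<Rightarrow> real). 1 \<le> p' \<and> Ap_weight p' w' \<longrightarrow>
           has_stability (\<lambda>f x. z * f x - T f x) p' w'"
proof (intro allI impI, elim conjE)
  fix p' :: real and w' :: "real ^ 'n \<Rightarrow> real"
  assume p': "1 \<le> p'" "Ap_weight p' w'"
  let ?J = "radmass TYPE('n) (radial_profile (kernel_abs K))"
  let ?X = "SUP \<delta>\<in>{0<..1::real}. ennreal (\<delta> powr - \<alpha>) * radmass TYPE('n) (radial_profile (mod_continuity \<delta> K))"
  let ?Y = "SUP \<delta>\<in>{0<..1::real}. ennreal (\<delta> powr - \<alpha>) *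
    radmass TYPE('n) (\<lambda>t. radial_profile (kernel_abs K) t * indicator {..\<delta>} t)"
  have "?J + ?X + ?Y < top"
    using assms(5) unfolding L1_norm_radial_sup L1_norm_radial_sup_indicator by simp
  then have J: "?J < top" and X: "?X < top" and Y: "?Y < top"
    by (simp_all only: ennreal_add_less_top)
  have "z \<noteq> 0"
  proof
    assume z: "z = 0"
    define M where "M = enn2real (?X + ?Y)"
    have "?X + ?Y < top"
      by (simp only: X Y ennreal_add_less_top simp_thms)
    then have M: "0 \<le> M" "?X + ?Y = ennreal M"
      unfolding M_def by (simp_all only: ennreal_enn2real enn2real_nonneg)
    have X_le: "?X \<le> ennreal M" and Y_le: "?Y \<le> ennreal M"
      unfolding M(2)[symmetric] by (simp_all only: add_increasing add_increasing2 order_refl zero_le)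
    obtain u where u: "u \<in> borel_measurable borel" "AE x in lborel. w x = u x" "\<And>x. 0 < u x"
      using assms(7) weight_borel_representative[of w] by (auto simp: Ap_weight_def)
    obtain A where A: "muckenhoupt p (\<lambda>x. ennreal (u x)) A"
      using Ap_weight_imp_muckenhoupt[OF assms(7,6) u] by blast
    have "\<not> has_stability (\<lambda>f x. 0 * f x - integral_operator K f x) p w"
      using le_powr_of_SUP_le[OF X_le _ _ M(1)] le_powr_of_SUP_le[OF Y_le _ _ M(1)]
      by (intro not_stable_zero[OF assms(3) M(1) _ _ u(2,3) A])
    then show False
      using assms(8) by (simp add: T_def z)
  qed
  then show "has_stability (\<lambda>f x. z * f x - T f x) p' w'"
    using assms(8) unfolding T_def by (intro stability_transfer[OF assms(2) J _ assms(6,7) p'])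
qed

end
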